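(* Let $s\in(0,1)$, $N\ge 2$, $\gamma>0$, let $\Omega\subset\mathbb{R}^N$ be a bounded open set with Lipschitz boundary, and let $f\in L^{(2_s^\ast)'}(\Omega)$ with $f\ge 0$, where $2_s^\ast=\frac{2N}{N-2s}$ and $(2_s^\ast)'=\frac{2N}{N+2s}$ is its conjugate exponent. Let $\Omega^\star$ be the open ball centered at the origin with the same Lebesgue measure as $\Omega$, and let $f^\star$ be the Schwarz rearrangement of $f$. If $u\in X_0^s(\Omega)$ is the weak solution to $$(-\Delta)^s u=\frac{f(x)}{u^\gamma}\ \text{ in }\Omega,\qquad u>0\ \text{ in }\Omega,\qquad u=0\ \text{ on }\mathbb{R}^N\setminus\Omega,$$ and $v\in X_0^s(\Omega^\star)$ is the weak solution to $$(-\Delta)^s v=(\gamma+1)f^\star\ \text{ in }\Omega^\star,\qquad v=0\ \text{ on }\mathbb{R}^N\setminus\Omega^\star,$$ then $$\|u^{\gamma+1}\|_{X_0^s(\Omega)}\le\|v\|_{X_0^s(\Omega^\star)}.$$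
   Context: Function spaces. For an open set $D\subset\mathbb{R}^N$, $[u]_{H^s(D)}=\left(\iint_{D\times D}\frac{|u(x)-u(y)|^2}{|x-y|^{N+2s}}\,dx\,dy\right)^{1/2}$ and $H^s(D)=\{u\in L^2(D): [u]_{H^s(D)}<\infty\}$. $H^s_{\mathrm{loc}}(D)$ is the set of $u:D\to\mathbb{R}$ with $u|_K\in H^s(K)$ for all $K\subset\subset D$. $X_0^s(D)=\{u\in H^s(\mathbb{R}^N): u=0 \text{ a.e. in }\mathbb{R}^N\setminus D\}$, with norm $\|u\|_{X_0^s(D)}=[u]_{H^s(\mathbb{R}^N)}$. The fractional Laplacian is $(-\Delta)^s u(x)=C_{N,s}\,\mathrm{P.V.}\int_{\mathbb{R}^N}\frac{u(x)-u(y)}{|x-y|^{N+2s}}\,dy$ with $C_{N,s}=\frac{s\,2^{2s}\,\Gamma\left(\frac{N+2s}{2}\right)}{\pi^{N/2}\,\Gamma(1-s)}$, understood in the weak senses below. Weak solution of the singular problem. A positive function $u\in H^s_{\mathrm{loc}}(\Omega)\cap L^1(\Omega)$ (extended by $0$ outside $\Omega$) is a weak solution to $(-\Delta)^s u=f/u^\gamma$ in $\Omega$, $u>0$ in $\Omega$, $u=0$ on $\mathbb{R}^N\setminus\Omega$, if $u^{\max\{\frac{\gamma+1}{2},1\}}\in X_0^s(\Omega)$, $\frac{f}{u^\gamma}\in L^1_{\mathrm{loc}}(\Omega)$, and for every nonnegative $\varphi\in C_c^\infty(\Omega)$ $$\frac{C_{N,s}}{2}\iint_{\mathbb{R}^{2N}}\frac{(u(x)-u(y))(\varphi(x)-\varphi(y))}{|x-y|^{N+2s}}\,dx\,dy=\int_\Omega\frac{f(x)}{u(x)^\gamma}\varphi(x)\,dx.$$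 Weak solution of the linear problem: $v\in X_0^s(\Omega^\star)$ with $\frac{C_{N,s}}{2}\iint_{\mathbb{R}^{2N}}\frac{(v(x)-v(y))(\eta(x)-\eta(y))}{|x-y|^{N+2s}}\,dx\,dy=(\gamma+1)\int_{\Omega^\star}f^\star\,\eta\,dx$ for all $\eta\in X_0^s(\Omega^\star)$. Rearrangement. With $\mu_f(t)=|\{x\in\Omega:|f(x)|>t\}|$ and $f^\ast(\sigma)=\sup\{t\ge 0:\mu_f(t)>\sigma\}$ for $\sigma>0$, the Schwarz rearrangement is $f^\star(x)=f^\ast(\omega_N|x|^N)$, $x\in\Omega^\star$, where $\omega_N$ is the measure of the unit ball of $\mathbb{R}^N$. *)

theory Defs
  imports "HOL-Analysis.Analysis"
begin

text \<open>
  Functions are total on the ambient space and are considered up to Lebesgue null sets; the values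
  outside the domain named in a definition are irrelevant unless a condition mentions them.
\<close>

text \<open>
  Near each boundary point the set is the strict supergraph of a Lipschitz function. The coordinate
  system is given by a unit vector \<open>e\<close>: the last coordinate of \<open>x\<close> is \<open>x \<bullet> e\<close> and the remaining ones
  are the projection of \<open>x\<close> onto the hyperplane orthogonal to \<open>e\<close>.
\<close>

definition lipschitz_boundary :: "'a::euclidean_space set \<Rightarrow> bool" where
  "lipschitz_boundary D \<longleftrightarrow>
     (\<forall>p\<in>frontier D. \<exists>e g L r. norm e = 1 \<and> r > 0 \<and> L-lipschitz_on {y. y \<bullet> e = 0} g \<and>
        D \<inter> ball p r = {x \<in> ball p r. g (x - (x \<bullet> e) *\<^sub>R e) < x \<bullet> e})"

definition Lp :: "real \<Rightarrow> 'a::euclidean_space set \<Rightarrow> ('a \<Rightarrow> real) set" where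
  "Lp p D = {u \<in> borel_measurable (lebesgue_on D). integrable (lebesgue_on D) (\<lambda>x. \<bar>u x\<bar> powr p)}"

definition L1_loc :: "'a::euclidean_space set \<Rightarrow> ('a \<Rightarrow> real) set" where
  "L1_loc D = {u. \<forall>K. compact K \<and> K \<subseteq> D \<longrightarrow> u \<in> Lp 1 K}"

text \<open>
  The energy is the squared seminorm, with values in the extended nonnegative reals. The seminorm is
  real-valued, hence meaningful only where the energy is finite.
\<close>

definition gagliardo_energy :: "real \<Rightarrow> 'a::euclidean_space set \<Rightarrow> ('a \<Rightarrow> real) \<Rightarrow> ennreal" where
  "gagliardo_energy s D u =
     (\<integral>\<^sup>+ (x, y). ennreal (\<bar>u x - u y\<bar>\<^sup>2 / norm (x - y) powr (real DIM('a) + 2 * s))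
        \<partial>(lebesgue_on D \<Otimes>\<^sub>M lebesgue_on D))"

definition gagliardo_seminorm :: "real \<Rightarrow> 'a::euclidean_space set \<Rightarrow> ('a \<Rightarrow> real) \<Rightarrow> real" where
  "gagliardo_seminorm s D u = sqrt (enn2real (gagliardo_energy s D u))"

definition Hs :: "real \<Rightarrow> 'a::euclidean_space set \<Rightarrow> ('a \<Rightarrow> real) set" where
  "Hs s D = {u \<in> Lp 2 D. gagliardo_energy s D u < \<infinity>}"

definition Hs_loc :: "real \<Rightarrow> 'a::euclidean_space set \<Rightarrow> ('a \<Rightarrow> real) set" where
  "Hs_loc s D = {u. \<forall>K. open K \<and> compact (closure K) \<and> closure K \<subseteq> D \<longrightarrow> u \<in> Hs s K}"

definition X0s :: "real \<Rightarrow> 'a::euclidean_space set \<Rightarrow> ('a \<Rightarrow> real) set" where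
  "X0s s D = {u \<in> Hs s UNIV. AE x in lebesgue. x \<notin> D \<longrightarrow> u x = 0}"

text \<open>The norm of \<open>X0s s D\<close>; its formula does not involve \<open>D\<close>.\<close>

definition X0s_norm :: "real \<Rightarrow> ('a::euclidean_space \<Rightarrow> real) \<Rightarrow> real" where
  "X0s_norm s u = gagliardo_seminorm s UNIV u"

primrec C_k :: "nat \<Rightarrow> ('a::euclidean_space \<Rightarrow> real) \<Rightarrow> bool" where
  "C_k 0 g \<longleftrightarrow> continuous_on UNIV g"
| "C_k (Suc k) g \<longleftrightarrow>
     (\<forall>x. g differentiable at x) \<and> (\<forall>w. C_k k (\<lambda>x. frechet_derivative g (at x) w))"

definition Cc_infinity :: "'a::euclidean_space set \<Rightarrow> ('a \<Rightarrow> real) set" where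
  "Cc_infinity D = {\<phi>. (\<forall>k. C_k k \<phi>) \<and> compact (closure {x. \<phi> x \<noteq> 0}) \<and> closure {x. \<phi> x \<noteq> 0} \<subseteq> D}"

definition C_frac :: "nat \<Rightarrow> real \<Rightarrow> real" where
  "C_frac N s = s * 2 powr (2 * s) * Gamma ((real N + 2 * s) / 2)
                  / (pi powr (real N / 2) * Gamma (1 - s))"

definition frac_form ::
    "real \<Rightarrow> ('a::euclidean_space \<Rightarrow> real) \<Rightarrow> ('a \<Rightarrow> real) \<Rightarrow> real" where
  "frac_form s u \<phi> = C_frac DIM('a) s / 2 *
     (\<integral> (x, y). (u x - u y) * (\<phi> x - \<phi> y) / norm (x - y) powr (real DIM('a) + 2 * s)
        \<partial>(lebesgue \<Otimes>\<^sub>M lebesgue))"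

text \<open>
  In both definitions below the membership conditions make the integrals of the weak formulation
  absolutely convergent: in the first one for every test function, in the second one whenever
  \<open>g\<close> lies in the dual Sobolev exponent space.
\<close>

definition singular_weak_solution ::
    "real \<Rightarrow> real \<Rightarrow> 'a::euclidean_space set \<Rightarrow> ('a \<Rightarrow> real) \<Rightarrow> ('a \<Rightarrow> real) \<Rightarrow> bool" where
  "singular_weak_solution s \<gamma> D f u \<longleftrightarrow>
     u \<in> Hs_loc s D \<inter> Lp 1 D \<and>
     (AE x in lebesgue. x \<in> D \<longrightarrow> u x > 0) \<and>
     (AE x in lebesgue. x \<notin> D \<longrightarrow> u x = 0) \<and>
     (\<lambda>x. u x powr max ((\<gamma> + 1) / 2) 1) \<in> X0s s D \<and>
     (\<lambda>x. f x / u x powr \<gamma>) \<in> L1_loc D \<and>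
     (\<forall>\<phi>\<in>Cc_infinity D. (\<forall>x. \<phi> x \<ge> 0) \<longrightarrow>
        frac_form s u \<phi> = (\<integral>x. f x / u x powr \<gamma> * \<phi> x \<partial>lebesgue_on D))"

definition linear_weak_solution ::
    "real \<Rightarrow> 'a::euclidean_space set \<Rightarrow> ('a \<Rightarrow> real) \<Rightarrow> ('a \<Rightarrow> real) \<Rightarrow> bool" where
  "linear_weak_solution s D g v \<longleftrightarrow>
     v \<in> X0s s D \<and>
     (\<forall>\<eta>\<in>X0s s D. frac_form s v \<eta> = (\<integral>x. g x * \<eta> x \<partial>lebesgue_on D))"

definition distribution_function ::
    "'a::euclidean_space set \<Rightarrow> ('a \<Rightarrow> real) \<Rightarrow> real \<Rightarrow> ennreal" where
  "distribution_function D f t = emeasure lebesgue {x \<in> D. \<bar>f x\<bar> > t}"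

text \<open>The supremum is taken in \<open>[0, \<infinity>]\<close>, so the supremum of the empty set is \<open>0\<close>.\<close>

definition decreasing_rearrangement ::
    "'a::euclidean_space set \<Rightarrow> ('a \<Rightarrow> real) \<Rightarrow> real \<Rightarrow> ennreal" where
  "decreasing_rearrangement D f \<sigma> =
     (SUP t\<in>{t. t \<ge> 0 \<and> distribution_function D f t > ennreal \<sigma>}. ennreal t)"

text \<open>
  For \<open>f\<close> in some \<open>Lp p D\<close> with \<open>p > 0\<close> the decreasing rearrangement is finite on the positive
  half-line, so the conversion to a real number can only matter at the origin.
\<close>

definition schwarz_rearrangement ::
    "'a::euclidean_space set \<Rightarrow> ('a \<Rightarrow> real) \<Rightarrow> 'a \<Rightarrow> real" where
  "schwarz_rearrangement D f x =
     enn2real (decreasing_rearrangement D f (measure lebesgue (ball (0::'a) 1) * norm x ^ DIM('a)))"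

definition schwarz_ball :: "'a::euclidean_space set \<Rightarrow> 'a set" where
  "schwarz_ball D = ball 0 (root DIM('a) (measure lebesgue D / measure lebesgue (ball (0::'a) 1)))"

lemma emeasure_schwarz_ball:
  fixes D :: "'a::euclidean_space set"
  assumes "D \<in> lmeasurable"
  shows "emeasure lebesgue (schwarz_ball D) = emeasure lebesgue D"
proof -
  have pos: "unit_ball_vol (real DIM('a)) \<noteq> 0"
    using less_imp_neq[OF unit_ball_vol_pos[of "real DIM('a)"]] by auto
  have "measure lebesgue (schwarz_ball D) = measure lebesgue D"
    using pos by (simp add: schwarz_ball_def content_ball real_root_ge_zero)
  moreover have "schwarz_ball D \<in> lmeasurable"
    by (simp add: schwarz_ball_def)
  ultimately show ?thesis
    using assms by (simp add: emeasure_eq_measure2 fmeasurableD2)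
qed

end

theory Submission
  imports Defs
begin

text \<open>
  Put \<open>w = u powr (\<gamma> + 1)\<close>. Formally, convexity of \<open>\<Phi>(t) = t powr (\<gamma> + 1)\<close> gives
  \<open>(-\<Delta>)\<^sup>s w \<le> \<Phi>'(u) (-\<Delta>)\<^sup>s u = (\<gamma> + 1) f\<close>, so that testing with \<open>w\<close> bounds the energy of \<open>w\<close> by
  \<open>(\<gamma> + 1) \<integral> f w\<close>. By the Hardy--Littlewood inequality this is at most \<open>(\<gamma> + 1) \<integral> f\<^sup>* w\<^sup>*\<close>, which
  the linear equation identifies with the bilinear form of \<open>v\<close> and \<open>w\<^sup>*\<close>. The form is bounded by half
  the sum of the energies of \<open>v\<close> and \<open>w\<^sup>*\<close>, and \<open>w\<^sup>*\<close> has at most the energy of \<open>w\<close> by the fractional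
  Polya--Szego inequality. Absorbing the energy of \<open>w\<close> proves the theorem.

  Three points need work.

  The singular equation may only be tested with smooth functions of compact support, whereas the
  argument calls for a power of \<open>u\<close>. In place of \<open>u\<close> itself a truncation \<open>min u k\<close> is used, which makes
  the test function \<open>min u k powr (2 \<gamma> + 1)\<close> bounded and a Lipschitz function of \<open>u\<close>
  (\<open>truncated_powr_convexity\<close> is the convexity inequality for it). It is approximated in two steps:
  it is cut off near the boundary (\<open>cutoff_approximation\<close>), the error being controlled by a
  Hardy inequality (\<open>fractional_Hardy\<close>), and then mollified (\<open>smooth_approximation\<close>). The Hardy
  inequality is cheap: the energy over the whole space contains the interaction of the domain with
  its complement, and a Lipschitz domain leaves enough room outside near each of its boundary points.

  The Polya--Szego inequality (\<open>fractional_polya_szego\<close>) is proved by polarization, that is, by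
  exchanging values between mirror points so that the larger one is nearer to the origin. One
  polarization preserves the distribution and does not increase the energy. Among all functions with
  the distribution of \<open>w\<close> and no more than its energy, a sequence minimising the second moment must
  converge to \<open>w\<^sup>*\<close>, because averaging over all mirrors shows that a function far from \<open>w\<^sup>*\<close> has a
  polarization with a definitely smaller second moment (\<open>almost_minimal_second_moment\<close>). Fatou's lemma
  then carries the energy bound to the limit.

  Finally \<open>k\<close> tends to infinity, again by Fatou's lemma, and a Poincare inequality shows that \<open>w\<close> is
  square integrable.
\<close>


section \<open>Square-integrable functions on a measure space\<close>

definition sq_norm :: "'a measure \<Rightarrow> ('a \<Rightarrow> real) \<Rightarrow> ennreal" where
  "sq_norm M F = (\<integral>\<^sup>+x. ennreal ((F x)\<^sup>2) \<partial>M)"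

lemma sq_norm_product:
  assumes [measurable]: "F \<in> borel_measurable M" "G \<in> borel_measurable M"
    and fin: "sq_norm M F < \<infinity>" "sq_norm M G < \<infinity>"
  shows "integrable M (\<lambda>x. F x * G x)"
    and "(\<integral>x. F x * G x \<partial>M)\<^sup>2 \<le> enn2real (sq_norm M F) * enn2real (sq_norm M G)"
    and "2 * (\<integral>x. F x * G x \<partial>M) \<le> enn2real (sq_norm M F) + enn2real (sq_norm M G)"
proof -
  let ?I = "\<integral>\<^sup>+x. ennreal \<bar>F x\<bar> * ennreal \<bar>G x\<bar> \<partial>M"
  have sq: "ennreal \<bar>r\<bar> ^ 2 = ennreal (r\<^sup>2)" for r :: real
    by (simp add: ennreal_power)
  have CS: "?I\<^sup>2 \<le> sq_norm M F * sq_norm M G"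
    using Cauchy_Schwarz_nn_integral[of "\<lambda>x. ennreal \<bar>F x\<bar>" M "\<lambda>x. ennreal \<bar>G x\<bar>"]
    by (simp add: sq sq_norm_def)
  have fin2: "sq_norm M F * sq_norm M G < \<infinity>"
    using fin by (simp add: ennreal_mult_less_top less_top)
  then have "?I\<^sup>2 < \<infinity>"
    using CS by (rule order_le_less_trans[rotated])
  then have I: "?I < \<infinity>"
    unfolding power2_eq_square less_top[symmetric] infinity_ennreal_def
    by (rule contrapos_nn) (simp only: ennreal_mult_top ennreal_top_mult ennreal_top_neq_zero if_False)
  have Ieq: "?I = (\<integral>\<^sup>+x. ennreal (norm (F x * G x)) \<partial>M)"
    by (simp add: abs_mult ennreal_mult)
  show int: "integrable M (\<lambda>x. F x * G x)"
    by (rule integrableI_bounded) (use I Ieq in auto)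
  have "ennreal \<bar>\<integral>x. F x * G x \<partial>M\<bar> \<le> ?I"
    unfolding Ieq using integral_norm_bound_ennreal[OF int] by simp
  then have "ennreal \<bar>\<integral>x. F x * G x \<partial>M\<bar> ^ 2 \<le> sq_norm M F * sq_norm M G"
    using CS by (meson order_trans power_mono zero_le)
  also have "\<dots> = ennreal (enn2real (sq_norm M F) * enn2real (sq_norm M G))"
    using fin by (simp add: ennreal_mult)
  finally show cs: "(\<integral>x. F x * G x \<partial>M)\<^sup>2 \<le> enn2real (sq_norm M F) * enn2real (sq_norm M G)"
    by (simp add: sq)
  have "(2 * (\<integral>x. F x * G x \<partial>M))\<^sup>2 \<le> (enn2real (sq_norm M F) + enn2real (sq_norm M G))\<^sup>2"
  proof -
    have "4 * (a * b) \<le> (a + b)\<^sup>2" for a b :: real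
      using zero_le_power2[of "a - b"] by (simp add: power2_eq_square algebra_simps)
    from order_trans[OF mult_left_mono[OF cs, of 4] this] show ?thesis
      by (simp add: power_mult_distrib)
  qed
  then show "2 * (\<integral>x. F x * G x \<partial>M) \<le> enn2real (sq_norm M F) + enn2real (sq_norm M G)"
    by (rule power2_le_imp_le) simp
qed

lemma sq_norm_add_le:
  assumes [measurable]: "F \<in> borel_measurable M" "G \<in> borel_measurable M"
    and "\<And>x. H x = F x + G x"
  shows "sq_norm M H \<le> 2 * sq_norm M F + 2 * sq_norm M G"
proof -
  have "(a + b)\<^sup>2 \<le> 2 * a\<^sup>2 + 2 * b\<^sup>2" for a b :: real
    using zero_le_power2[of "a - b"] by (simp add: power2_eq_square algebra_simps)
  then have "sq_norm M H \<le> (\<integral>\<^sup>+x. 2 * ennreal ((F x)\<^sup>2) + 2 * ennreal ((G x)\<^sup>2) \<partial>M)"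
    unfolding sq_norm_def assms(3)
    by (intro nn_integral_mono)
      (simp add: ennreal_plus[symmetric] ennreal_mult'[symmetric] ennreal_numeral[symmetric]
            del: ennreal_plus ennreal_numeral)
  also have "\<dots> = 2 * sq_norm M F + 2 * sq_norm M G"
    by (simp add: sq_norm_def nn_integral_add nn_integral_cmult)
  finally show ?thesis .
qed

text \<open>
  The parallelogram identity makes \<open>2 (F n)\<^sup>2 + 2 G\<^sup>2 - (F n - G)\<^sup>2\<close> nonnegative, and Fatou's lemma
  applied to it turns the absence of a norm gain into strong convergence.
\<close>

lemma sq_norm_diff_tendsto_0:
  assumes [measurable]: "\<And>n. F n \<in> borel_measurable M" "G \<in> borel_measurable M"
    and lim: "AE x in M. (\<lambda>n. F n x) \<longlonglongrightarrow> G x"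
    and le: "\<And>n. sq_norm M (F n) \<le> sq_norm M G" and fin: "sq_norm M G < \<infinity>"
  shows "(\<lambda>n. sq_norm M (\<lambda>x. F n x - G x)) \<longlonglongrightarrow> 0"
proof -
  define q where "q n = sq_norm M (\<lambda>x. F n x - G x)" for n
  have qeq: "q = (\<lambda>n. sq_norm M (\<lambda>x. F n x - G x))"
    by (rule ext) (rule q_def)
  define c where "c = sq_norm M G"
  have c: "c \<noteq> \<infinity>" using fin by (auto simp: c_def)
  let ?H = "\<lambda>n x. ennreal (2 * (F n x)\<^sup>2 + 2 * (G x)\<^sup>2 - (F n x - G x)\<^sup>2)"
  have pos: "0 \<le> 2 * a\<^sup>2 + 2 * b\<^sup>2 - (a - b)\<^sup>2" for a b :: real
    using zero_le_power2[of "a + b"] by (simp add: power2_eq_square algebra_simps)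
  have qfin: "q n \<le> 4 * c" for n
  proof -
    have "q n \<le> 2 * sq_norm M (F n) + 2 * sq_norm M (\<lambda>x. - G x)"
      unfolding q_def by (rule sq_norm_add_le) auto
    also have "\<dots> \<le> 2 * c + 2 * c"
      using le by (intro add_mono mult_left_mono) (auto simp: sq_norm_def c_def)
    also have "\<dots> = 4 * c"
      by (simp add: distrib_right[symmetric])
    finally show ?thesis .
  qed
  have H: "(\<integral>\<^sup>+x. ?H n x \<partial>M) + q n \<le> 4 * c" for n
  proof -
    have "(\<integral>\<^sup>+x. ?H n x \<partial>M) + q n = (\<integral>\<^sup>+x. ?H n x + ennreal ((F n x - G x)\<^sup>2) \<partial>M)"
      unfolding q_def sq_norm_def by (rule nn_integral_add[symmetric]) auto
    also have "\<dots> = (\<integral>\<^sup>+x. 2 * ennreal ((F n x)\<^sup>2) + 2 * ennreal ((G x)\<^sup>2) \<partial>M)"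
    proof (rule nn_integral_cong)
      fix x
      have "?H n x + ennreal ((F n x - G x)\<^sup>2) = ennreal (2 * (F n x)\<^sup>2 + 2 * (G x)\<^sup>2)"
        using pos[of "F n x" "G x"] by (subst ennreal_plus[symmetric]) simp_all
      then show "?H n x + ennreal ((F n x - G x)\<^sup>2) = 2 * ennreal ((F n x)\<^sup>2) + 2 * ennreal ((G x)\<^sup>2)"
        by (simp add: ennreal_mult')
    qed
    also have "\<dots> = 2 * sq_norm M (F n) + 2 * c"
      by (simp add: sq_norm_def c_def nn_integral_add nn_integral_cmult)
    also have "\<dots> \<le> 2 * c + 2 * c"
      using le by (intro add_mono mult_left_mono) (auto simp: c_def)
    also have "\<dots> = 4 * c"
      by (simp add: distrib_right[symmetric])
    finally show ?thesis .
  qed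
  have "(\<integral>\<^sup>+x. ennreal (4 * (G x)\<^sup>2) \<partial>M) = (\<integral>\<^sup>+x. liminf (\<lambda>n. ?H n x) \<partial>M)"
  proof (rule nn_integral_cong_AE)
    show "AE x in M. ennreal (4 * (G x)\<^sup>2) = liminf (\<lambda>n. ?H n x)"
      using lim
    proof eventually_elim
      case (elim x)
      have "(\<lambda>n. 2 * (F n x)\<^sup>2 + 2 * (G x)\<^sup>2 - (F n x - G x)\<^sup>2)
              \<longlonglongrightarrow> 2 * (G x)\<^sup>2 + 2 * (G x)\<^sup>2 - (G x - G x)\<^sup>2"
        by (intro tendsto_intros elim)
      then have "(\<lambda>n. ?H n x) \<longlonglongrightarrow> ennreal (4 * (G x)\<^sup>2)"
        by (intro tendsto_ennrealI) simp
      then show ?case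
        by (rule lim_imp_Liminf[OF sequentially_bot, symmetric])
    qed
  qed
  also have "\<dots> \<le> liminf (\<lambda>n. \<integral>\<^sup>+x. ?H n x \<partial>M)"
    by (rule nn_integral_liminf) auto
  also have "(\<integral>\<^sup>+x. ennreal (4 * (G x)\<^sup>2) \<partial>M) = 4 * c"
    by (simp add: c_def sq_norm_def nn_integral_cmult[symmetric] ennreal_mult'
             ennreal_numeral[symmetric] del: ennreal_numeral)
  finally have low: "4 * c \<le> liminf (\<lambda>n. \<integral>\<^sup>+x. ?H n x \<partial>M)" .
  have "(\<integral>\<^sup>+x. ?H n x \<partial>M) \<le> 4 * c - q n" for n
    using H[of n] by (simp add: ennreal_le_minus_iff)
  then have "liminf (\<lambda>n. \<integral>\<^sup>+x. ?H n x \<partial>M) \<le> liminf (\<lambda>n. 4 * c - q n)"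
    by (intro Liminf_mono always_eventually) auto
  also have "\<dots> = 4 * c - limsup q"
    using qfin c by (intro ennreal_liminf_minus) (auto simp: ennreal_mult_eq_top_iff)
  finally have "4 * c \<le> 4 * c - limsup q"
    using low by simp
  then have 1: "4 * c \<le> 4 * c - limsup q" .
  have 2: "limsup q \<le> 4 * c"
    using qfin by (intro Limsup_bounded always_eventually) auto
  have c4: "4 * c \<noteq> top"
    using c by (simp add: ennreal_mult_eq_top_iff)
  then have "limsup q \<noteq> top"
    using 2 by (auto simp: top_unique)
  with c4 obtain a b where ab: "4 * c = ennreal a" "a \<ge> 0" "limsup q = ennreal b" "b \<ge> 0"
    by (meson ennreal_cases)
  have "ennreal a \<le> ennreal (a - b)" "ennreal b \<le> ennreal a"
    using 1 2 unfolding ab(1,3) by (simp_all add: ennreal_minus ab)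
  then have "b = 0"
    using ab(2,4) by (auto simp: ennreal_le_iff2)
  then have "limsup q = 0"
    using ab by simp
  moreover from this have "liminf q = 0"
    using Liminf_le_Limsup[OF sequentially_bot, of q] by simp
  ultimately have "q \<longlonglongrightarrow> 0"
    by (simp add: tendsto_iff_Liminf_eq_Limsup)
  then show ?thesis
    by (subst (asm) qeq)
qed

lemma tendsto_integral_sq_norm:
  assumes [measurable]: "\<And>n. F n \<in> borel_measurable M" "G \<in> borel_measurable M"
      "H \<in> borel_measurable M"
    and fin: "sq_norm M G < \<infinity>" "sq_norm M H < \<infinity>"
    and lim: "(\<lambda>n. sq_norm M (\<lambda>x. F n x - G x)) \<longlonglongrightarrow> 0"
  shows "(\<lambda>n. \<integral>x. H x * F n x \<partial>M) \<longlonglongrightarrow> (\<integral>x. H x * G x \<partial>M)"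
proof -
  let ?q = "\<lambda>n. sq_norm M (\<lambda>x. F n x - G x)"
  have ev: "eventually (\<lambda>n. ?q n < 1) sequentially"
    using lim by (rule order_tendstoD) simp
  have bd: "eventually (\<lambda>n. norm ((\<integral>x. H x * F n x \<partial>M) - (\<integral>x. H x * G x \<partial>M))
      \<le> sqrt (enn2real (sq_norm M H) * enn2real (?q n))) sequentially"
    using ev
  proof eventually_elim
    case (elim n)
    have qn: "?q n < \<infinity>" using elim by (rule order_less_trans) simp
    have 1: "integrable M (\<lambda>x. H x * (F n x - G x))"
      and 2: "(\<integral>x. H x * (F n x - G x) \<partial>M)\<^sup>2 \<le> enn2real (sq_norm M H) * enn2real (?q n)"
      using sq_norm_product[of H M "\<lambda>x. F n x - G x"] fin qn by auto
    have 3: "integrable M (\<lambda>x. H x * G x)"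
      using sq_norm_product(1)[of H M G] fin by auto
    have "(\<integral>x. H x * F n x \<partial>M) = (\<integral>x. H x * (F n x - G x) + H x * G x \<partial>M)"
      by (simp add: algebra_simps)
    also have "\<dots> = (\<integral>x. H x * (F n x - G x) \<partial>M) + (\<integral>x. H x * G x \<partial>M)"
      using 1 3 by (rule Bochner_Integration.integral_add)
    finally show ?case
      using 2 by (simp add: real_le_rsqrt real_sqrt_abs[symmetric] del: real_sqrt_abs)
  qed
  have "(\<lambda>n. enn2real (?q n)) \<longlonglongrightarrow> 0"
    by (rule tendsto_enn2real) (use lim in simp_all)
  from tendsto_real_sqrt[OF tendsto_mult_left[OF this, of "enn2real (sq_norm M H)"]]
  have "(\<lambda>n. sqrt (enn2real (sq_norm M H) * enn2real (?q n))) \<longlonglongrightarrow> 0"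
    by simp
  from Lim_null_comparison[OF bd this] show ?thesis
    by (rule LIM_zero_cancel)
qed


section \<open>The Gagliardo form as an inner product\<close>

lemma sigma_finite_lebesgue: "sigma_finite_measure (lebesgue :: 'a::euclidean_space measure)"
proof
  obtain A :: "'a set set" where A: "countable A" "A \<subseteq> sets lborel" "\<Union>A = space lborel"
      "\<forall>a\<in>A. emeasure lborel a \<noteq> \<infinity>"
    using lborel.sigma_finite_countable by blast
  then show "\<exists>A::'a set set. countable A \<and> A \<subseteq> sets lebesgue \<and> \<Union> A = space lebesgue
      \<and> (\<forall>a\<in>A. emeasure lebesgue a \<noteq> \<infinity>)"
    by (intro exI[of _ A]) auto
qed

definition gagliardo_kernel :: "real \<Rightarrow> 'a::euclidean_space \<Rightarrow> 'a \<Rightarrow> real" where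
  "gagliardo_kernel s x y = 1 / norm (x - y) powr (real DIM('a) + 2 * s)"

text \<open>
  With respect to this measure the energy of \<open>h\<close> is the squared norm of the increment of \<open>h\<close>, and the
  bilinear form is the inner product of increments. On the diagonal, where the kernel is singular,
  division by zero yields the weight \<open>0\<close>; increments vanish there.
\<close>

definition gagliardo_measure :: "real \<Rightarrow> ('a::euclidean_space \<times> 'a) measure" where
  "gagliardo_measure s =
     density (lebesgue \<Otimes>\<^sub>M lebesgue) (\<lambda>z. ennreal (gagliardo_kernel s (fst z) (snd z)))"

definition increment :: "('a \<Rightarrow> real) \<Rightarrow> 'a \<times> 'a \<Rightarrow> real" where
  "increment h z = h (fst z) - h (snd z)"

lemma gagliardo_kernel_nonneg [simp]: "0 \<le> gagliardo_kernel s x y"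
  by (simp add: gagliardo_kernel_def)

lemma measurable_fst_lebesgue [measurable]:
    "fst \<in> (lebesgue \<Otimes>\<^sub>M lebesgue) \<rightarrow>\<^sub>M (borel :: 'a::euclidean_space measure)"
  and measurable_snd_lebesgue [measurable]:
    "snd \<in> (lebesgue \<Otimes>\<^sub>M lebesgue) \<rightarrow>\<^sub>M (borel :: 'a::euclidean_space measure)"
proof -
  have *: "(\<lambda>x. x) \<in> lebesgue \<rightarrow>\<^sub>M (borel :: 'a measure)"
    by (rule measurable_completion) simp
  show "fst \<in> (lebesgue \<Otimes>\<^sub>M lebesgue) \<rightarrow>\<^sub>M (borel :: 'a measure)"
    by (rule measurable_compose[OF measurable_fst *])
  show "snd \<in> (lebesgue \<Otimes>\<^sub>M lebesgue) \<rightarrow>\<^sub>M (borel :: 'a measure)"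
    by (rule measurable_compose[OF measurable_snd *])
qed

lemma borel_measurable_gagliardo_kernel [measurable]:
  assumes [measurable]: "f \<in> M \<rightarrow>\<^sub>M (borel :: 'a::euclidean_space measure)" "g \<in> M \<rightarrow>\<^sub>M borel"
  shows "(\<lambda>z. gagliardo_kernel s (f z) (g z)) \<in> borel_measurable M"
  unfolding gagliardo_kernel_def by measurable

lemma sets_gagliardo_measure [measurable_cong]:
  "sets (gagliardo_measure s) = sets (lebesgue \<Otimes>\<^sub>M lebesgue)"
  by (simp add: gagliardo_measure_def)

lemma borel_measurable_increment [measurable]:
  assumes [measurable]: "h \<in> borel_measurable lebesgue"
  shows "increment h \<in> borel_measurable (lebesgue \<Otimes>\<^sub>M lebesgue)"
  unfolding increment_def[abs_def] by measurable

lemma borel_measurable_increment' [measurable]: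
  assumes [measurable]: "h \<in> borel_measurable lebesgue"
  shows "increment h \<in> borel_measurable (gagliardo_measure s)"
  using borel_measurable_increment[OF assms] by (simp cong: measurable_cong_sets add: sets_gagliardo_measure)

lemma gagliardo_energy_eq_sq_norm:
  fixes u :: "'a::euclidean_space \<Rightarrow> real"
  assumes [measurable]: "u \<in> borel_measurable lebesgue"
  shows "gagliardo_energy s UNIV u = sq_norm (gagliardo_measure s) (increment u)"
  unfolding gagliardo_energy_def sq_norm_def gagliardo_measure_def
  by (subst nn_integral_density)
    (auto simp: lebesgue_on_UNIV_eq increment_def gagliardo_kernel_def ennreal_mult'[symmetric]
       split_beta' mult.commute intro!: nn_integral_cong)

lemma frac_form_eq_integral:
  fixes u :: "'a::euclidean_space \<Rightarrow> real"
  assumes [measurable]: "u \<in> borel_measurable lebesgue" "\<phi> \<in> borel_measurable lebesgue"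
  shows "frac_form s u \<phi> =
    C_frac DIM('a) s / 2 * (\<integral>z. increment u z * increment \<phi> z \<partial>gagliardo_measure s)"
  unfolding frac_form_def gagliardo_measure_def
  by (subst integral_real_density)
    (auto simp: increment_def gagliardo_kernel_def split_beta' mult.commute)

lemma AE_gagliardo_measure:
  assumes "AE x in (lebesgue :: 'a::euclidean_space measure). P x"
  shows "AE z in gagliardo_measure s. P (fst z) \<and> P (snd z)"
proof -
  interpret L: sigma_finite_measure "lebesgue :: 'a measure" by (rule sigma_finite_lebesgue)
  from assms obtain N where N: "{x. \<not> P x} \<subseteq> N" "N \<in> null_sets lebesgue"
    by (auto elim!: AE_E2 simp: eventually_ae_filter)
  have "N \<times> (UNIV :: 'a set) \<in> null_sets (lebesgue \<Otimes>\<^sub>M lebesgue)"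
      "(UNIV :: 'a set) \<times> N \<in> null_sets (lebesgue \<Otimes>\<^sub>M lebesgue)"
    using N(2) by (intro L.times_in_null_sets1 L.times_in_null_sets2; simp)+
  then have "N \<times> UNIV \<union> UNIV \<times> N \<in> null_sets (lebesgue \<Otimes>\<^sub>M lebesgue)"
    by (rule null_sets.Un)
  then have "AE z in lebesgue \<Otimes>\<^sub>M lebesgue. P (fst z) \<and> P (snd z)"
    by (rule AE_I') (use N(1) in auto)
  then show ?thesis
    unfolding gagliardo_measure_def by (subst AE_density) auto
qed

lemma gagliardo_energy_mono_AE:
  assumes [measurable]: "h \<in> borel_measurable lebesgue" "u \<in> borel_measurable lebesgue"
    and P: "AE x in lebesgue. P x"
    and le: "\<And>x y. P x \<Longrightarrow> P y \<Longrightarrow> \<bar>h x - h y\<bar> \<le> L * \<bar>u x - u y\<bar>"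
  shows "gagliardo_energy s UNIV h \<le> ennreal (L\<^sup>2) * gagliardo_energy s UNIV u"
proof -
  have "gagliardo_energy s UNIV h \<le> (\<integral>\<^sup>+z. ennreal (L\<^sup>2) * ennreal ((increment u z)\<^sup>2) \<partial>gagliardo_measure s)"
    unfolding gagliardo_energy_eq_sq_norm[OF assms(1)] sq_norm_def
  proof (rule nn_integral_mono_AE)
    show "AE z in gagliardo_measure s. ennreal ((increment h z)\<^sup>2) \<le> ennreal (L\<^sup>2) * ennreal ((increment u z)\<^sup>2)"
      using AE_gagliardo_measure[OF P]
    proof eventually_elim
      case (elim z)
      have "\<bar>increment h z\<bar>\<^sup>2 \<le> (L * \<bar>increment u z\<bar>)\<^sup>2"
        unfolding increment_def using le elim by (intro power_mono) auto
      then show ?case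
        by (simp add: power_mult_distrib ennreal_mult'[symmetric])
    qed
  qed
  also have "\<dots> = ennreal (L\<^sup>2) * gagliardo_energy s UNIV u"
    by (simp add: gagliardo_energy_eq_sq_norm sq_norm_def nn_integral_cmult)
  finally show ?thesis .
qed

lemma gagliardo_energy_cong_AE:
  assumes [measurable]: "h \<in> borel_measurable lebesgue" "u \<in> borel_measurable lebesgue"
    and eq: "AE x in lebesgue. h x = u x"
  shows "gagliardo_energy s UNIV h = gagliardo_energy s UNIV u"
  using gagliardo_energy_mono_AE[OF assms(1,2) eq, of 1 s]
    gagliardo_energy_mono_AE[OF assms(2,1) eq, of 1 s] by simp

lemma gagliardo_energy_Fatou:
  assumes [measurable]: "\<And>n. h n \<in> borel_measurable lebesgue" "u \<in> borel_measurable lebesgue"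
    and lim: "AE x in lebesgue. (\<lambda>n. h n x) \<longlonglongrightarrow> u x"
    and le: "\<And>n. gagliardo_energy s UNIV (h n) \<le> c"
  shows "gagliardo_energy s UNIV u \<le> c"
proof -
  have "gagliardo_energy s UNIV u
      = (\<integral>\<^sup>+z. liminf (\<lambda>n. ennreal ((increment (h n) z)\<^sup>2)) \<partial>gagliardo_measure s)"
    unfolding gagliardo_energy_eq_sq_norm[OF assms(2)] sq_norm_def
  proof (rule nn_integral_cong_AE)
    show "AE z in gagliardo_measure s.
        ennreal ((increment u z)\<^sup>2) = liminf (\<lambda>n. ennreal ((increment (h n) z)\<^sup>2))"
      using AE_gagliardo_measure[OF lim]
    proof eventually_elim
      case (elim z)
      then have "(\<lambda>n. ennreal ((increment (h n) z)\<^sup>2)) \<longlonglongrightarrow> ennreal ((increment u z)\<^sup>2)"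
        unfolding increment_def by (intro tendsto_ennrealI tendsto_intros) auto
      then show ?case
        by (rule lim_imp_Liminf[OF sequentially_bot, symmetric])
    qed
  qed
  also have "\<dots> \<le> liminf (\<lambda>n. gagliardo_energy s UNIV (h n))"
    unfolding gagliardo_energy_eq_sq_norm[OF assms(1)] sq_norm_def
    by (rule nn_integral_liminf) auto
  also have "\<dots> \<le> liminf (\<lambda>n. c)"
    using le by (intro Liminf_mono always_eventually) auto
  finally show ?thesis by (simp add: Liminf_const)
qed

text \<open>
  Strong convergence comes for free when the approximations do not exceed the energy of their pointwise
  limit. Mollification has this property.
\<close>

lemma gagliardo_energy_diff_tendsto_0:
  assumes [measurable]: "\<And>n. h n \<in> borel_measurable lebesgue" "u \<in> borel_measurable lebesgue"
    and lim: "AE x in lebesgue. (\<lambda>n. h n x) \<longlonglongrightarrow> u x"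
    and le: "\<And>n. gagliardo_energy s UNIV (h n) \<le> gagliardo_energy s UNIV u"
    and fin: "gagliardo_energy s UNIV u < \<infinity>"
  shows "(\<lambda>n. gagliardo_energy s UNIV (\<lambda>x. h n x - u x)) \<longlonglongrightarrow> 0"
proof -
  have "(\<lambda>n. sq_norm (gagliardo_measure s) (\<lambda>z. increment (h n) z - increment u z)) \<longlonglongrightarrow> 0"
  proof (rule sq_norm_diff_tendsto_0)
    show "AE z in gagliardo_measure s. (\<lambda>n. increment (h n) z) \<longlonglongrightarrow> increment u z"
      using AE_gagliardo_measure[OF lim]
      by eventually_elim (auto simp: increment_def intro!: tendsto_intros)
  qed (use le fin in \<open>auto simp: gagliardo_energy_eq_sq_norm[symmetric]\<close>)
  moreover have "(\<lambda>z. increment (h n) z - increment u z) = increment (\<lambda>x. h n x - u x)" for n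
    by (auto simp: increment_def)
  ultimately show ?thesis
    by (simp add: gagliardo_energy_eq_sq_norm)
qed

lemma frac_form_tendsto:
  assumes [measurable]: "\<And>n. h n \<in> borel_measurable lebesgue" "\<phi> \<in> borel_measurable lebesgue"
      "u \<in> borel_measurable lebesgue"
    and fin: "gagliardo_energy s UNIV \<phi> < \<infinity>" "gagliardo_energy s UNIV u < \<infinity>"
    and lim: "(\<lambda>n. gagliardo_energy s UNIV (\<lambda>x. h n x - \<phi> x)) \<longlonglongrightarrow> 0"
  shows "(\<lambda>n. frac_form s u (h n)) \<longlonglongrightarrow> frac_form s u \<phi>"
proof -
  have eq: "increment (\<lambda>x. h n x - \<phi> x) = (\<lambda>z. increment (h n) z - increment \<phi> z)" for n
    by (auto simp: increment_def)
  have "(\<lambda>n. sq_norm (gagliardo_measure s) (\<lambda>z. increment (h n) z - increment \<phi> z)) \<longlonglongrightarrow> 0"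
    using lim by (simp add: gagliardo_energy_eq_sq_norm eq)
  then show ?thesis
    unfolding frac_form_eq_integral[OF assms(3) assms(1)] frac_form_eq_integral[OF assms(3) assms(2)]
    using fin by (intro tendsto_intros tendsto_integral_sq_norm)
      (auto simp: gagliardo_energy_eq_sq_norm[symmetric])
qed

lemma C_frac_pos:
  assumes "0 < s" "s < 1"
  shows "0 < C_frac N s"
  using assms unfolding C_frac_def
  by (intro divide_pos_pos mult_pos_pos Gamma_real_pos) auto

text \<open>The Cauchy--Schwarz inequality, in the additive form in which it is used.\<close>

lemma frac_form_le_energies:
  fixes u \<phi> :: "'a::euclidean_space \<Rightarrow> real"
  assumes [measurable]: "u \<in> borel_measurable lebesgue" "\<phi> \<in> borel_measurable lebesgue"
    and "gagliardo_energy s UNIV u < \<infinity>" "gagliardo_energy s UNIV \<phi> < \<infinity>"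
    and s: "0 < s" "s < 1"
  shows "frac_form s u \<phi> \<le> C_frac DIM('a) s / 4 *
    (enn2real (gagliardo_energy s UNIV u) + enn2real (gagliardo_energy s UNIV \<phi>))"
proof -
  have "2 * (\<integral>z. increment u z * increment \<phi> z \<partial>gagliardo_measure s)
      \<le> enn2real (gagliardo_energy s UNIV u) + enn2real (gagliardo_energy s UNIV \<phi>)"
    using sq_norm_product(3)[of "increment u" "gagliardo_measure s" "increment \<phi>"] assms
    by (simp add: gagliardo_energy_eq_sq_norm)
  then have "C_frac DIM('a) s / 4 * (2 * (\<integral>z. increment u z * increment \<phi> z \<partial>gagliardo_measure s))
      \<le> C_frac DIM('a) s / 4 *
    (enn2real (gagliardo_energy s UNIV u) + enn2real (gagliardo_energy s UNIV \<phi>))"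
    using C_frac_pos[OF s, of "DIM('a)"] by (intro mult_left_mono) auto
  then show ?thesis
    by (simp add: frac_form_eq_integral)
qed

text \<open>
  The product of the two completed measures agrees on Borel functions with the iterated Borel integral,
  which is the form in which changes of variables are available.
\<close>

lemma nn_integral_lebesgue_pair_borel:
  fixes g :: "'a::euclidean_space \<times> 'a \<Rightarrow> ennreal"
  assumes [measurable]: "g \<in> borel_measurable (borel \<Otimes>\<^sub>M borel)"
  shows "(\<integral>\<^sup>+z. g z \<partial>(lebesgue \<Otimes>\<^sub>M lebesgue)) = (\<integral>\<^sup>+x. \<integral>\<^sup>+y. g (x, y) \<partial>lborel \<partial>lborel)"
proof -
  interpret L: sigma_finite_measure "lebesgue :: 'a measure" by (rule sigma_finite_lebesgue)
  have "(\<lambda>z. (fst z, snd z)) \<in> lebesgue \<Otimes>\<^sub>M lebesgue \<rightarrow>\<^sub>M (borel \<Otimes>\<^sub>M borel :: ('a \<times> 'a) measure)"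
    by measurable
  then have "g \<in> borel_measurable (lebesgue \<Otimes>\<^sub>M lebesgue)"
    using measurable_compose[OF _ assms] by simp
  then show ?thesis
    by (subst L.nn_integral_fst[symmetric]) (auto simp: nn_integral_completion)
qed

lemma gagliardo_energy_borel:
  fixes h :: "'a::euclidean_space \<Rightarrow> real"
  assumes [measurable]: "h \<in> borel_measurable borel"
  shows "gagliardo_energy s UNIV h =
    (\<integral>\<^sup>+x. \<integral>\<^sup>+y. ennreal ((h x - h y)\<^sup>2 * gagliardo_kernel s x y) \<partial>lborel \<partial>lborel)"
  unfolding gagliardo_energy_def lebesgue_on_UNIV_eq
  by (subst nn_integral_lebesgue_pair_borel) (auto simp: gagliardo_kernel_def)


section \<open>Measure of Lipschitz images\<close>

text \<open>
  An open set slightly larger than \<open>S\<close> is, up to a null set, a disjoint union of balls by Vitali's theorem.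
  The map sends each of them into a ball whose radius is larger by the factor \<open>L\<close>, and null sets to null sets.
\<close>

lemma emeasure_lipschitz_image_le:
  fixes f :: "'a::euclidean_space \<Rightarrow> 'a"
  assumes T: "open T" and L: "0 < L"
    and lip: "\<And>x y. x \<in> T \<Longrightarrow> y \<in> T \<Longrightarrow> norm (f x - f y) \<le> L * norm (x - y)"
    and S: "S \<in> sets lebesgue" "S \<subseteq> T" and Y: "Y \<in> sets lebesgue" "Y \<subseteq> f ` S"
  shows "emeasure lebesgue Y \<le> ennreal (L ^ DIM('a)) * emeasure lebesgue S"
proof (cases "emeasure lebesgue S = \<infinity>")
  case True
  then show ?thesis using L by (simp add: ennreal_mult_top)
next
  case fin: False
  have key: "emeasure lebesgue Y \<le> ennreal (L ^ DIM('a)) * (emeasure lebesgue S + ennreal e)" if e: "e > 0" for e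
  proof -
    obtain U where U: "open U" "S \<subseteq> U" "U - S \<in> lmeasurable" "emeasure lebesgue (U - S) < ennreal e"
      using sets_lebesgue_outer_open[OF S(1) e] by metis
    define V where "V = U \<inter> T"
    have V: "open V" "S \<subseteq> V" "V \<subseteq> T" using U T S by (auto simp: V_def)
    have "emeasure lebesgue V \<le> emeasure lebesgue (S \<union> (U - S))"
      using S U(1) by (intro emeasure_mono) (auto simp: V_def)
    also have "\<dots> \<le> emeasure lebesgue S + emeasure lebesgue (U - S)"
      using S(1) U(3) by (intro emeasure_subadditive) (auto dest: fmeasurableD)
    also have "\<dots> \<le> emeasure lebesgue S + ennreal e"
      using U(4) by (intro add_left_mono) auto
    finally have mV: "emeasure lebesgue V \<le> emeasure lebesgue S + ennreal e" .
    define K where "K = {i :: 'a \<times> real. 0 < snd i \<and> ball (fst i) (snd i) \<subseteq> V}"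
    have cov: "\<exists>i. i \<in> K \<and> x \<in> ball (fst i) (snd i) \<and> snd i < d" if xd: "x \<in> V" "0 < d" for x d
    proof -
      obtain k where k: "k > 0" "ball x k \<subseteq> V"
        using openE[OF V(1) xd(1)] by blast
      have "ball x (min k (d/2)) \<subseteq> V" using k by auto
      then show ?thesis using k xd
        by (intro exI[of _ "(x, min k (d/2))"]) (auto simp: K_def)
    qed
    obtain C where C: "countable C" "C \<subseteq> K"
        "pairwise (\<lambda>i j. disjnt (ball (fst i) (snd i)) (ball (fst j) (snd j))) C"
        "negligible (V - (\<Union>i \<in> C. ball (fst i) (snd i)))"
      by (rule Vitali_covering_theorem_balls[of V K fst snd, OF cov]) (assumption | rule that)+
    define N where "N = V - (\<Union>i \<in> C. ball (fst i) (snd i))"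
    define I where "I = to_nat_on C ` C"
    define B where "B n = (if n \<in> I then ball (fst (from_nat_into C n)) (snd (from_nat_into C n)) else {})" for n
    define B' where "B' n = (if n \<in> I then ball (f (fst (from_nat_into C n))) (L * snd (from_nat_into C n)) else {})" for n
    have inC: "from_nat_into C n \<in> C" if "n \<in> I" for n
      using that C(1) by (auto simp: I_def)
    have B_eq: "(\<Union>n. B n) = (\<Union>i \<in> C. ball (fst i) (snd i))"
    proof -
      have "(\<Union>n. B n) = (\<Union>n\<in>I. ball (fst (from_nat_into C n)) (snd (from_nat_into C n)))"
        by (auto simp: B_def split: if_splits)
      also have "\<dots> = (\<Union>i \<in> C. ball (fst i) (snd i))"
        unfolding I_def using C(1) by simp
      finally show ?thesis .
    qed
    have disj: "disjoint_family B"
      unfolding disjoint_family_on_def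
    proof (intro ballI impI)
      fix m n :: nat assume "m \<noteq> n"
      show "B m \<inter> B n = {}"
      proof (cases "m \<in> I \<and> n \<in> I")
        case True
        then have "from_nat_into C m \<noteq> from_nat_into C n"
          using \<open>m \<noteq> n\<close> C(1) by (auto simp: I_def)
        then show ?thesis
          using True inC[of m] inC[of n] C(3) unfolding B_def pairwise_def disjnt_def by auto
      qed (auto simp: B_def)
    qed
    have mB: "emeasure lebesgue (B' n) = ennreal (L ^ DIM('a)) * emeasure lebesgue (B n)" for n
    proof (cases "n \<in> I")
      case True
      then have "0 < snd (from_nat_into C n)" using inC[OF True] C(2) by (auto simp: K_def)
      then show ?thesis using True L
        by (simp add: B_def B'_def emeasure_ball power_mult_distrib ennreal_mult'[symmetric] mult_ac)
    qed (auto simp: B_def B'_def)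
    have "negligible (f ` N)"
    proof (rule negligible_locally_Lipschitz_image)
      show "negligible N" using C(4) by (simp add: N_def)
      fix x assume "x \<in> N"
      then show "\<exists>T B. open T \<and> x \<in> T \<and> (\<forall>y\<in>N \<inter> T. norm (f y - f x) \<le> B * norm (y - x))"
        using lip V by (intro exI[of _ UNIV] exI[of _ L]) (auto simp: N_def)
    qed simp
    then have N0: "f ` N \<in> null_sets lebesgue" by (simp add: negligible_iff_null_sets)
    have "Y \<subseteq> (\<Union>n. B' n) \<union> f ` N"
    proof
      fix y assume "y \<in> Y"
      then obtain x where x: "x \<in> S" "y = f x" using Y by auto
      show "y \<in> (\<Union>n. B' n) \<union> f ` N"
      proof (cases "x \<in> N")
        case False
        then have "x \<in> (\<Union>n. B n)" using x V B_eq by (auto simp: N_def)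
        then obtain n where n: "x \<in> B n" by auto
        then have nI: "n \<in> I" by (auto simp: B_def split: if_splits)
        let ?c = "fst (from_nat_into C n)" and ?r = "snd (from_nat_into C n)"
        have r: "norm (?c - x) < ?r" "0 < ?r" "ball ?c ?r \<subseteq> V"
          using n nI inC[OF nI] C(2) by (auto simp: B_def K_def dist_norm)
        have "?c \<in> ball ?c ?r" using r(2) by simp
        then have "?c \<in> T" using r(3) V(3) by blast
        moreover have "x \<in> T" using x(1) S(2) by blast
        ultimately have "norm (f ?c - f x) \<le> L * norm (?c - x)" by (rule lip)
        also have "\<dots> < L * ?r" using r L by simp
        finally have "y \<in> B' n" using nI x by (simp add: B'_def dist_norm)
        then show ?thesis by auto
      qed (use x in auto)
    qed
    then have "emeasure lebesgue Y \<le> emeasure lebesgue ((\<Union>n. B' n) \<union> f ` N)"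
      using N0 by (intro emeasure_mono) (auto simp: B'_def intro!: sets.Un sets.countable_UN)
    also have "\<dots> = emeasure lebesgue (\<Union>n. B' n)"
      using N0 by (intro emeasure_Un_null_set) (auto simp: B'_def intro!: sets.countable_UN)
    also have "\<dots> \<le> (\<Sum>n. emeasure lebesgue (B' n))"
      by (rule emeasure_subadditive_countably) (auto simp: B'_def)
    also have "\<dots> = ennreal (L ^ DIM('a)) * (\<Sum>n. emeasure lebesgue (B n))"
      by (simp add: mB)
    also have "(\<Sum>n. emeasure lebesgue (B n)) = emeasure lebesgue (\<Union>n. B n)"
      by (rule suminf_emeasure[OF _ disj]) (auto simp: B_def)
    also have "\<dots> \<le> emeasure lebesgue V"
      using V(1) C(2) by (intro emeasure_mono) (auto simp: B_eq K_def)
    finally show ?thesis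
      using mV by (meson mult_left_mono order_trans zero_le)
  qed
  obtain m where m: "emeasure lebesgue S = ennreal m" "m \<ge> 0"
    using fin by (cases "emeasure lebesgue S") auto
  have Lp: "0 < L ^ DIM('a)" using L by simp
  show ?thesis
  proof (rule ennreal_le_epsilon)
    fix e :: real assume e: "e > 0"
    have "emeasure lebesgue Y \<le> ennreal (L ^ DIM('a)) * (emeasure lebesgue S + ennreal (e / L ^ DIM('a)))"
      by (rule key) (use e Lp in auto)
    also have "\<dots> = ennreal (L ^ DIM('a)) * emeasure lebesgue S + ennreal e"
      using L e by (simp add: distrib_left ennreal_mult'[symmetric])
    finally show "emeasure lebesgue Y \<le> ennreal (L ^ DIM('a)) * emeasure lebesgue S + ennreal e" .
  qed
qed

lemma isometric_borel_measurable:
  fixes \<sigma> :: "'a::euclidean_space \<Rightarrow> 'a"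
  assumes iso: "\<And>x y. norm (\<sigma> x - \<sigma> y) = norm (x - y)"
  shows "\<sigma> \<in> borel_measurable borel"
proof (rule borel_measurable_continuous_onI)
  show "continuous_on UNIV \<sigma>"
    unfolding continuous_on_iff dist_norm by (metis iso)
qed

lemma distr_isometric_involution:
  fixes \<sigma> :: "'a::euclidean_space \<Rightarrow> 'a"
  assumes inv: "\<And>x. \<sigma> (\<sigma> x) = x" and iso: "\<And>x y. norm (\<sigma> x - \<sigma> y) = norm (x - y)"
  shows "distr lborel borel \<sigma> = lborel"
proof (rule measure_eqI)
  have m [measurable]: "\<sigma> \<in> borel_measurable borel" by (rule isometric_borel_measurable[OF iso])
  fix A assume "A \<in> sets (distr lborel borel \<sigma>)"
  then have A [measurable]: "A \<in> sets borel" by simp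
  define A' where "A' = \<sigma> -` A"
  have A' [measurable]: "A' \<in> sets borel"
    using measurable_sets[OF m A] by (simp add: A'_def)
  have mem: "x \<in> \<sigma> ` B" if "\<sigma> x \<in> B" for x B
    using image_eqI[of x \<sigma> "\<sigma> x" B] that inv by simp
  have im: "A \<subseteq> \<sigma> ` A'" "A' \<subseteq> \<sigma> ` A"
    by (auto simp: A'_def inv intro: mem)
  have "emeasure lebesgue A \<le> ennreal (1 ^ DIM('a)) * emeasure lebesgue A'"
    by (rule emeasure_lipschitz_image_le[of UNIV, OF _ _ _ _ _ _ im(1)]) (auto simp: iso)
  moreover have "emeasure lebesgue A' \<le> ennreal (1 ^ DIM('a)) * emeasure lebesgue A"
    by (rule emeasure_lipschitz_image_le[of UNIV, OF _ _ _ _ _ _ im(2)]) (auto simp: iso)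
  ultimately have "emeasure lborel A' = emeasure lborel A" by simp
  then show "emeasure (distr lborel borel \<sigma>) A = emeasure lborel A"
    by (subst emeasure_distr) (auto simp: A'_def)
qed simp

section \<open>Reflections\<close>

text \<open>The reflection in the hyperplane equidistant from \<open>0\<close> and \<open>q\<close>.\<close>

definition reflection :: "'a::real_inner \<Rightarrow> 'a \<Rightarrow> 'a" where
  "reflection q x = x + (1 - 2 * (x \<bullet> q) / (q \<bullet> q)) *\<^sub>R q"

text \<open>Positive on the side of \<open>0\<close>, negative on the side of \<open>q\<close>.\<close>

definition reflection_side :: "'a::real_inner \<Rightarrow> 'a \<Rightarrow> real" where
  "reflection_side q x = q \<bullet> q - 2 * (x \<bullet> q)"

lemma reflection_alt:
  assumes "q \<noteq> 0"
  shows "reflection q x = x + (reflection_side q x / (q \<bullet> q)) *\<^sub>R q"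
  using assms by (simp add: reflection_def reflection_side_def diff_divide_distrib)

lemma reflection_side_reflection:
  assumes "q \<noteq> 0"
  shows "reflection_side q (reflection q x) = - reflection_side q x"
  using assms by (simp add: reflection_alt reflection_side_def inner_add_left) 

lemma reflection_reflection:
  assumes "q \<noteq> 0"
  shows "reflection q (reflection q x) = x"
proof -
  have "reflection q (reflection q x) = reflection q x - (reflection_side q x / (q \<bullet> q)) *\<^sub>R q"
    using reflection_alt[OF assms, of "reflection q x"] assms by (simp add: reflection_side_reflection)
  also have "\<dots> = x"
    using reflection_alt[OF assms, of x] by simp
  finally show ?thesis .
qed

lemma norm_reflection:
  assumes "q \<noteq> 0"
  shows "(norm (reflection q x))\<^sup>2 = (norm x)\<^sup>2 + reflection_side q x"
proof -
  define b where "b = reflection_side q x / (q \<bullet> q)"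
  have b: "b * (q \<bullet> q) = q \<bullet> q - 2 * (x \<bullet> q)" using assms by (simp add: b_def reflection_side_def)
  have "(norm (reflection q x))\<^sup>2 = (norm x)\<^sup>2 + b * (2 * (x \<bullet> q) + b * (q \<bullet> q))"
    using assms unfolding reflection_alt[OF assms] b_def[symmetric] power2_norm_eq_inner
    by (simp add: algebra_simps inner_commute)
  also have "\<dots> = (norm x)\<^sup>2 + reflection_side q x"
    using b by (simp add: reflection_side_def)
  finally show ?thesis .
qed

text \<open>
  Two points on the same side of the mirror are closer to each other than one of them is to the mirror
  image of the other. This is what makes polarization decrease the energy for a decreasing kernel.
\<close>

lemma norm_diff_reflection:
  assumes "q \<noteq> 0"
  shows "(norm (x - reflection q y))\<^sup>2
    = (norm (x - y))\<^sup>2 + reflection_side q x * reflection_side q y / (q \<bullet> q)"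
proof -
  define b where "b = reflection_side q y / (q \<bullet> q)"
  have b: "b * (q \<bullet> q) = q \<bullet> q - 2 * (y \<bullet> q)" using assms by (simp add: b_def reflection_side_def)
  have "(norm (x - reflection q y))\<^sup>2 = (norm (x - y))\<^sup>2 + b * (b * (q \<bullet> q) - 2 * (x \<bullet> q) + 2 * (y \<bullet> q))"
    using assms unfolding reflection_alt[OF assms] b_def[symmetric] power2_norm_eq_inner
    by (simp add: algebra_simps inner_commute)
  also have "\<dots> = (norm (x - y))\<^sup>2 + b * reflection_side q x"
    using b by (simp add: reflection_side_def)
  finally show ?thesis by (simp add: b_def)
qed

lemma norm_reflection_diff:
  assumes "q \<noteq> 0"
  shows "norm (reflection q x - reflection q y) = norm (x - y)"
proof -
  have "(norm (reflection q x - reflection q y))\<^sup>2 = (norm (x - y))\<^sup>2"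
    using norm_diff_reflection[OF assms, of "reflection q x" y] norm_diff_reflection[OF assms, of y x] assms
    by (simp add: reflection_side_reflection norm_minus_commute)
  then show ?thesis by (metis norm_ge_zero power2_eq_imp_eq)
qed

text \<open>
  Points of different norm are mirror images in exactly one hyperplane; in terms of the reflected origin it
  is given by the following vector.
\<close>

lemma reflection_to:
  assumes "norm x \<noteq> norm y"
  shows "reflection ((((norm y)\<^sup>2 - (norm x)\<^sup>2) / (norm (y - x))\<^sup>2) *\<^sub>R (y - x)) x = y"
proof -
  define c where "c = ((norm y)\<^sup>2 - (norm x)\<^sup>2) / (norm (y - x))\<^sup>2"
  define z where "z = y - x"
  have z: "z \<noteq> 0" using assms by (auto simp: z_def)
  have c0: "c \<noteq> 0" using assms z by (auto simp: c_def z_def power2_eq_iff_nonneg)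
  have cz: "c * (z \<bullet> z) = z \<bullet> z + 2 * (x \<bullet> z)"
  proof -
    have "c * (z \<bullet> z) = y \<bullet> y - x \<bullet> x"
      using z by (simp add: c_def z_def[symmetric] power2_norm_eq_inner)
    also have "\<dots> = z \<bullet> z + 2 * (x \<bullet> z)"
      by (simp add: z_def algebra_simps inner_commute)
    finally show ?thesis .
  qed
  have "1 - 2 * (x \<bullet> (c *\<^sub>R z)) / ((c *\<^sub>R z) \<bullet> (c *\<^sub>R z)) = 1 / c"
  proof -
    have "1 - 2 * (x \<bullet> (c *\<^sub>R z)) / ((c *\<^sub>R z) \<bullet> (c *\<^sub>R z))
        = (c * (z \<bullet> z) - 2 * (x \<bullet> z)) / (c * (z \<bullet> z))"
      using c0 z by (simp add: diff_divide_distrib)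
    also have "c * (z \<bullet> z) - 2 * (x \<bullet> z) = z \<bullet> z"
      using cz by simp
    finally show ?thesis using z by simp
  qed
  then have "reflection (c *\<^sub>R z) x = x + z"
    using c0 by (simp add: reflection_def)
  then show ?thesis by (simp add: c_def z_def)
qed

lemma borel_measurable_reflection [measurable]:
  assumes [measurable]: "f \<in> M \<rightarrow>\<^sub>M (borel :: 'a::euclidean_space measure)" "g \<in> M \<rightarrow>\<^sub>M borel"
  shows "(\<lambda>z. reflection (f z) (g z)) \<in> M \<rightarrow>\<^sub>M borel"
  unfolding reflection_def by measurable

lemma borel_measurable_reflection_side [measurable]:
  assumes [measurable]: "f \<in> M \<rightarrow>\<^sub>M (borel :: 'a::euclidean_space measure)" "g \<in> M \<rightarrow>\<^sub>M borel"
  shows "(\<lambda>z. reflection_side (f z) (g z)) \<in> borel_measurable M"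
  unfolding reflection_side_def by measurable

lemma distr_reflection_lborel:
  fixes q :: "'a::euclidean_space"
  assumes "q \<noteq> 0"
  shows "distr lborel borel (reflection q) = lborel"
  by (rule distr_isometric_involution) (simp_all add: reflection_reflection norm_reflection_diff assms)

lemma nn_integral_reflection:
  fixes q :: "'a::euclidean_space"
  assumes "q \<noteq> 0" and [measurable]: "f \<in> borel_measurable borel"
  shows "(\<integral>\<^sup>+x. f (reflection q x) \<partial>lborel) = (\<integral>\<^sup>+x. f x \<partial>lborel)"
  using nn_integral_distr[of "reflection q" lborel borel f] distr_reflection_lborel[OF assms(1)] by simp

text \<open>
  As long as the mirrors stay away from the origin, the image of a fixed point depends Lipschitz
  continuously on the mirror. Hence the mirrors that send \<open>x\<close> into a set \<open>Y\<close> have at least a fixed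
  multiple of the measure of \<open>Y\<close>.
\<close>

lemma reflection_lipschitz_in_mirror:
  fixes x q q' :: "'a::real_inner"
  assumes r: "0 < r" "r \<le> norm q" "r \<le> norm q'"
  shows "norm (reflection q x - reflection q' x) \<le> (1 + 8 * norm x / r) * norm (q - q')"
proof -
  define e where "e = q /\<^sub>R norm q"
  define e' where "e' = q' /\<^sub>R norm q'"
  have q: "norm q > 0" "norm q' > 0" using r by auto
  have e1: "norm e = 1" "norm e' = 1" using q by (auto simp: e_def e'_def)
  have unit: "reflection p x = x + p - (2 * (x \<bullet> (p /\<^sub>R norm p))) *\<^sub>R (p /\<^sub>R norm p)" for p
  proof -
    have "(2 * (x \<bullet> (p /\<^sub>R norm p))) *\<^sub>R (p /\<^sub>R norm p) = (2 * (x \<bullet> p) / (norm p * norm p)) *\<^sub>R p"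
      by (cases "p = 0") (simp_all add: field_simps)
    also have "norm p * norm p = p \<bullet> p"
      by (simp add: dot_square_norm power2_eq_square)
    finally have "(2 * (x \<bullet> (p /\<^sub>R norm p))) *\<^sub>R (p /\<^sub>R norm p) = (2 * (x \<bullet> p) / (p \<bullet> p)) *\<^sub>R p" .
    then show ?thesis
      by (simp only: reflection_def scaleR_left_diff_distrib scaleR_one add_diff_eq)
  qed
  have R: "reflection q x = x + q - (2 * (x \<bullet> e)) *\<^sub>R e"
    and R': "reflection q' x = x + q' - (2 * (x \<bullet> e')) *\<^sub>R e'"
    unfolding e_def e'_def by (rule unit)+
  have ee: "norm (e - e') \<le> 2 * norm (q - q') / r"
  proof -
    have "norm q *\<^sub>R (e - e') = (q - q') + (norm q' - norm q) *\<^sub>R e'"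
      using q by (simp add: e_def e'_def algebra_simps)
    then have "norm q * norm (e - e') = norm ((q - q') + (norm q' - norm q) *\<^sub>R e')"
      using q by (metis abs_norm_cancel norm_scaleR)
    also have "\<dots> \<le> norm (q - q') + \<bar>norm q' - norm q\<bar>"
      by (rule norm_triangle_le) (simp add: e1)
    also have "\<dots> \<le> 2 * norm (q - q')"
      using norm_triangle_ineq3[of q' q] by (simp add: norm_minus_commute)
    finally have 1: "norm q * norm (e - e') \<le> 2 * norm (q - q')" .
    have "r * norm (e - e') \<le> norm q * norm (e - e')"
      using r by (intro mult_right_mono) auto
    with 1 show ?thesis using r by (simp add: field_simps)
  qed
  have "(x \<bullet> e) *\<^sub>R e - (x \<bullet> e') *\<^sub>R e' = (x \<bullet> e) *\<^sub>R (e - e') + (x \<bullet> (e - e')) *\<^sub>R e'"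
    by (simp add: algebra_simps inner_diff_right)
  then have "norm ((x \<bullet> e) *\<^sub>R e - (x \<bullet> e') *\<^sub>R e') \<le> \<bar>x \<bullet> e\<bar> * norm (e - e') + \<bar>x \<bullet> (e - e')\<bar>"
    using norm_triangle_ineq[of "(x \<bullet> e) *\<^sub>R (e - e')" "(x \<bullet> (e - e')) *\<^sub>R e'"] by (simp add: e1)
  also have "\<dots> \<le> norm x * norm (e - e') + norm x * norm (e - e')"
    using Cauchy_Schwarz_ineq2[of x e] Cauchy_Schwarz_ineq2[of x "e - e'"] e1
    by (intro add_mono mult_right_mono) auto
  also have "\<dots> \<le> norm x * (2 * norm (q - q') / r) + norm x * (2 * norm (q - q') / r)"
    using ee by (intro add_mono mult_left_mono) auto
  finally have A: "norm ((x \<bullet> e) *\<^sub>R e - (x \<bullet> e') *\<^sub>R e') \<le> 4 * norm x * norm (q - q') / r"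
    by (simp add: algebra_simps)
  have "reflection q x - reflection q' x = (q - q') - 2 *\<^sub>R ((x \<bullet> e) *\<^sub>R e - (x \<bullet> e') *\<^sub>R e')"
    unfolding R R' by (simp add: algebra_simps)
  then have "norm (reflection q x - reflection q' x)
      \<le> norm (q - q') + 2 * norm ((x \<bullet> e) *\<^sub>R e - (x \<bullet> e') *\<^sub>R e')"
    using norm_triangle_ineq4[of "q - q'" "2 *\<^sub>R ((x \<bullet> e) *\<^sub>R e - (x \<bullet> e') *\<^sub>R e')"] by simp
  with A have "norm (reflection q x - reflection q' x) \<le> norm (q - q') + 2 * (4 * norm x * norm (q - q') / r)"
    by linarith
  then show ?thesis by (simp add: algebra_simps)
qed

section \<open>Polarization\<close>

text \<open>
  Of the two values at a pair of mirror points, the larger one is moved to the side of the origin.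
\<close>

definition polarization :: "'a::real_inner \<Rightarrow> ('a \<Rightarrow> real) \<Rightarrow> 'a \<Rightarrow> real" where
  "polarization q h x =
     (if 0 \<le> reflection_side q x then max (h x) (h (reflection q x)) else min (h x) (h (reflection q x)))"

lemma borel_measurable_polarization [measurable]:
  fixes q :: "'a::euclidean_space"
  assumes [measurable]: "h \<in> borel_measurable borel"
  shows "polarization q h \<in> borel_measurable borel"
  unfolding polarization_def[abs_def] by measurable

lemma polarization_reflection:
  assumes "q \<noteq> 0"
  shows "polarization q h (reflection q x) =
     (if 0 \<le> reflection_side q x then min (h x) (h (reflection q x)) else max (h x) (h (reflection q x)))"
proof (cases "reflection_side q x = 0")
  case True
  then have "reflection q x = x" using assms by (simp add: reflection_alt)
  then show ?thesis by (simp add: polarization_def)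
next
  case False
  then show ?thesis
    using assms by (auto simp: polarization_def reflection_side_reflection reflection_reflection)
qed

text \<open>
  A function and its polarization take the same two values on each pair of mirror points, so their
  integrands agree after adding the contributions of \<open>x\<close> and \<open>reflection q x\<close>.
\<close>

lemma nn_integral_polarization:
  fixes q :: "'a::euclidean_space" and g :: "real \<Rightarrow> ennreal"
  assumes q: "q \<noteq> 0" and [measurable]: "h \<in> borel_measurable borel" "g \<in> borel_measurable borel"
  shows "(\<integral>\<^sup>+x. g (polarization q h x) \<partial>lborel) = (\<integral>\<^sup>+x. g (h x) \<partial>lborel)"
proof -
  have two: "2 * (\<integral>\<^sup>+x. g (k x) \<partial>lborel) = (\<integral>\<^sup>+x. g (k x) + g (k (reflection q x)) \<partial>lborel)"
    if [measurable]: "k \<in> borel_measurable borel" for k :: "'a \<Rightarrow> real"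
    using nn_integral_reflection[OF q, of "\<lambda>x. g (k x)"] by (simp add: nn_integral_add mult_2)
  have "g (polarization q h x) + g (polarization q h (reflection q x)) = g (h x) + g (h (reflection q x))" for x
    unfolding polarization_reflection[OF q] by (auto simp: polarization_def max_def min_def add.commute)
  then have "2 * (\<integral>\<^sup>+x. g (polarization q h x) \<partial>lborel) = 2 * (\<integral>\<^sup>+x. g (h x) \<partial>lborel)"
    by (simp add: two)
  then show ?thesis by (simp add: ennreal_mult_cancel_left)
qed

lemma emeasure_superlevel_polarization:
  fixes q :: "'a::euclidean_space"
  assumes q: "q \<noteq> 0" and [measurable]: "h \<in> borel_measurable borel"
  shows "emeasure lborel {x. t < polarization q h x} = emeasure lborel {x. t < h x}"
proof -
  have *: "emeasure lborel {x. t < k x} = (\<integral>\<^sup>+x. indicator {t<..} (k x) \<partial>lborel)"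
    if [measurable]: "k \<in> borel_measurable borel" for k :: "'a \<Rightarrow> real"
  proof -
    have "(\<integral>\<^sup>+x. indicator {t<..} (k x) \<partial>lborel) = (\<integral>\<^sup>+x. indicator {x. t < k x} x \<partial>lborel)"
      by (rule nn_integral_cong) (auto split: split_indicator)
    then show ?thesis by simp
  qed
  show ?thesis
    using nn_integral_polarization[OF q, of h "indicator {t<..}"] by (simp add: *)
qed

text \<open>
  Of the two pairings of \<open>{a, b}\<close> with \<open>{c, d}\<close>, ordering both pairs minimises the first sum of
  squares and leaves the total unchanged; so ordering does not increase the weighted sum
  if the first pairing has the larger weight. The two exceptional alternatives are the ones in
  which a kernel is evaluated on the diagonal.
\<close>

lemma two_point_inequality:
  fixes a b c d K1 K2 :: real
  assumes "K2 \<le> K1 \<or> a = c \<and> b = d"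
  shows "((max a b - max c d)\<^sup>2 + (min a b - min c d)\<^sup>2) * K1
      + ((max a b - min c d)\<^sup>2 + (min a b - max c d)\<^sup>2) * K2
    \<le> ((a - c)\<^sup>2 + (b - d)\<^sup>2) * K1 + ((a - d)\<^sup>2 + (b - c)\<^sup>2) * K2"
proof -
  define S1 where "S1 = (a - c)\<^sup>2 + (b - d)\<^sup>2"
  define S2 where "S2 = (a - d)\<^sup>2 + (b - c)\<^sup>2"
  define T1 where "T1 = (max a b - max c d)\<^sup>2 + (min a b - min c d)\<^sup>2"
  define T2 where "T2 = (max a b - min c d)\<^sup>2 + (min a b - max c d)\<^sup>2"
  have pr: "(a \<le> b \<Longrightarrow> d \<le> c \<Longrightarrow> 0 \<le> (b - a) * (c - d))" "(b \<le> a \<Longrightarrow> c \<le> d \<Longrightarrow> 0 \<le> (a - b) * (d - c))"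
    by auto
  have tot: "T1 + T2 = S1 + S2"
    by (auto simp: S1_def S2_def T1_def T2_def max_def min_def)
  have T1: "T1 \<le> S1"
    using pr by (cases "a \<le> b"; cases "c \<le> d")
      (auto simp: S1_def T1_def max_def min_def power2_eq_square algebra_simps)
  have "T1 * K1 + T2 * K2 \<le> S1 * K1 + S2 * K2"
  proof (cases "K2 \<le> K1")
    case True
    then have "0 \<le> (S1 - T1) * (K1 - K2)" using T1 by simp
    moreover have "S1 - T1 = T2 - S2" using tot by simp
    then have "(S1 - T1) * (K1 - K2) = (S1 - T1) * K1 - (T2 - S2) * K2"
      by (simp only: right_diff_distrib)
    ultimately show ?thesis by (simp add: left_diff_distrib)
  next
    case False
    then have "S1 = 0" using assms by (simp add: S1_def)
    moreover have "T1 \<ge> 0" by (simp add: T1_def)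
    ultimately have "T1 = 0" "T2 = S2" using T1 tot by auto
    then show ?thesis using \<open>S1 = 0\<close> by simp
  qed
  then show ?thesis by (simp only: S1_def S2_def T1_def T2_def)
qed

lemma gagliardo_kernel_mono:
  fixes x y x' y' :: "'a::euclidean_space"
  assumes "(norm (x - y))\<^sup>2 \<le> (norm (x' - y'))\<^sup>2" "x \<noteq> y" "0 < s"
  shows "gagliardo_kernel s x' y' \<le> gagliardo_kernel s x y"
proof -
  have "norm (x - y) \<le> norm (x' - y')" using assms(1) by (simp add: norm_le_square power2_norm_eq_inner)
  moreover have "0 < norm (x - y)" using assms by simp
  ultimately show ?thesis
    using assms(3) unfolding gagliardo_kernel_def by (intro divide_left_mono powr_mono2 mult_pos_pos) auto
qed

text \<open>
  The inequality holds only after summing over the four pairs that arise from \<open>(x, y)\<close> by reflecting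
  either point. Of these, two have the kernel value \<open>K1\<close> and two have \<open>K2\<close>, and \<open>two_point_inequality\<close>
  applies, with the roles of \<open>K1\<close> and \<open>K2\<close> exchanged if the mirror separates \<open>x\<close> from \<open>y\<close>.
\<close>

lemma polarization_pointwise:
  fixes q :: "'a::euclidean_space"
  assumes q: "q \<noteq> 0" and s: "0 < s"
  defines "G \<equiv> \<lambda>h x y. (h x - h y :: real)\<^sup>2 * gagliardo_kernel s x y"
  shows "G (polarization q h) x y + G (polarization q h) (reflection q x) (reflection q y)
      + G (polarization q h) x (reflection q y) + G (polarization q h) (reflection q x) y
    \<le> G h x y + G h (reflection q x) (reflection q y) + G h x (reflection q y) + G h (reflection q x) y"
proof -
  define a b c d where "a = h x" "b = h (reflection q x)" "c = h y" "d = h (reflection q y)"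
  note abcd = this
  define K1 where "K1 = gagliardo_kernel s x y"
  define K2 where "K2 = gagliardo_kernel s x (reflection q y)"
  have K: "gagliardo_kernel s (reflection q x) (reflection q y) = K1"
      "gagliardo_kernel s (reflection q x) y = K2"
    using norm_reflection_diff[OF q, of x y] norm_reflection_diff[OF q, of x "reflection q y"]
      reflection_reflection[OF q, of y]
    by (simp_all add: K1_def K2_def gagliardo_kernel_def)
  have qq: "0 < q \<bullet> q" using q by simp
  have G: "G k x y + G k (reflection q x) (reflection q y) + G k x (reflection q y) + G k (reflection q x) y
      = ((k x - k y)\<^sup>2 + (k (reflection q x) - k (reflection q y))\<^sup>2) * K1
        + ((k x - k (reflection q y))\<^sup>2 + (k (reflection q x) - k y)\<^sup>2) * K2" for k
    unfolding G_def K K1_def[symmetric] K2_def[symmetric] by (simp add: algebra_simps)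
  show ?thesis
  proof (cases "0 \<le> reflection_side q x \<longleftrightarrow> 0 \<le> reflection_side q y")
    case same: True
    then have "0 \<le> reflection_side q x * reflection_side q y"
      by (meson less_eq_real_def linorder_not_le mult_neg_neg mult_nonneg_nonneg)
    then have "0 \<le> reflection_side q x * reflection_side q y / (q \<bullet> q)" by simp
    then have le: "(norm (x - y))\<^sup>2 \<le> (norm (x - reflection q y))\<^sup>2"
      using norm_diff_reflection[OF q, of x y] by simp
    have "K2 \<le> K1 \<or> a = c \<and> b = d"
      using gagliardo_kernel_mono[OF le _ s] by (auto simp: K1_def K2_def abcd)
    from two_point_inequality[OF this] same show ?thesis
      unfolding G polarization_reflection[OF q] unfolding polarization_def abcd[symmetric]
      by (auto simp: add_ac)
  next
    case opp: False
    then have "reflection_side q x * reflection_side q y \<le> 0"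
      by (meson less_eq_real_def linorder_not_le mult_nonneg_nonpos mult_nonpos_nonneg)
    then have "reflection_side q x * reflection_side q y / (q \<bullet> q) \<le> 0"
      using qq by (simp add: divide_le_0_iff)
    then have le: "(norm (x - reflection q y))\<^sup>2 \<le> (norm (x - y))\<^sup>2"
      using norm_diff_reflection[OF q, of x y] by simp
    have "K1 \<le> K2 \<or> a = d \<and> b = c"
    proof (cases "x = reflection q y")
      case True
      then show ?thesis by (simp add: abcd reflection_reflection[OF q])
    next
      case False
      then show ?thesis using gagliardo_kernel_mono[OF le _ s] by (simp add: K1_def K2_def)
    qed
    from two_point_inequality[OF this] opp show ?thesis
      unfolding G polarization_reflection[OF q] unfolding polarization_def abcd[symmetric]
      by (auto simp: add_ac max.commute min.commute)
  qed
qed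

lemma gagliardo_energy_polarization_le:
  fixes q :: "'a::euclidean_space"
  assumes q: "q \<noteq> 0" and s: "0 < s" and [measurable]: "h \<in> borel_measurable borel"
  shows "gagliardo_energy s UNIV (polarization q h) \<le> gagliardo_energy s UNIV h"
proof -
  let ?R = "reflection q"
  define G where "G k x y = ennreal ((k x - k y)\<^sup>2 * gagliardo_kernel s x y)" for k :: "'a \<Rightarrow> real" and x y
  have four: "4 * gagliardo_energy s UNIV k = (\<integral>\<^sup>+x. \<integral>\<^sup>+y.
      G k x y + G k (?R x) (?R y) + G k x (?R y) + G k (?R x) y \<partial>lborel \<partial>lborel)"
    if [measurable]: "k \<in> borel_measurable borel" for k :: "'a \<Rightarrow> real"
  proof -
    let ?E = "gagliardo_energy s UNIV k"
    have [measurable]: "case_prod (G k) \<in> borel_measurable (borel \<Otimes>\<^sub>M borel)"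
      unfolding G_def by measurable
    have G_meas [measurable]: "(\<lambda>z. G k (f z) (g z)) \<in> borel_measurable M"
      if [measurable]: "f \<in> M \<rightarrow>\<^sub>M borel" "g \<in> M \<rightarrow>\<^sub>M borel" for f g and M :: "'c measure"
      unfolding G_def by measurable
    have E0: "(\<integral>\<^sup>+x. \<integral>\<^sup>+y. G k x y \<partial>lborel \<partial>lborel) = ?E"
      unfolding G_def by (rule gagliardo_energy_borel[symmetric]) simp
    have y: "(\<integral>\<^sup>+y. G k x (?R y) \<partial>lborel) = (\<integral>\<^sup>+y. G k x y \<partial>lborel)" for x
      by (rule nn_integral_reflection[OF q]) measurable
    have x: "(\<integral>\<^sup>+x. \<integral>\<^sup>+y. G k (?R x) y \<partial>lborel \<partial>lborel) = ?E"
      using nn_integral_reflection[OF q, of "\<lambda>x. \<integral>\<^sup>+y. G k x y \<partial>lborel"] E0 by simp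
    have "(4::ennreal) = 1 + 1 + 1 + 1" by simp
    then have "4 * ?E = ?E + ?E + ?E + ?E" by (simp only: distrib_right mult_1_left)
    then show ?thesis
      by (simp add: nn_integral_add y x E0)
  qed
  have "4 * gagliardo_energy s UNIV (polarization q h) \<le> 4 * gagliardo_energy s UNIV h"
    unfolding four[OF assms(3)] four[OF borel_measurable_polarization[OF assms(3)]] G_def
    by (intro nn_integral_mono)
      (use polarization_pointwise[OF q s, of h] in \<open>simp add: ennreal_plus[symmetric] ennreal_leI del: ennreal_plus\<close>)
  then show ?thesis
    by (simp add: ennreal_mult_le_mult_iff)
qed


section \<open>The fractional Polya--Szego inequality\<close>

lemma nn_integral_layer_cake_weighted:
  fixes h :: "'a \<Rightarrow> ennreal"
  assumes "sigma_finite_measure M" and [measurable]: "f \<in> borel_measurable M" "h \<in> borel_measurable M"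
  shows "(\<integral>\<^sup>+x. h x * ennreal (f x) \<partial>M)
    = (\<integral>\<^sup>+t. indicator {0..} t * (\<integral>\<^sup>+x. h x * indicator {x. t < f x} x \<partial>M) \<partial>(lborel :: real measure))"
proof -
  interpret M: sigma_finite_measure M by fact
  interpret P: pair_sigma_finite M "lborel :: real measure" ..
  have 1: "ennreal (f x) = (\<integral>\<^sup>+t. indicator {0..} t * indicator {x. t < f x} x \<partial>(lborel :: real measure))" for x
  proof -
    have "(\<integral>\<^sup>+t. indicator {0..} t * indicator {x. t < f x} x \<partial>(lborel :: real measure))
        = (\<integral>\<^sup>+t. indicator {0..<f x} t \<partial>(lborel :: real measure))"
      by (intro nn_integral_cong) (auto split: split_indicator)
    then show ?thesis by (cases "0 \<le> f x") (simp_all add: ennreal_neg)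
  qed
  have m [measurable]: "(\<lambda>z. indicator {x. snd z < f x} (fst z) :: ennreal) \<in> borel_measurable (M \<Otimes>\<^sub>M (lborel :: real measure))"
    unfolding indicator_def by measurable
  have m2 [measurable]: "(\<lambda>t. indicator {x. t < f x} x :: ennreal) \<in> borel_measurable (lborel :: real measure)" for x
    unfolding indicator_def by measurable
  have m3 [measurable]: "(\<lambda>x. indicator {x. t < f x} x :: ennreal) \<in> borel_measurable M" for t
    unfolding indicator_def by measurable
  have "(\<integral>\<^sup>+x. h x * ennreal (f x) \<partial>M)
      = (\<integral>\<^sup>+x. \<integral>\<^sup>+t. h x * (indicator {0..} t * indicator {x. t < f x} x) \<partial>(lborel :: real measure) \<partial>M)"
    unfolding 1 by (intro nn_integral_cong nn_integral_cmult[symmetric]) measurable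
  also have "\<dots> = (\<integral>\<^sup>+t. \<integral>\<^sup>+x. h x * (indicator {0..} t * indicator {x. t < f x} x) \<partial>M \<partial>(lborel :: real measure))"
    by (rule P.Fubini'[symmetric]) (use m in measurable)
  also have "\<dots> = (\<integral>\<^sup>+t. indicator {0..} t * (\<integral>\<^sup>+x. h x * indicator {x. t < f x} x \<partial>M) \<partial>(lborel :: real measure))"
  proof (rule nn_integral_cong)
    fix t :: real
    have "(\<integral>\<^sup>+x. h x * (indicator {0..} t * indicator {x. t < f x} x) \<partial>M)
        = (\<integral>\<^sup>+x. indicator {0..} t * (h x * indicator {x. t < f x} x) \<partial>M)"
      by (intro nn_integral_cong mult.left_commute)
    also have "\<dots> = indicator {0..} t * (\<integral>\<^sup>+x. h x * indicator {x. t < f x} x \<partial>M)"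
      by (rule nn_integral_cmult) measurable
    finally show "(\<integral>\<^sup>+x. h x * (indicator {0..} t * indicator {x. t < f x} x) \<partial>M)
        = indicator {0..} t * (\<integral>\<^sup>+x. h x * indicator {x. t < f x} x \<partial>M)" .
  qed
  finally show ?thesis .
qed

lemma nn_integral_indicator_superlevel:
  assumes [measurable]: "f \<in> borel_measurable M"
  shows "(\<integral>\<^sup>+x. indicator {x. t < f x} x \<partial>M) = emeasure M {x \<in> space M. t < (f x :: real)}"
proof -
  have "(\<integral>\<^sup>+x. indicator {x. t < f x} x \<partial>M) = (\<integral>\<^sup>+x. indicator {x \<in> space M. t < f x} x \<partial>M)"
    by (intro nn_integral_cong) (auto split: split_indicator)
  then show ?thesis by simp
qed

lemma nn_integral_layer_cake:
  assumes "sigma_finite_measure M" and [measurable]: "f \<in> borel_measurable M"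
  shows "(\<integral>\<^sup>+x. ennreal (f x) \<partial>M)
    = (\<integral>\<^sup>+t. indicator {0..} t * emeasure M {x \<in> space M. t < f x} \<partial>(lborel :: real measure))"
  using nn_integral_layer_cake_weighted[OF assms, of "\<lambda>_. 1"]
  by (simp add: nn_integral_indicator_superlevel)

lemma nn_integral_mult_layer_cake:
  assumes M: "sigma_finite_measure M" and [measurable]: "f \<in> borel_measurable M" "g \<in> borel_measurable M"
  shows "(\<integral>\<^sup>+x. ennreal (g x) * ennreal (f x) \<partial>M)
    = (\<integral>\<^sup>+t. indicator {0..} t * (\<integral>\<^sup>+r. indicator {0..} r * emeasure M {x \<in> space M. t < f x \<and> r < g x}
        \<partial>(lborel :: real measure)) \<partial>(lborel :: real measure))"
proof -
  have m: "(\<lambda>x. indicator {x. t < f x} x :: ennreal) \<in> borel_measurable M" for t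
    unfolding indicator_def by measurable
  have "(\<integral>\<^sup>+x. ennreal (g x) * indicator {x. t < f x} x \<partial>M)
      = (\<integral>\<^sup>+r. indicator {0..} r * emeasure M {x \<in> space M. t < f x \<and> r < g x} \<partial>(lborel :: real measure))" for t
  proof -
    have "(\<integral>\<^sup>+x. ennreal (g x) * indicator {x. t < f x} x \<partial>M)
        = (\<integral>\<^sup>+x. indicator {x. t < f x} x * ennreal (g x) \<partial>M)"
      by (intro nn_integral_cong mult.commute)
    also have "\<dots> = (\<integral>\<^sup>+r. indicator {0..} r * (\<integral>\<^sup>+x. indicator {x. t < f x} x * indicator {x. r < g x} x \<partial>M) \<partial>(lborel :: real measure))"
      by (rule nn_integral_layer_cake_weighted[OF M _ m]) measurable
    also have "\<dots> = (\<integral>\<^sup>+r. indicator {0..} r * emeasure M {x \<in> space M. t < f x \<and> r < g x} \<partial>(lborel :: real measure))"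
    proof (intro nn_integral_cong arg_cong2[where f="(*)"] refl)
      fix r :: real
      have "(\<integral>\<^sup>+x. indicator {x. t < f x} x * indicator {x. r < g x} x \<partial>M)
          = (\<integral>\<^sup>+x. indicator {x \<in> space M. t < f x \<and> r < g x} x \<partial>M)"
        by (intro nn_integral_cong) (auto split: split_indicator)
      then show "(\<integral>\<^sup>+x. indicator {x. t < f x} x * indicator {x. r < g x} x \<partial>M)
          = emeasure M {x \<in> space M. t < f x \<and> r < g x}" by simp
    qed
    finally show ?thesis .
  qed
  then show ?thesis
    by (simp add: nn_integral_layer_cake_weighted[OF M])
qed

definition second_moment :: "('a::euclidean_space \<Rightarrow> real) \<Rightarrow> ennreal" where
  "second_moment h = (\<integral>\<^sup>+x. ennreal (h x * (norm x)\<^sup>2) \<partial>lborel)"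

text \<open>
  Whenever the reflection moves a point \<open>x\<close> of \<open>X\<close> into \<open>Y\<close>, the values at the two points are exchanged;
  the gain is the difference of the values times the difference of the squared norms.
\<close>

lemma second_moment_polarization:
  fixes q :: "'a::euclidean_space"
  assumes q: "q \<noteq> 0" and [measurable]: "h \<in> borel_measurable borel" "X \<in> sets borel" "Y \<in> sets borel"
    and h: "\<And>x. 0 \<le> h x" and de: "0 \<le> d" "0 \<le> e"
    and sep: "\<And>x y. x \<in> X \<Longrightarrow> y \<in> Y \<Longrightarrow> d \<le> (norm y)\<^sup>2 - (norm x)\<^sup>2"
      "\<And>x y. x \<in> X \<Longrightarrow> y \<in> Y \<Longrightarrow> e \<le> h y - h x"
  shows "2 * second_moment (polarization q h) + ennreal (d * e) * emeasure lborel {x \<in> X. reflection q x \<in> Y}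
    \<le> 2 * second_moment h"
proof -
  let ?R = "reflection q" and ?Z = "{x \<in> X. reflection q x \<in> Y}"
  have [measurable]: "?R \<in> borel_measurable borel"
    by (rule borel_measurable_reflection[of "\<lambda>_. q" _ "\<lambda>x. x"]) simp_all
  have two: "2 * second_moment k =
      (\<integral>\<^sup>+x. ennreal (k x * (norm x)\<^sup>2) + ennreal (k (?R x) * (norm (?R x))\<^sup>2) \<partial>lborel)"
    if [measurable]: "k \<in> borel_measurable borel" for k :: "'a \<Rightarrow> real"
    using nn_integral_reflection[OF q, of "\<lambda>x. ennreal (k x * (norm x)\<^sup>2)"]
    by (simp add: nn_integral_add mult_2 second_moment_def)
  have pos: "0 \<le> polarization q h x" for x
    using h by (simp add: polarization_def le_max_iff_disj)
  have pw: "polarization q h x * (norm x)\<^sup>2 + polarization q h (?R x) * (norm (?R x))\<^sup>2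
        + d * e * indicator ?Z x
      \<le> h x * (norm x)\<^sup>2 + h (?R x) * (norm (?R x))\<^sup>2" for x
  proof -
    define a b n c where "a = h x" "b = h (?R x)" "n = (norm x)\<^sup>2" "c = reflection_side q x"
    note abn = this
    have nR: "(norm (?R x))\<^sup>2 = n + c" using norm_reflection[OF q] by (simp add: abn)
    have p: "polarization q h x = (if 0 \<le> c then max a b else min a b)"
        "polarization q h (?R x) = (if 0 \<le> c then min a b else max a b)"
      unfolding polarization_reflection[OF q] by (simp_all add: polarization_def abn)
    show ?thesis
    proof (cases "x \<in> ?Z")
      case True
      then have "d \<le> c" "e \<le> b - a" using sep[of x "?R x"] nR by (auto simp: abn)
      then have "d * e \<le> c * (b - a)" using de by (intro mult_mono) auto
      moreover have "0 \<le> c" "a \<le> b" using \<open>d \<le> c\<close> \<open>e \<le> b - a\<close> de by auto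
      ultimately show ?thesis
        using True unfolding p nR abn[symmetric]
        by (simp add: algebra_simps)
    next
      case False
      have "0 \<le> c \<Longrightarrow> min a b * c \<le> b * c" "c \<le> 0 \<Longrightarrow> max a b * c \<le> b * c"
        by (auto intro: mult_right_mono mult_right_mono_neg)
      moreover have "max a b * n + min a b * n = a * n + b * n"
        by (auto simp: max_def min_def)
      ultimately show ?thesis
        using False unfolding p nR abn[symmetric]
        by (auto simp: algebra_simps)
    qed
  qed
  have "2 * second_moment (polarization q h) + ennreal (d * e) * emeasure lborel ?Z
      = (\<integral>\<^sup>+x. ennreal (polarization q h x * (norm x)\<^sup>2)
          + ennreal (polarization q h (?R x) * (norm (?R x))\<^sup>2) + ennreal (d * e) * indicator ?Z x \<partial>lborel)"
    by (subst two) (auto simp: nn_integral_add nn_integral_cmult_indicator)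
  also have "\<dots> \<le> (\<integral>\<^sup>+x. ennreal (h x * (norm x)\<^sup>2) + ennreal (h (?R x) * (norm (?R x))\<^sup>2) \<partial>lborel)"
  proof (rule nn_integral_mono)
    fix x
    have "ennreal (polarization q h x * (norm x)\<^sup>2 + polarization q h (?R x) * (norm (?R x))\<^sup>2
        + d * e * indicator ?Z x) \<le> ennreal (h x * (norm x)\<^sup>2 + h (?R x) * (norm (?R x))\<^sup>2)"
      by (rule ennreal_leI[OF pw])
    then show "ennreal (polarization q h x * (norm x)\<^sup>2)
          + ennreal (polarization q h (?R x) * (norm (?R x))\<^sup>2) + ennreal (d * e) * indicator ?Z x
        \<le> ennreal (h x * (norm x)\<^sup>2) + ennreal (h (?R x) * (norm (?R x))\<^sup>2)"
      using pos h de by (simp add: ennreal_mult' ennreal_indicator[symmetric])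
  qed
  also have "\<dots> = 2 * second_moment h" by (simp add: two)
  finally show ?thesis .
qed

text \<open>
  If no reflection lowers the second moment of \<open>h\<close> by more than \<open>\<delta>\<close>, averaging the previous lemma
  over the mirrors shows that \<open>X\<close> and \<open>Y\<close> cannot both be large: every point of \<open>X\<close> is
  moved into \<open>Y\<close> by a set of reflections whose measure is comparable to that of \<open>Y\<close>.
\<close>

lemma almost_minimal_second_moment:
  fixes h :: "'a::euclidean_space \<Rightarrow> real"
  assumes [measurable]: "h \<in> borel_measurable borel"
    and h: "\<And>x. 0 \<le> h x" and de: "0 < d" "0 < e" and R: "0 < R"
    and fin: "second_moment h < \<infinity>" and "0 \<le> \<delta>"
    and almost: "\<And>q. q \<noteq> 0 \<Longrightarrow> second_moment h \<le> second_moment (polarization q h) + ennreal \<delta>"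
    and [measurable]: "X \<in> sets borel" "Y \<in> sets borel"
    and XR: "\<And>x. x \<in> X \<Longrightarrow> norm x \<le> R" and YR: "\<And>y. y \<in> Y \<Longrightarrow> norm y \<le> R"
    and sep: "\<And>x y. x \<in> X \<Longrightarrow> y \<in> Y \<Longrightarrow> d \<le> (norm y)\<^sup>2 - (norm x)\<^sup>2"
      "\<And>x y. x \<in> X \<Longrightarrow> y \<in> Y \<Longrightarrow> e \<le> h y - h x"
  shows "ennreal (d * e) * (emeasure lborel X * emeasure lborel Y)
    \<le> ennreal ((1 + 32 * R\<^sup>2 / d) ^ DIM('a)) * (2 * ennreal \<delta> * emeasure lborel (ball (0::'a) (3 * R)))"
proof -
  define r where "r = d / (4 * R)"
  define L where "L = 1 + 32 * R\<^sup>2 / d"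
  define Q where "Q = ball (0::'a) (3 * R) - cball 0 r"
  have r: "0 < r" using de R by (simp add: r_def)
  have L: "0 < L" using de R by (simp add: L_def add_pos_nonneg)
  have Q: "open Q" by (simp add: Q_def open_Diff)
  then have [measurable]: "Q \<in> sets borel" by simp
  have meas [measurable]: "(\<lambda>z::'a\<times>'a. reflection (snd z) (fst z)) \<in> borel_measurable (borel \<Otimes>\<^sub>M borel)"
    by measurable
  have one: "ennreal (d * e) * emeasure lborel {x \<in> X. reflection q x \<in> Y} \<le> 2 * ennreal \<delta>" if q: "q \<noteq> 0" for q
  proof -
    let ?z = "ennreal (d * e) * emeasure lborel {x \<in> X. reflection q x \<in> Y}"
    let ?P = "second_moment (polarization q h)"
    have 1: "2 * ?P + ?z \<le> 2 * second_moment h"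
      by (rule second_moment_polarization[OF q]) (use h de sep in auto)
    also have "\<dots> \<le> 2 * (?P + ennreal \<delta>)"
      using almost[OF q] by (intro mult_left_mono) auto
    finally have 2: "2 * ?P + ?z \<le> 2 * ?P + 2 * ennreal \<delta>" by (simp add: distrib_left)
    have "2 * ?P \<le> 2 * ?P + ?z" by simp
    also note 1
    finally have "2 * ?P < \<infinity>"
      using fin by (auto simp: ennreal_mult_less_top ennreal_mult_eq_top_iff less_top[symmetric] top_unique)
    with 2 show ?thesis by (auto simp: ennreal_add_left_cancel_le)
  qed
  \<comment> \<open>the vector realising \<open>y\<close> as an image of \<open>x\<close> has norm between \<open>d / (2 * R)\<close> and \<open>2 * R\<close>\<close>
  have two: "emeasure lborel Y \<le> ennreal (L ^ DIM('a)) * emeasure lborel {q \<in> Q. reflection q x \<in> Y}"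
    if x: "x \<in> X" for x
  proof -
    define S where "S = {q \<in> Q. reflection q x \<in> Y}"
    have [measurable]: "(\<lambda>q. reflection q x) \<in> borel_measurable borel"
      by (rule borel_measurable_reflection[of "\<lambda>q. q" _ "\<lambda>_. x"]) simp_all
    have S [measurable]: "S \<in> sets borel"
      unfolding S_def by measurable
    have "emeasure lebesgue Y \<le> ennreal (L ^ DIM('a)) * emeasure lebesgue S"
    proof (rule emeasure_lipschitz_image_le[OF Q L])
      fix q q' assume "q \<in> Q" "q' \<in> Q"
      then have "norm (reflection q x - reflection q' x) \<le> (1 + 8 * norm x / r) * norm (q - q')"
        by (intro reflection_lipschitz_in_mirror[OF r]) (auto simp: Q_def)
      also have "\<dots> \<le> L * norm (q - q')"
      proof (rule mult_right_mono)
        have "8 * norm x / r \<le> 8 * R / r"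
          using XR[OF x] r by (intro divide_right_mono) auto
        also have "\<dots> = 32 * R\<^sup>2 / d"
          using R de by (simp add: r_def power2_eq_square)
        finally show "1 + 8 * norm x / r \<le> L" by (simp add: L_def)
      qed simp
      finally show "norm (reflection q x - reflection q' x) \<le> L * norm (q - q')" .
    next
      show "Y \<subseteq> (\<lambda>q. reflection q x) ` S"
      proof
        fix y assume y: "y \<in> Y"
        define D where "D = (norm y)\<^sup>2 - (norm x)\<^sup>2"
        define q where "q = (D / (norm (y - x))\<^sup>2) *\<^sub>R (y - x)"
        have D: "d \<le> D" using sep(1)[OF x y] by (simp add: D_def)
        then have ne: "norm x \<noteq> norm y" using de by (auto simp: D_def)
        then have xy: "0 < norm (y - x)" by auto
        have qn: "norm q = D / norm (y - x)"
          using D de xy by (simp add: q_def power2_eq_square)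
        have "norm (y - x) \<le> 2 * R"
          using norm_triangle_ineq4[of y x] XR[OF x] YR[OF y] by linarith
        then have "d / (2 * R) \<le> norm q"
          unfolding qn using D de xy by (intro frac_le) auto
        moreover have "r < d / (2 * R)" using de R by (simp add: r_def field_simps)
        ultimately have "r < norm q" by linarith
        moreover have "norm q \<le> 2 * R"
        proof -
          have "D = (norm y - norm x) * (norm y + norm x)"
            by (simp add: D_def power2_eq_square algebra_simps)
          also have "\<dots> \<le> norm (y - x) * (2 * R)"
            using XR[OF x] YR[OF y] norm_triangle_ineq2[of y x] by (intro mult_mono) auto
          finally show ?thesis unfolding qn using xy by (simp add: pos_divide_le_eq mult.commute)
        qed
        ultimately have "q \<in> Q" using R by (simp add: Q_def)
        moreover have "reflection q x = y"
          unfolding q_def D_def by (rule reflection_to[OF ne])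
        ultimately show "y \<in> (\<lambda>q. reflection q x) ` S"
          using y by (auto simp: S_def intro!: image_eqI[of _ _ q])
      qed
    qed (auto simp: S_def)
    then show ?thesis by (simp add: S_def[symmetric])
  qed
  have ind: "emeasure lborel {x \<in> X. reflection q x \<in> Y}
      = (\<integral>\<^sup>+x. indicator X x * indicator Y (reflection q x) \<partial>lborel)" for q
  proof -
    have [measurable]: "reflection q \<in> borel_measurable borel"
      by (rule borel_measurable_reflection[of "\<lambda>_. q" _ "\<lambda>x. x"]) simp_all
    have "(\<integral>\<^sup>+x. indicator X x * indicator Y (reflection q x) \<partial>lborel)
        = (\<integral>\<^sup>+x. indicator {x \<in> X. reflection q x \<in> Y} x \<partial>lborel)"
      by (intro nn_integral_cong) (auto split: split_indicator)
    then show ?thesis by simp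
  qed
  have ind': "emeasure lborel {q \<in> Q. reflection q x \<in> Y}
      = (\<integral>\<^sup>+q. indicator Q q * indicator Y (reflection q x) \<partial>lborel)" for x
  proof -
    have [measurable]: "(\<lambda>q. reflection q x) \<in> borel_measurable borel"
      by (rule borel_measurable_reflection[of "\<lambda>q. q" _ "\<lambda>_. x"]) simp_all
    have "(\<integral>\<^sup>+q. indicator Q q * indicator Y (reflection q x) \<partial>lborel)
        = (\<integral>\<^sup>+q. indicator {q \<in> Q. reflection q x \<in> Y} q \<partial>lborel)"
      by (intro nn_integral_cong) (auto split: split_indicator)
    then show ?thesis by simp
  qed
  have "emeasure lborel X * emeasure lborel Y = (\<integral>\<^sup>+x. indicator X x * emeasure lborel Y \<partial>lborel)"
    by (simp add: nn_integral_multc)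
  also have "\<dots> \<le> (\<integral>\<^sup>+x. indicator X x * (ennreal (L ^ DIM('a)) * emeasure lborel {q \<in> Q. reflection q x \<in> Y}) \<partial>lborel)"
    by (intro nn_integral_mono) (auto split: split_indicator intro: two)
  also have "\<dots> = (\<integral>\<^sup>+x. \<integral>\<^sup>+q. ennreal (L ^ DIM('a)) * (indicator X x * (indicator Q q * indicator Y (reflection q x))) \<partial>lborel \<partial>lborel)"
    unfolding ind'
  proof (rule nn_integral_cong)
    fix x :: 'a
    have [measurable]: "(\<lambda>q. reflection q x) \<in> borel_measurable borel"
      by (rule borel_measurable_reflection[of "\<lambda>q. q" _ "\<lambda>_. x"]) simp_all
    have m: "(\<lambda>q. indicator Q q * indicator Y (reflection q x) :: ennreal) \<in> borel_measurable lborel"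
      by measurable
    show "indicator X x * (ennreal (L ^ DIM('a)) * (\<integral>\<^sup>+q. indicator Q q * indicator Y (reflection q x) \<partial>lborel))
        = (\<integral>\<^sup>+q. ennreal (L ^ DIM('a)) * (indicator X x * (indicator Q q * indicator Y (reflection q x))) \<partial>lborel)"
      by (subst nn_integral_cmult, rule borel_measurable_times_ennreal[OF borel_measurable_const m],
          subst nn_integral_cmult[OF m], rule mult.left_commute)
  qed
  also have "\<dots> = (\<integral>\<^sup>+q. \<integral>\<^sup>+x. ennreal (L ^ DIM('a)) * (indicator X x * (indicator Q q * indicator Y (reflection q x))) \<partial>lborel \<partial>lborel)"
    by (rule lborel_pair.Fubini'[symmetric]) measurable
  also have "\<dots> = (\<integral>\<^sup>+q. ennreal (L ^ DIM('a)) * (indicator Q q * emeasure lborel {x \<in> X. reflection q x \<in> Y}) \<partial>lborel)"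
    unfolding ind by (intro nn_integral_cong) (simp add: nn_integral_cmult[symmetric] mult_ac)
  finally have "ennreal (d * e) * (emeasure lborel X * emeasure lborel Y)
      \<le> ennreal (d * e) * (\<integral>\<^sup>+q. ennreal (L ^ DIM('a)) * (indicator Q q * emeasure lborel {x \<in> X. reflection q x \<in> Y}) \<partial>lborel)"
    by (intro mult_left_mono) auto
  also have "\<dots> = (\<integral>\<^sup>+q. ennreal (d * e) * (ennreal (L ^ DIM('a)) * (indicator Q q * emeasure lborel {x \<in> X. reflection q x \<in> Y})) \<partial>lborel)"
    unfolding ind by (rule nn_integral_cmult[symmetric]) measurable
  also have "\<dots> \<le> (\<integral>\<^sup>+q. ennreal (L ^ DIM('a)) * (2 * ennreal \<delta>) * indicator (ball (0::'a) (3 * R)) q \<partial>lborel)"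
  proof (rule nn_integral_mono)
    fix q :: 'a
    show "ennreal (d * e) * (ennreal (L ^ DIM('a)) * (indicator Q q * emeasure lborel {x \<in> X. reflection q x \<in> Y}))
        \<le> ennreal (L ^ DIM('a)) * (2 * ennreal \<delta>) * indicator (ball 0 (3 * R)) q"
    proof (cases "q \<in> Q")
      case True
      then have "q \<noteq> 0" "q \<in> ball 0 (3 * R)" using r by (auto simp: Q_def)
      then show ?thesis
        using mult_left_mono[OF one[of q], of "ennreal (L ^ DIM('a))"] True by (simp add: mult_ac)
    qed simp
  qed
  also have "\<dots> = ennreal (L ^ DIM('a)) * (2 * ennreal \<delta>) * emeasure lborel (ball (0::'a) (3 * R))"
    by (rule nn_integral_cmult_indicator) simp
  finally show ?thesis by (simp add: L_def mult.assoc)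
qed


lemma nn_integral_superlevel_eq:
  fixes f g :: "'a::euclidean_space \<Rightarrow> real"
  assumes [measurable]: "f \<in> borel_measurable borel" "g \<in> borel_measurable borel"
    and eq: "\<And>t. 0 \<le> t \<Longrightarrow> emeasure lborel {x. t < f x} = emeasure lborel {x. t < g x}"
  shows "(\<integral>\<^sup>+x. ennreal (f x) \<partial>lborel) = (\<integral>\<^sup>+x. ennreal (g x) \<partial>lborel)"
proof -
  have "indicator {0..} t * emeasure lborel {x. t < f x} = indicator {0..} t * emeasure lborel {x. t < g x}" for t
    by (cases "0 \<le> t") (simp_all add: eq)
  then show ?thesis
    by (simp add: nn_integral_layer_cake[OF sigma_finite_lborel])
qed

lemma thin_shell_ball:
  assumes "0 \<le> \<rho>" "0 < \<kappa>"
  obtains \<eta> where "0 < \<eta>"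
    "measure lborel (ball (0::'a::euclidean_space) (\<rho> + \<eta>)) - measure lborel (ball (0::'a) \<rho>) < \<kappa>"
proof -
  let ?c = "unit_ball_vol (real DIM('a))"
  have "((\<lambda>\<eta>. ?c * (\<rho> + \<eta>) ^ DIM('a) - ?c * \<rho> ^ DIM('a)) \<longlongrightarrow> ?c * (\<rho> + 0) ^ DIM('a) - ?c * \<rho> ^ DIM('a)) (at_right 0)"
    by (intro tendsto_intros)
  then have "((\<lambda>\<eta>. ?c * (\<rho> + \<eta>) ^ DIM('a) - ?c * \<rho> ^ DIM('a)) \<longlongrightarrow> 0) (at_right 0)"
    by simp
  then have "eventually (\<lambda>\<eta>. ?c * (\<rho> + \<eta>) ^ DIM('a) - ?c * \<rho> ^ DIM('a) < \<kappa>) (at_right 0)"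
    using assms(2) by (rule order_tendstoD)
  then obtain b where b: "b > 0" "\<And>\<eta>. 0 < \<eta> \<Longrightarrow> \<eta> < b \<Longrightarrow> ?c * (\<rho> + \<eta>) ^ DIM('a) - ?c * \<rho> ^ DIM('a) < \<kappa>"
    unfolding eventually_at_right_field by auto
  have "?c * (\<rho> + b/2) ^ DIM('a) - ?c * \<rho> ^ DIM('a) < \<kappa>"
    using b by simp
  then show ?thesis
    using that[of "b/2"] b(1) assms(1) by (simp add: content_ball)
qed

text \<open>
  Compare a function \<open>h\<close> having almost minimal second moment with the centred ball \<open>ball 0 \<rho>\<close> of
  the same measure as \<open>{h > t}\<close>. What the ball misses of \<open>{h > t}\<close> has the same measure as what it
  contains in excess. After removal of a thin shell, which keeps the norms apart,
  \<open>almost_minimal_second_moment\<close> bounds the product of the two measures.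
\<close>

lemma almost_minimal_superlevel_tendsto:
  fixes h :: "nat \<Rightarrow> 'a::euclidean_space \<Rightarrow> real"
  assumes h_meas [measurable]: "\<And>n. h n \<in> borel_measurable borel"
    and h: "\<And>n x. 0 \<le> h n x" "\<And>n x. R \<le> norm x \<Longrightarrow> h n x = 0" and R: "0 < R"
    and fin: "\<And>n. second_moment (h n) < \<infinity>"
    and \<delta>: "\<And>n. 0 \<le> \<delta> n" "\<delta> \<longlonglongrightarrow> 0"
    and almost: "\<And>n q. q \<noteq> 0 \<Longrightarrow> second_moment (h n) \<le> second_moment (polarization q (h n)) + ennreal (\<delta> n)"
    and t: "0 \<le> t" "0 < e" and \<rho>: "0 \<le> \<rho>"
    and same: "\<And>n. emeasure lborel {x. t < h n x} = emeasure lborel (ball (0::'a) \<rho>)"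
  shows "(\<lambda>n. measure lborel (ball 0 \<rho> - {x. t - e < h n x})) \<longlonglongrightarrow> 0"
proof (rule LIMSEQ_I)
  fix \<kappa> :: real assume \<kappa>: "0 < \<kappa>"
  obtain \<eta> where \<eta>: "0 < \<eta>" "measure lborel (ball (0::'a) (\<rho> + \<eta>)) - measure lborel (ball (0::'a) \<rho>) < \<kappa> / 2"
    using thin_shell_ball[OF \<rho>, of "\<kappa> / 2"] \<kappa> by auto
  define d where "d = (\<rho> + \<eta>)\<^sup>2 - \<rho>\<^sup>2"
  have d: "0 < d" using \<eta> \<rho> by (simp add: d_def power2_eq_square algebra_simps add_pos_nonneg)
  define S where "S = R + \<rho>"
  have S: "0 < S" "R \<le> S" "\<rho> \<le> S" using R \<rho> by (auto simp: S_def)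
  define B where "B = ball (0::'a) \<rho>"
  define A where "A n = {x. t < h n x}" for n
  define X where "X n = B - {x. t - e < h n x}" for n
  define Y where "Y n = A n - ball 0 (\<rho> + \<eta>)" for n
  have [measurable]: "B \<in> sets borel" "A n \<in> sets borel" "X n \<in> sets borel" "Y n \<in> sets borel" for n
    unfolding A_def X_def Y_def B_def by measurable
  have B [simp]: "B \<in> fmeasurable lborel"
    unfolding B_def by (intro fmeasurableI) (auto simp: emeasure_ball \<rho>)
  have AR: "norm x < R" if "x \<in> A n" for n x
    using that h(2)[of x n] t by (force simp: A_def)
  have A [simp]: "A n \<in> fmeasurable lborel" for n
  proof (rule fmeasurableI2)
    show "ball (0::'a) R \<in> fmeasurable lborel"
      using R by (intro fmeasurableI) (auto simp: emeasure_ball)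
    show "A n \<subseteq> ball 0 R" using AR[of _ n] by auto
  qed simp
  have X [simp]: "X n \<in> fmeasurable lborel" for n
    by (rule fmeasurableI2[OF B]) (auto simp: X_def)
  have Y [simp]: "Y n \<in> fmeasurable lborel" for n
    by (rule fmeasurableI2[OF A[of n]]) (auto simp: Y_def)
  have AB: "measure lborel (A n) = measure lborel B" for n
    using same[of n] by (simp add: measure_def A_def B_def)
  define C where "C = (1 + 32 * S\<^sup>2 / d) ^ DIM('a) * (2 * measure lborel (ball (0::'a) (3 * S)))"
  have main: "d * e * (measure lborel (X n) * measure lborel (Y n)) \<le> C * \<delta> n" for n
  proof -
    have "ennreal (d * e) * (emeasure lborel (X n) * emeasure lborel (Y n))
      \<le> ennreal ((1 + 32 * S\<^sup>2 / d) ^ DIM('a)) * (2 * ennreal (\<delta> n) * emeasure lborel (ball (0::'a) (3 * S)))"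
    proof (rule almost_minimal_second_moment[OF h_meas[of n] h(1) d t(2) S(1) fin \<delta>(1) almost])
      show "norm x \<le> S" if "x \<in> X n" for x using that S by (auto simp: X_def B_def)
      show "norm x \<le> S" if "x \<in> Y n" for x using that S AR[of x n] by (auto simp: Y_def)
      fix x y assume x: "x \<in> X n" and y: "y \<in> Y n"
      have "\<rho> + \<eta> \<le> norm y" using y by (auto simp: Y_def)
      then have "(\<rho> + \<eta>)\<^sup>2 \<le> (norm y)\<^sup>2" using \<rho> \<eta> by (intro power_mono) auto
      moreover have "(norm x)\<^sup>2 \<le> \<rho>\<^sup>2" using x by (intro power_mono) (auto simp: X_def B_def)
      ultimately show "d \<le> (norm y)\<^sup>2 - (norm x)\<^sup>2" by (simp add: d_def)
      show "e \<le> h n y - h n x" using x y by (auto simp: X_def Y_def A_def)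
    qed auto
    also have "\<dots> = ennreal (C * \<delta> n)"
      using \<delta>(1)[of n] d S
      by (simp add: C_def emeasure_eq_measure2 fmeasurableI emeasure_ball ennreal_mult' content_ball mult_ac)
    also have "ennreal (d * e) * (emeasure lborel (X n) * emeasure lborel (Y n))
       = ennreal (d * e * (measure lborel (X n) * measure lborel (Y n)))"
      using d t by (simp add: emeasure_eq_measure2 ennreal_mult')
    finally show ?thesis
      using \<delta>(1)[of n] d S by (subst (asm) ennreal_le_iff) (auto simp: C_def intro!: mult_nonneg_nonneg add_nonneg_nonneg)
  qed
  have shell: "ball (0::'a) (\<rho> + \<eta>) \<in> fmeasurable lborel"
    using \<rho> \<eta> by (intro fmeasurableI) (auto simp: emeasure_ball)
  have mD: "measure lborel (P - Q) = measure lborel P - measure lborel (P \<inter> Q)"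
    if "P \<in> fmeasurable lborel" "Q \<in> fmeasurable lborel" for P Q :: "'a set"
  proof -
    have "measure lborel (P - P \<inter> Q) = measure lborel P - measure lborel (P \<inter> Q)"
      using that by (intro measure_Diff) (auto simp: fmeasurable_def)
    moreover have "P - P \<inter> Q = P - Q" by auto
    ultimately show ?thesis by simp
  qed
  have XY: "measure lborel (X n) \<le> measure lborel (Y n) + \<kappa> / 2" for n
  proof -
    have "measure lborel (X n) \<le> measure lborel (B - A n)"
      using t by (intro measure_mono_fmeasurable fmeasurable.Diff A B) (auto simp: X_def A_def)
    also have "\<dots> = measure lborel B - measure lborel (B \<inter> A n)"
      using mD[OF B A] .
    also have "\<dots> = measure lborel (A n) - measure lborel (A n \<inter> B)"
      by (simp add: AB Int_commute)
    also have "\<dots> = measure lborel (A n - B)"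
      using mD[OF A B, symmetric] .
    also have "\<dots> \<le> measure lborel (Y n \<union> (ball 0 (\<rho> + \<eta>) - B))"
      by (intro measure_mono_fmeasurable fmeasurable.Un fmeasurable.Diff Y B shell) (auto simp: Y_def)
    also have "\<dots> \<le> measure lborel (Y n) + measure lborel (ball 0 (\<rho> + \<eta>) - B)"
      by (intro measure_Un_le) auto
    also have "measure lborel (ball 0 (\<rho> + \<eta>) - B) = measure lborel (ball (0::'a) (\<rho> + \<eta>)) - measure lborel B"
      using \<rho> \<eta> by (intro measure_Diff) (auto simp: B_def emeasure_ball)
    finally show ?thesis using \<eta>(2) by (simp add: B_def)
  qed
  have "(\<lambda>n. C * \<delta> n) \<longlonglongrightarrow> C * 0" by (intro tendsto_intros \<delta>)
  moreover have "C * 0 < d * e * (\<kappa> * (\<kappa> / 2))" using d t \<kappa> by simp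
  ultimately have "eventually (\<lambda>n. C * \<delta> n < d * e * (\<kappa> * (\<kappa> / 2))) sequentially"
    by (rule order_tendstoD)
  then obtain n0 where n0: "\<And>n. n \<ge> n0 \<Longrightarrow> C * \<delta> n < d * e * (\<kappa> * (\<kappa> / 2))"
    by (auto simp: eventually_sequentially)
  have "measure lborel (X n) < \<kappa>" if "n \<ge> n0" for n
  proof (rule ccontr)
    assume "\<not> measure lborel (X n) < \<kappa>"
    then have "\<kappa> \<le> measure lborel (X n)" "\<kappa> / 2 \<le> measure lborel (Y n)" using XY[of n] by auto
    then have "d * e * (\<kappa> * (\<kappa> / 2)) \<le> d * e * (measure lborel (X n) * measure lborel (Y n))"
      using d t \<kappa> by (intro mult_left_mono mult_mono) auto
    with main[of n] n0[OF that] show False by linarith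
  qed
  then show "\<exists>n0. \<forall>n\<ge>n0. norm (measure lborel (ball 0 \<rho> - {x. t - e < h n x}) - 0) < \<kappa>"
    by (auto simp: X_def B_def)
qed

text \<open>
  The functions that have the distribution of \<open>w\<close> and at most its energy are stable under
  polarization. A sequence in this class that minimises the second moment has the rearrangement of
  \<open>w\<close> as its only possible limit, and the energy is lower semicontinuous.
\<close>

theorem fractional_polya_szego:
  fixes w ws :: "'a::euclidean_space \<Rightarrow> real"
  assumes s: "0 < s" and [measurable]: "w \<in> borel_measurable borel" "ws \<in> borel_measurable borel"
    and w: "\<And>x. 0 \<le> w x" "\<And>x. w x \<le> M" "\<And>x. R \<le> norm x \<Longrightarrow> w x = 0" and R: "0 < R"
    and ws: "\<And>x. 0 \<le> ws x" "\<And>t. 0 \<le> t \<Longrightarrow> \<exists>\<rho>\<ge>0. {x. t < ws x} = ball 0 \<rho>"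
    and same: "\<And>t. 0 \<le> t \<Longrightarrow> emeasure lborel {x. t < ws x} = emeasure lborel {x. t < w x}"
  shows "gagliardo_energy s UNIV ws \<le> gagliardo_energy s UNIV w"
proof -
  define \<A> where "\<A> = {h :: 'a \<Rightarrow> real. h \<in> borel_measurable borel \<and> (\<forall>x. 0 \<le> h x \<and> h x \<le> M) \<and>
      (\<forall>x. R \<le> norm x \<longrightarrow> h x = 0) \<and>
      (\<forall>t\<ge>0. emeasure lborel {x. t < h x} = emeasure lborel {x. t < w x}) \<and>
      gagliardo_energy s UNIV h \<le> gagliardo_energy s UNIV w}"
  have M: "0 \<le> M" using w(1,2) order_trans by blast
  have wA: "w \<in> \<A>" using w by (auto simp: \<A>_def)
  have pol: "polarization q h \<in> \<A>" if h: "h \<in> \<A>" and q: "q \<noteq> 0" for h q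
  proof -
    have [measurable]: "h \<in> borel_measurable borel" using h by (simp add: \<A>_def)
    have "polarization q h x = 0" if x: "R \<le> norm x" for x
    proof (cases "0 \<le> reflection_side q x")
      case True
      have "(norm x)\<^sup>2 \<le> (norm (reflection q x))\<^sup>2" using norm_reflection[OF q, of x] True by simp
      then have "norm x \<le> norm (reflection q x)" by (rule power2_le_imp_le) simp
      then show ?thesis using h x True by (simp add: \<A>_def polarization_def)
    next
      case False
      then show ?thesis using h x by (simp add: \<A>_def polarization_def min_def)
    qed
    moreover have "0 \<le> polarization q h x \<and> polarization q h x \<le> M" for x
      using h by (simp add: \<A>_def polarization_def le_max_iff_disj min_le_iff_disj)
    moreover have "gagliardo_energy s UNIV (polarization q h) \<le> gagliardo_energy s UNIV w"
      using gagliardo_energy_polarization_le[OF q s, of h] h by (auto simp: \<A>_def)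
    ultimately show ?thesis
      using h by (auto simp: \<A>_def emeasure_superlevel_polarization[OF q])
  qed
  have fin: "second_moment h < \<infinity>" if "h \<in> \<A>" for h
  proof -
    have "second_moment h \<le> (\<integral>\<^sup>+x. ennreal (M * R\<^sup>2) * indicator (ball 0 R) x \<partial>(lborel :: 'a measure))"
      unfolding second_moment_def
    proof (rule nn_integral_mono)
      fix x :: 'a
      show "ennreal (h x * (norm x)\<^sup>2) \<le> ennreal (M * R\<^sup>2) * indicator (ball 0 R) x"
        using that M by (cases "norm x < R") (auto simp: \<A>_def intro!: ennreal_leI mult_mono power_mono)
    qed
    also have "\<dots> < \<infinity>"
      using R by (subst nn_integral_cmult_indicator) (auto simp: ennreal_mult_less_top emeasure_ball)
    finally show ?thesis .
  qed
  define m where "m = (INF h\<in>\<A>. second_moment h)"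
  have "m \<le> second_moment w" unfolding m_def by (rule INF_lower[OF wA])
  then have m: "m \<noteq> \<infinity>" using fin[OF wA] by (auto simp: top_unique)
  have "\<exists>h\<in>\<A>. second_moment h < m + ennreal (1 / Suc n)" for n
  proof -
    have "m < m + ennreal (1 / Suc n)"
      using m ennreal_add_left_cancel_less[of m 0 "ennreal (1 / Suc n)"] by (simp add: zero_less_iff_neq_zero)
    then show ?thesis unfolding m_def INF_less_iff .
  qed
  then obtain h where h: "\<And>n. h n \<in> \<A>" "\<And>n. second_moment (h n) < m + ennreal (1 / Suc n)"
    by metis
  have h_meas [measurable]: "\<And>n. h n \<in> borel_measurable borel"
    and h_bd: "\<And>n x. 0 \<le> h n x" "\<And>n x. h n x \<le> M" and h0: "\<And>n x. R \<le> norm x \<Longrightarrow> h n x = 0"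
    and h_eq: "\<And>n t. 0 \<le> t \<Longrightarrow> emeasure lborel {x. t < h n x} = emeasure lborel {x. t < w x}"
    and h_en: "\<And>n. gagliardo_energy s UNIV (h n) \<le> gagliardo_energy s UNIV w"
    using h(1) by (auto simp: \<A>_def)
  have almost: "second_moment (h n) \<le> second_moment (polarization q (h n)) + ennreal (1 / Suc n)" if "q \<noteq> 0" for n q
  proof -
    have "m \<le> second_moment (polarization q (h n))"
      unfolding m_def by (rule INF_lower[OF pol[OF h(1) that]])
    then show ?thesis
      using h(2)[of n] by (meson add_right_mono less_imp_le order_trans)
  qed
  have level: "(\<lambda>n. measure lborel ({x. t < ws x} - {x. t - e < h n x})) \<longlonglongrightarrow> 0" if t: "0 \<le> t" and e: "0 < e" for t e
  proof -
    obtain \<rho> where \<rho>: "0 \<le> \<rho>" "{x. t < ws x} = ball 0 \<rho>" using ws(2)[OF t] by blast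
    show ?thesis
      unfolding \<rho>(2)
    proof (rule almost_minimal_superlevel_tendsto[where \<delta>="\<lambda>n. 1 / Suc n", OF h_meas h_bd(1) h0 R fin[OF h(1)]])
      show "(\<lambda>n. 1 / real (Suc n)) \<longlonglongrightarrow> 0" by (rule LIMSEQ_Suc[OF lim_1_over_n])
      show "emeasure lborel {x. t < h n x} = emeasure lborel (ball (0::'a) \<rho>)" for n
        using same[OF t] h_eq[OF t] \<rho>(2) by simp
    qed (use almost t e \<rho> in auto)
  qed
  have ws_le: "ws x \<le> M" for x
  proof (rule ccontr)
    assume x: "\<not> ws x \<le> M"
    obtain \<rho> where \<rho>: "0 \<le> \<rho>" "{x. M < ws x} = ball 0 \<rho>" using ws(2)[OF M] by blast
    have "emeasure lborel (ball (0::'a) \<rho>) = 0"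
      using same[OF M] w(2) \<rho>(2) by (simp add: not_less[symmetric])
    moreover have "unit_ball_vol (real DIM('a)) \<noteq> 0"
      using less_imp_neq[OF unit_ball_vol_pos[of "real DIM('a)"]] by auto
    ultimately have "\<rho> = 0"
      using \<rho>(1) by (simp add: emeasure_ball)
    then have "{x. M < ws x} = {}" using \<rho>(2) by simp
    then show False using x by (simp add: set_eq_iff not_le)
  qed
  obtain \<rho>0 where \<rho>0: "0 \<le> \<rho>0" "{x. 0 < ws x} = ball 0 \<rho>0" using ws(2)[of 0] by auto
  \<comment> \<open>if \<open>h n x + 2 * e < ws x\<close>, some multiple of \<open>e\<close> is a level that separates the two values by at least \<open>e\<close>\<close>
  have bad: "(\<lambda>n. measure lborel {x. h n x + 2 * e < ws x}) \<longlonglongrightarrow> 0" if e: "0 < e" for e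
  proof -
    define J where "J = nat \<lceil>M / e\<rceil>"
    let ?Z = "\<lambda>n j. {x. real j * e < ws x} - {x. real j * e - e < h n x}"
    have Z: "?Z n j \<in> fmeasurable lborel" for n j
    proof (rule fmeasurableI2)
      show "ball (0::'a) \<rho>0 \<in> fmeasurable lborel"
        using \<rho>0 by (intro fmeasurableI) (auto simp: emeasure_ball)
      have "{x. real j * e < ws x} \<subseteq> {x. 0 < ws x}" using e
        by (auto intro: order_le_less_trans[rotated])
      then show "?Z n j \<subseteq> ball 0 \<rho>0" using \<rho>0(2) by auto
    qed measurable
    have sub: "{x. h n x + 2 * e < ws x} \<subseteq> (\<Union>j\<in>{..J}. ?Z n j)" for n
    proof
      fix x assume "x \<in> {x. h n x + 2 * e < ws x}"
      then have x: "h n x + 2 * e < ws x" by simp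
      then have pos: "0 < ws x / e" using h_bd(1)[of n x] e by simp
      define j where "j = nat (\<lceil>ws x / e\<rceil> - 1)"
      have j: "real j = of_int \<lceil>ws x / e\<rceil> - 1"
        using pos by (simp add: j_def of_nat_nat)
      have "real j < ws x / e" "ws x / e \<le> real j + 1" unfolding j by linarith+
      then have "real j * e < ws x" "ws x \<le> (real j + 1) * e"
        using e by (simp_all add: field_simps)
      moreover have "j \<le> J"
      proof -
        have "ws x / e \<le> M / e" using ws_le[of x] e by (simp add: divide_right_mono)
        then have "\<lceil>ws x / e\<rceil> \<le> \<lceil>M / e\<rceil>" by (rule ceiling_mono)
        then show ?thesis by (simp add: j_def J_def)
      qed
      moreover have "h n x \<le> real j * e - e"
        using x \<open>ws x \<le> (real j + 1) * e\<close> by (simp add: algebra_simps)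
      ultimately show "x \<in> (\<Union>j\<in>{..J}. ?Z n j)" by auto
    qed
    have "(\<lambda>n. \<Sum>j\<le>J. measure lborel (?Z n j)) \<longlonglongrightarrow> (\<Sum>j\<le>J. 0)"
      using e by (intro tendsto_sum level) auto
    then have lim: "(\<lambda>n. \<Sum>j\<le>J. measure lborel (?Z n j)) \<longlonglongrightarrow> 0" by simp
    have "measure lborel {x. h n x + 2 * e < ws x} \<le> (\<Sum>j\<le>J. measure lborel (?Z n j))" for n
    proof -
      have "measure lborel {x. h n x + 2 * e < ws x} \<le> measure lborel (\<Union>j\<in>{..J}. ?Z n j)"
        using sub Z by (intro measure_mono_fmeasurable fmeasurable.finite_UN) auto
      also have "\<dots> \<le> (\<Sum>j\<le>J. measure lborel (?Z n j))"
        using Z by (intro measure_UNION_le) auto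
      finally show ?thesis .
    qed
    then show ?thesis
      by (intro tendsto_sandwich[OF _ _ tendsto_const lim] always_eventually) auto
  qed
  have int_bd: "integrable lborel k" if [measurable]: "k \<in> borel_measurable borel"
    and k: "\<And>x. 0 \<le> k x" "\<And>x. k x \<le> M" "\<And>x. S \<le> norm x \<Longrightarrow> k x = 0" and S: "0 \<le> S"
    for k :: "'a \<Rightarrow> real" and S
  proof (rule integrableI_bounded_set[of "ball 0 S"])
    show "emeasure lborel (ball (0::'a) S) < \<infinity>" using S by (simp add: emeasure_ball)
    show "AE x in lborel. x \<in> ball 0 S \<longrightarrow> norm (k x) \<le> M" using k by auto
    show "AE x in lborel. x \<notin> ball 0 S \<longrightarrow> k x = 0" using k(3) by (auto simp: not_less)
  qed auto
  have ws0: "ws x = 0" if "\<rho>0 \<le> norm x" for x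
  proof -
    have "x \<notin> {x. 0 < ws x}" unfolding \<rho>0(2) using that by simp
    then show ?thesis using ws(1)[of x] by simp
  qed
  have ws_int: "integrable lborel ws"
    by (rule int_bd[OF _ ws(1) ws_le ws0 \<rho>0(1)]) auto
  have h_int: "integrable lborel (h n)" for n
    by (rule int_bd[OF _ h_bd h0]) (use R in auto)
  have same_int: "(\<integral>x. h n x \<partial>lborel) = (\<integral>x. ws x \<partial>lborel)" for n
  proof -
    have "(\<integral>\<^sup>+x. ennreal (h n x) \<partial>lborel) = (\<integral>\<^sup>+x. ennreal (ws x) \<partial>lborel)"
      by (rule nn_integral_superlevel_eq) (auto simp: same h_eq)
    then show ?thesis
      using h_bd(1) ws(1) by (simp add: integral_eq_nn_integral)
  qed
  define D where "D n = (\<integral>x. norm (ws x - h n x) \<partial>lborel)" for n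
  \<comment> \<open>both functions have the same integral, so the distance is twice the integral of the positive part\<close>
  have Dbd: "D n \<le> 4 * e * measure lborel (ball (0::'a) \<rho>0) + 2 * M * measure lborel {x. h n x + 2 * e < ws x}"
    if e: "0 < e" for n e
  proof -
    let ?Z = "{x. h n x + 2 * e < ws x}"
    have Z0: "?Z \<subseteq> ball 0 \<rho>0"
      using h_bd(1)[of n] e \<rho>0(2) by (auto simp: set_eq_iff) (smt (verit))
    have Z: "?Z \<in> fmeasurable lborel"
    proof (rule fmeasurableI2[OF _ Z0])
      show "ball (0::'a) \<rho>0 \<in> fmeasurable lborel"
        using \<rho>0 by (intro fmeasurableI) (auto simp: emeasure_ball)
    qed measurable
    have B: "ball (0::'a) \<rho>0 \<in> fmeasurable lborel"
      using \<rho>0 by (intro fmeasurableI) (auto simp: emeasure_ball)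
    have "D n = (\<integral>x. 2 * max 0 (ws x - h n x) - ws x + h n x \<partial>lborel)"
      unfolding D_def by (rule Bochner_Integration.integral_cong) (auto simp: max_def)
    also have "\<dots> = 2 * (\<integral>x. max 0 (ws x - h n x) \<partial>lborel)"
      using ws_int h_int[of n] same_int[of n] by simp
    also have "(\<integral>x. max 0 (ws x - h n x) \<partial>lborel)
        \<le> (\<integral>x. 2 * e * indicator (ball 0 \<rho>0) x + M * indicator ?Z x \<partial>lborel)"
    proof (rule integral_mono)
      show "integrable lborel (\<lambda>x. max 0 (ws x - h n x))" using ws_int h_int[of n] by simp
      show "integrable lborel (\<lambda>x. 2 * e * indicator (ball 0 \<rho>0) x + M * indicator ?Z x)"
        using B Z by (auto simp: fmeasurable_def)
      fix x
      show "max 0 (ws x - h n x) \<le> 2 * e * indicator (ball 0 \<rho>0) x + M * indicator ?Z x"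
        using e ws_le[of x] h_bd(1)[of n x] ws0[of x] M
        by (cases "norm x < \<rho>0"; cases "x \<in> ?Z") (auto simp: indicator_def)
    qed
    also have "\<dots> = 2 * e * measure lborel (ball (0::'a) \<rho>0) + M * measure lborel ?Z"
      using B Z by (simp add: fmeasurable_def)
    finally show ?thesis by simp
  qed
  have "D \<longlonglongrightarrow> 0"
  proof (rule LIMSEQ_I)
    fix \<kappa> :: real assume \<kappa>: "0 < \<kappa>"
    define V where "V = measure lborel (ball (0::'a) \<rho>0)"
    define e where "e = \<kappa> / (8 * (V + 1))"
    have V: "0 \<le> V" by (simp add: V_def)
    then have e: "0 < e" using \<kappa> by (simp add: e_def)
    have "4 * e * V \<le> 4 * e * (V + 1)" using e by simp
    also have "\<dots> = \<kappa> / 2" using V by (simp add: e_def field_simps)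
    finally have 1: "4 * e * V \<le> \<kappa> / 2" .
    have "(\<lambda>n. 2 * M * measure lborel {x. h n x + 2 * e < ws x}) \<longlonglongrightarrow> 2 * M * 0"
      by (intro tendsto_intros bad e)
    moreover have "2 * M * 0 < \<kappa> / 2" using \<kappa> by simp
    ultimately have "eventually (\<lambda>n. 2 * M * measure lborel {x. h n x + 2 * e < ws x} < \<kappa> / 2) sequentially"
      by (rule order_tendstoD)
    then obtain n0 where n0: "\<And>n. n \<ge> n0 \<Longrightarrow> 2 * M * measure lborel {x. h n x + 2 * e < ws x} < \<kappa> / 2"
      by (auto simp: eventually_sequentially)
    have "D n < \<kappa>" if "n \<ge> n0" for n
      using Dbd[OF e, of n] 1 n0[OF that] unfolding V_def by linarith
    moreover have "0 \<le> D n" for n by (simp add: D_def)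
    ultimately show "\<exists>n0. \<forall>n\<ge>n0. norm (D n - 0) < \<kappa>" by auto
  qed
  then obtain r where r: "strict_mono r" "AE x in lborel. (\<lambda>n. ws x - h (r n) x) \<longlonglongrightarrow> 0"
    using tendsto_L1_AE_subseq[of lborel "\<lambda>n x. ws x - h n x"] ws_int h_int unfolding D_def by auto
  have "AE x in lborel. (\<lambda>n. h (r n) x) \<longlonglongrightarrow> ws x"
    using r(2)
  proof eventually_elim
    case (elim x)
    from tendsto_diff[OF tendsto_const[of "ws x"] elim] show ?case by simp
  qed
  then have "AE x in lebesgue. (\<lambda>n. h (r n) x) \<longlonglongrightarrow> ws x"
    by (rule AE_completion)
  then show ?thesis
  proof (rule gagliardo_energy_Fatou[rotated 2])
    show "h (r n) \<in> borel_measurable lebesgue" for n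
      by (rule measurable_completion) simp
    show "ws \<in> borel_measurable lebesgue"
      by (rule measurable_completion) simp
    show "gagliardo_energy s UNIV (h (r n)) \<le> gagliardo_energy s UNIV w" for n
      by (rule h_en)
  qed
qed


section \<open>The Schwarz rearrangement\<close>

abbreviation level_measure :: "'a::euclidean_space set \<Rightarrow> ('a \<Rightarrow> real) \<Rightarrow> real \<Rightarrow> real" where
  "level_measure D g t \<equiv> measure lebesgue {x \<in> D. t < \<bar>g x\<bar>}"

text \<open>
  The centred ball of this radius has the measure of the superlevel set of \<open>\<bar>g\<bar>\<close> at level \<open>t\<close>.
\<close>

definition level_radius :: "'a::euclidean_space set \<Rightarrow> ('a \<Rightarrow> real) \<Rightarrow> real \<Rightarrow> real" where
  "level_radius D g t = root DIM('a) (level_measure D g t / measure lebesgue (ball (0::'a) 1))"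

lemma unit_ball_measure_pos: "0 < measure lebesgue (ball (0::'a::euclidean_space) 1)"
  by (simp add: content_ball)

lemma level_radius_nonneg: "0 \<le> level_radius D g t"
  by (simp add: level_radius_def real_root_ge_zero)

lemma less_level_radius_iff:
  fixes x :: "'a::euclidean_space" and D :: "'a set"
  shows "norm x < level_radius D g t \<longleftrightarrow> measure lebesgue (ball (0::'a) 1) * norm x ^ DIM('a) < level_measure D g t"
proof -
  have "norm x < level_radius D g t \<longleftrightarrow> root DIM('a) (norm x ^ DIM('a)) < level_radius D g t"
    by (simp add: real_root_power_cancel)
  also have "\<dots> \<longleftrightarrow> norm x ^ DIM('a) < level_measure D g t / measure lebesgue (ball (0::'a) 1)"
    unfolding level_radius_def by (rule real_root_less_iff) simp
  also have "\<dots> \<longleftrightarrow> measure lebesgue (ball (0::'a) 1) * norm x ^ DIM('a) < level_measure D g t"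
    using unit_ball_measure_pos[where 'a='a] by (simp add: pos_less_divide_eq mult.commute)
  finally show ?thesis .
qed

lemma measure_ball_level_radius:
  fixes D :: "'a::euclidean_space set"
  shows "measure lborel (ball (0::'a) (level_radius D g t)) = level_measure D g t"
proof -
  have "unit_ball_vol (real DIM('a)) \<noteq> 0"
    using less_imp_neq[OF unit_ball_vol_pos[of "real DIM('a)"]] by auto
  then show ?thesis
    using level_radius_nonneg[of D g t]
    by (simp add: content_ball level_radius_def real_root_pow_pos2 measure_nonneg)
qed

locale rearrangement =
  fixes D :: "'a::euclidean_space set" and g :: "'a \<Rightarrow> real"
  assumes D: "D \<in> lmeasurable" and g [measurable]: "g \<in> borel_measurable (lebesgue_on D)"
begin

lemma level_lmeasurable: "{x \<in> D. t < \<bar>g x\<bar>} \<in> lmeasurable"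
proof (rule fmeasurableI2[OF D])
  have "{x \<in> space (lebesgue_on D). t < \<bar>g x\<bar>} \<in> sets (lebesgue_on D)" by measurable
  then show "{x \<in> D. t < \<bar>g x\<bar>} \<in> sets lebesgue"
    using D by (simp add: sets_restrict_space_iff fmeasurableD)
qed auto

lemma distribution_function_eq: "distribution_function D g t = ennreal (level_measure D g t)"
  unfolding distribution_function_def by (rule emeasure_eq_measure2[OF level_lmeasurable])

lemma level_measure_antimono: "t \<le> t' \<Longrightarrow> level_measure D g t' \<le> level_measure D g t"
  by (intro measure_mono_fmeasurable level_lmeasurable fmeasurableD) auto

lemma level_measure_right_continuous:
  assumes "c < level_measure D g t"
  obtains t' where "t < t'" "c < level_measure D g t'"
proof -
  let ?A = "\<lambda>n::nat. {x \<in> D. t + 1 / Suc n < \<bar>g x\<bar>}"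
  have inc: "incseq ?A"
  proof (rule incseq_SucI, rule subsetI)
    fix n x assume "x \<in> ?A n"
    moreover have "1 / real (Suc (Suc n)) \<le> 1 / real (Suc n)" by (intro divide_left_mono) auto
    ultimately have "x \<in> D" "t + 1 / real (Suc (Suc n)) < \<bar>g x\<bar>" by (simp, simp only: mem_Collect_eq, linarith)
    then show "x \<in> ?A (Suc n)" by blast
  qed
  have un: "(\<Union>n. ?A n) = {x \<in> D. t < \<bar>g x\<bar>}"
  proof (intro equalityI subsetI)
    fix x assume x: "x \<in> {x \<in> D. t < \<bar>g x\<bar>}"
    then have "0 < \<bar>g x\<bar> - t" by simp
    then obtain n where "1 / real (Suc n) < \<bar>g x\<bar> - t" by (rule nat_approx_posE)
    then have "x \<in> ?A n" using x by simp
    then show "x \<in> (\<Union>n. ?A n)" by blast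
  next
    fix x assume "x \<in> (\<Union>n. ?A n)"
    then obtain n where n: "x \<in> D" "t + 1 / real (Suc n) < \<bar>g x\<bar>" by blast
    have "0 < 1 / real (Suc n)" by simp
    with n(2) have "t < \<bar>g x\<bar>" by linarith
    then show "x \<in> {x \<in> D. t < \<bar>g x\<bar>}" using n(1) by blast
  qed
  have "(\<lambda>n. measure lebesgue (?A n)) \<longlonglongrightarrow> measure lebesgue (\<Union>n. ?A n)"
  proof (rule Lim_measure_incseq[OF _ inc])
    show "range ?A \<subseteq> sets lebesgue" using fmeasurableD[OF level_lmeasurable] by blast
    show "emeasure lebesgue (\<Union>n. ?A n) \<noteq> \<infinity>"
      unfolding un using fmeasurableD2[OF level_lmeasurable] by simp
  qed
  then have "eventually (\<lambda>n. c < measure lebesgue (?A n)) sequentially"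
    unfolding un using assms by (rule order_tendstoD)
  then obtain n where n: "c < measure lebesgue (?A n)"
    using eventually_happens'[OF sequentially_bot] by blast
  show ?thesis by (rule that[OF _ n]) simp
qed

lemma level_measure_tendsto_0:
  assumes "0 < c"
  obtains T where "0 \<le> T" "level_measure D g T < c"
proof -
  let ?A = "\<lambda>n::nat. {x \<in> D. real n < \<bar>g x\<bar>}"
  have dec: "decseq ?A"
  proof (rule decseq_SucI, rule subsetI)
    fix n x assume "x \<in> ?A (Suc n)"
    then show "x \<in> ?A n" by simp
  qed
  have int: "(\<Inter>n. ?A n) = {}"
  proof -
    have "\<exists>n. \<not> real n < \<bar>g x\<bar>" for x using real_arch_simple[of "\<bar>g x\<bar>"] by (simp add: not_less)
    then show ?thesis by blast
  qed
  have "(\<lambda>n. measure lebesgue (?A n)) \<longlonglongrightarrow> measure lebesgue (\<Inter>n. ?A n)"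
  proof (rule Lim_measure_decseq[OF _ dec])
    show "range ?A \<subseteq> sets lebesgue" using fmeasurableD[OF level_lmeasurable] by blast
    show "emeasure lebesgue (?A i) \<noteq> \<infinity>" for i
      using fmeasurableD2[OF level_lmeasurable] by simp
  qed
  then have "(\<lambda>n. measure lebesgue (?A n)) \<longlonglongrightarrow> 0" unfolding int by simp
  then have "eventually (\<lambda>n. measure lebesgue (?A n) < c) sequentially"
    using assms by (rule order_tendstoD)
  then obtain n where n: "measure lebesgue (?A n) < c"
    using eventually_happens'[OF sequentially_bot] by blast
  show ?thesis by (rule that[OF _ n]) simp
qed

text \<open>
  The conversion of the rearrangement to a real number is harmless unless the supremum is infinite,
  which happens at most at the origin.
\<close>

lemma less_schwarz_rearrangement_iff:
  assumes t: "0 \<le> t" and fin: "0 \<le> T" "level_measure D g T \<le> measure lebesgue (ball (0::'a) 1) * norm x ^ DIM('a)"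
  shows "t < schwarz_rearrangement D g x \<longleftrightarrow> norm x < level_radius D g t"
proof -
  define \<sigma> where "\<sigma> = measure lebesgue (ball (0::'a) 1) * norm x ^ DIM('a)"
  have \<sigma>: "0 \<le> \<sigma>" by (simp add: \<sigma>_def)
  define A where "A = {t. t \<ge> 0 \<and> \<sigma> < level_measure D g t}"
  have A: "{t. t \<ge> 0 \<and> distribution_function D g t > ennreal \<sigma>} = A"
    using \<sigma> by (simp add: A_def distribution_function_eq ennreal_less_iff)
  have le: "r \<le> T" if "r \<in> A" for r
  proof (rule ccontr)
    assume "\<not> r \<le> T"
    then have "level_measure D g r \<le> level_measure D g T" by (intro level_measure_antimono) simp
    moreover have "\<sigma> < level_measure D g r" using that by (simp only: A_def mem_Collect_eq)
    ultimately show False using fin(2) unfolding \<sigma>_def by linarith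
  qed
  let ?S = "SUP t\<in>A. ennreal t"
  have "?S \<le> ennreal T" using le by (intro SUP_least ennreal_leI)
  then have S: "?S < top" by (rule order_le_less_trans) simp
  have "schwarz_rearrangement D g x = enn2real ?S"
    unfolding schwarz_rearrangement_def decreasing_rearrangement_def \<sigma>_def[symmetric] A ..
  then have "t < schwarz_rearrangement D g x \<longleftrightarrow> ennreal t < ?S"
    using S t by (metis enn2real_nonneg ennreal_enn2real ennreal_less_iff)
  also have "\<dots> \<longleftrightarrow> (\<exists>r\<in>A. t < r)"
    unfolding less_SUP_iff using ennreal_less_iff[OF t] by (simp only:)
  also have "\<dots> \<longleftrightarrow> \<sigma> < level_measure D g t"
  proof
    assume "\<exists>r\<in>A. t < r"
    then obtain r where r: "t < r" "\<sigma> < level_measure D g r" unfolding A_def by blast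
    then show "\<sigma> < level_measure D g t" using level_measure_antimono[of t r] by linarith
  next
    assume "\<sigma> < level_measure D g t"
    then obtain t' where t': "t < t'" "\<sigma> < level_measure D g t'" by (rule level_measure_right_continuous)
    then have "t' \<in> A" using t by (simp add: A_def)
    then show "\<exists>r\<in>A. t < r" using t'(1) by blast
  qed
  finally show ?thesis unfolding less_level_radius_iff \<sigma>_def .
qed

lemma less_schwarz_rearrangement_iff':
  assumes "0 \<le> t" "x \<noteq> 0"
  shows "t < schwarz_rearrangement D g x \<longleftrightarrow> norm x < level_radius D g t"
proof -
  have "0 < measure lebesgue (ball (0::'a) 1) * norm x ^ DIM('a)"
    using assms(2) unit_ball_measure_pos[where 'a='a] by simp
  then obtain T where "0 \<le> T" "level_measure D g T < measure lebesgue (ball (0::'a) 1) * norm x ^ DIM('a)"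
    by (rule level_measure_tendsto_0)
  then show ?thesis by (intro less_schwarz_rearrangement_iff[OF assms(1), of T]) simp_all
qed

lemma superlevel_schwarz_rearrangement_bounded:
  assumes t: "0 \<le> t" and B: "0 \<le> B" "\<And>x. x \<in> D \<Longrightarrow> \<bar>g x\<bar> \<le> B"
  shows "{x. t < schwarz_rearrangement D g x} = ball 0 (level_radius D g t)"
proof -
  have "{x \<in> D. B < \<bar>g x\<bar>} = {}" using B(2) by (auto simp: not_less)
  then have "level_measure D g B = 0" by (simp only: measure_empty)
  then have iff: "t < schwarz_rearrangement D g x \<longleftrightarrow> norm x < level_radius D g t" for x
    by (intro less_schwarz_rearrangement_iff[OF t B(1)]) simp
  show ?thesis
    by (rule set_eqI) (simp only: mem_Collect_eq mem_ball_0 iff)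
qed

lemma schwarz_rearrangement_nonneg: "0 \<le> schwarz_rearrangement D g x"
  by (simp add: schwarz_rearrangement_def)

lemma borel_measurable_schwarz_rearrangement [measurable]:
  "schwarz_rearrangement D g \<in> borel_measurable borel"
  unfolding borel_measurable_iff_greater
proof
  fix t :: real
  show "{x \<in> space borel. t < schwarz_rearrangement D g x} \<in> sets borel"
  proof (cases "0 \<le> t")
    case True
    let ?A = "{x. t < schwarz_rearrangement D g x}"
    have "?A = (if 0 \<in> ?A then insert 0 (ball 0 (level_radius D g t)) else ball 0 (level_radius D g t) - {0})"
    proof (rule set_eqI)
      fix x
      show "x \<in> ?A \<longleftrightarrow> x \<in> (if 0 \<in> ?A then insert 0 (ball 0 (level_radius D g t)) else ball 0 (level_radius D g t) - {0})"
        by (cases "x = 0") (simp_all add: less_schwarz_rearrangement_iff'[OF True])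
    qed
    also have "\<dots> \<in> sets borel" by auto
    finally show ?thesis by simp
  next
    case False
    then have "{x. t < schwarz_rearrangement D g x} = UNIV"
      using schwarz_rearrangement_nonneg by (auto simp: not_le intro: order_less_le_trans)
    then show ?thesis by simp
  qed
qed

lemma emeasure_level_eq_ball: "ennreal (level_measure D g t) = emeasure lborel (ball (0::'a) (level_radius D g t))"
  using level_radius_nonneg[of D g t]
  by (subst emeasure_eq_measure2) (auto intro!: fmeasurableI simp: emeasure_ball measure_ball_level_radius)

lemma emeasure_superlevel_schwarz_rearrangement:
  assumes "0 \<le> t"
  shows "emeasure lborel {x. t < schwarz_rearrangement D g x} = emeasure lebesgue {x \<in> D. t < \<bar>g x\<bar>}"
proof -
  have "emeasure lborel {x. t < schwarz_rearrangement D g x} = emeasure lborel (ball (0::'a) (level_radius D g t))"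
  proof (rule emeasure_eq_AE)
    have "AE x in lborel. x \<noteq> (0::'a)" by (rule AE_lborel_singleton)
    then show "AE x in lborel. x \<in> {x. t < schwarz_rearrangement D g x} \<longleftrightarrow> x \<in> ball 0 (level_radius D g t)"
      by eventually_elim (simp add: less_schwarz_rearrangement_iff'[OF assms])
  qed auto
  then show ?thesis by (simp add: emeasure_level_eq_ball[symmetric] emeasure_eq_measure2[OF level_lmeasurable])
qed

lemma schwarz_rearrangement_outside:
  assumes "x \<notin> schwarz_ball D" "x \<noteq> 0"
  shows "schwarz_rearrangement D g x = 0"
proof -
  have "level_measure D g 0 \<le> measure lebesgue D"
    by (intro measure_mono_fmeasurable D fmeasurableD level_lmeasurable) auto
  then have "level_radius D g 0 \<le> root DIM('a) (measure lebesgue D / measure lebesgue (ball (0::'a) 1))"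
    unfolding level_radius_def using unit_ball_measure_pos[where 'a='a]
    by (intro iffD2[OF real_root_le_iff] divide_right_mono) auto
  then have "\<not> norm x < level_radius D g 0" using assms(1) by (simp add: schwarz_ball_def)
  then have "\<not> 0 < schwarz_rearrangement D g x"
    using less_schwarz_rearrangement_iff'[of 0 x] assms(2) by simp
  then show ?thesis using schwarz_rearrangement_nonneg[of x] by simp
qed

lemma nn_integral_schwarz_rearrangement:
  "(\<integral>\<^sup>+x. ennreal (schwarz_rearrangement D g x) \<partial>lborel) = (\<integral>\<^sup>+x. ennreal \<bar>g x\<bar> \<partial>lebesgue_on D)"
proof -
  interpret F: finite_measure "lebesgue_on D" using D by (rule finite_measure_lebesgue_on)
  have "emeasure (lebesgue_on D) {x \<in> D. t < \<bar>g x\<bar>} = emeasure lebesgue {x \<in> D. t < \<bar>g x\<bar>}" for t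
    using D by (intro emeasure_restrict_space) (auto simp: fmeasurableD)
  then have eq: "indicator {0..} t * emeasure lborel {x. t < schwarz_rearrangement D g x}
      = indicator {0..} t * emeasure (lebesgue_on D) {x \<in> D. t < \<bar>g x\<bar>}" for t
    by (cases "0 \<le> t") (simp_all add: emeasure_superlevel_schwarz_rearrangement)
  have "(\<integral>\<^sup>+x. ennreal (schwarz_rearrangement D g x) \<partial>lborel)
      = (\<integral>\<^sup>+t. indicator {0..} t * emeasure lborel {x. t < schwarz_rearrangement D g x} \<partial>(lborel :: real measure))"
    using nn_integral_layer_cake[OF sigma_finite_lborel, of "schwarz_rearrangement D g"] by simp
  also have "\<dots> = (\<integral>\<^sup>+x. ennreal \<bar>g x\<bar> \<partial>lebesgue_on D)"
    unfolding eq using nn_integral_layer_cake[OF F.sigma_finite_measure_axioms, of "\<lambda>x. \<bar>g x\<bar>"] by simp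
  finally show ?thesis .
qed

end

text \<open>
  By the layer cake representation it suffices to compare intersections of superlevel sets. For the
  rearrangements these are nested balls, so that the measure of the intersection is the smaller of the
  two measures, which is the largest possible value.
\<close>

lemma nn_integral_mult_schwarz_rearrangement_ge:
  fixes D :: "'a::euclidean_space set"
  assumes D: "D \<in> lmeasurable" and f [measurable]: "f \<in> borel_measurable (lebesgue_on D)"
    and g [measurable]: "g \<in> borel_measurable (lebesgue_on D)"
  shows "(\<integral>\<^sup>+x. ennreal (g x) * ennreal (f x) \<partial>lebesgue_on D)
    \<le> (\<integral>\<^sup>+x. ennreal (schwarz_rearrangement D g x) * ennreal (schwarz_rearrangement D f x) \<partial>lborel)"
proof -
  interpret F: rearrangement D f by unfold_locales fact+
  interpret G: rearrangement D g by unfold_locales fact+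
  interpret M: finite_measure "lebesgue_on D" using D by (rule finite_measure_lebesgue_on)
  have lev: "emeasure (lebesgue_on D) {x \<in> D. t < f x \<and> r < g x}
      \<le> emeasure lborel {x. t < schwarz_rearrangement D f x \<and> r < schwarz_rearrangement D g x}"
    if tr: "0 \<le> t" "0 \<le> r" for t r
  proof -
    have meas: "{x \<in> D. t < f x \<and> r < g x} \<in> sets lebesgue"
    proof -
      have "{x \<in> space (lebesgue_on D). t < f x \<and> r < g x} \<in> sets (lebesgue_on D)" by measurable
      then show ?thesis using D by (simp add: sets_restrict_space_iff fmeasurableD)
    qed
    let ?a = "level_radius D f t" and ?b = "level_radius D g r"
    have "emeasure (lebesgue_on D) {x \<in> D. t < f x \<and> r < g x} = emeasure lebesgue {x \<in> D. t < f x \<and> r < g x}"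
      using D by (intro emeasure_restrict_space) (auto simp: fmeasurableD)
    also have "\<dots> \<le> min (emeasure lebesgue {x \<in> D. t < \<bar>f x\<bar>}) (emeasure lebesgue {x \<in> D. r < \<bar>g x\<bar>})"
      using F.level_lmeasurable G.level_lmeasurable
      by (intro min.boundedI emeasure_mono) (auto simp: fmeasurableD)
    also have "\<dots> = min (emeasure lborel (ball (0::'a) ?a)) (emeasure lborel (ball (0::'a) ?b))"
      using trans[OF emeasure_eq_measure2[OF F.level_lmeasurable] F.emeasure_level_eq_ball]
        trans[OF emeasure_eq_measure2[OF G.level_lmeasurable] G.emeasure_level_eq_ball] by (simp only:)
    also have "\<dots> \<le> emeasure lborel (ball (0::'a) (min ?a ?b))"
      by (auto simp: min_def)
    also have "\<dots> = emeasure lborel {x. t < schwarz_rearrangement D f x \<and> r < schwarz_rearrangement D g x}"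
    proof (rule emeasure_eq_AE)
      have "AE x in lborel. x \<noteq> (0::'a)" by (rule AE_lborel_singleton)
      then show "AE x in lborel. x \<in> ball 0 (min ?a ?b) \<longleftrightarrow>
          x \<in> {x. t < schwarz_rearrangement D f x \<and> r < schwarz_rearrangement D g x}"
        by eventually_elim
          (simp add: F.less_schwarz_rearrangement_iff'[OF tr(1)] G.less_schwarz_rearrangement_iff'[OF tr(2)])
    qed auto
    finally show ?thesis .
  qed
  have "(\<integral>\<^sup>+x. ennreal (g x) * ennreal (f x) \<partial>lebesgue_on D)
    = (\<integral>\<^sup>+t. indicator {0..} t * (\<integral>\<^sup>+r. indicator {0..} r * emeasure (lebesgue_on D) {x \<in> D. t < f x \<and> r < g x}
        \<partial>(lborel :: real measure)) \<partial>(lborel :: real measure))"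
    using nn_integral_mult_layer_cake[OF M.sigma_finite_measure_axioms f g] by simp
  also have "\<dots> \<le> (\<integral>\<^sup>+t. indicator {0..} t * (\<integral>\<^sup>+r. indicator {0..} r *
      emeasure lborel {x. t < schwarz_rearrangement D f x \<and> r < schwarz_rearrangement D g x}
        \<partial>(lborel :: real measure)) \<partial>(lborel :: real measure))"
  proof (rule nn_integral_mono)
    fix t :: real
    show "indicator {0..} t * (\<integral>\<^sup>+r. indicator {0..} r * emeasure (lebesgue_on D) {x \<in> D. t < f x \<and> r < g x}
        \<partial>(lborel :: real measure)) \<le> indicator {0..} t * (\<integral>\<^sup>+r. indicator {0..} r *
      emeasure lborel {x. t < schwarz_rearrangement D f x \<and> r < schwarz_rearrangement D g x} \<partial>(lborel :: real measure))"
    proof (cases "0 \<le> t")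
      case True
      have "indicator {0..} r * emeasure (lebesgue_on D) {x \<in> D. t < f x \<and> r < g x}
        \<le> indicator {0..} r * emeasure lborel {x. t < schwarz_rearrangement D f x \<and> r < schwarz_rearrangement D g x}" for r
        using lev[OF True, of r] by (cases "0 \<le> r") auto
      then show ?thesis by (intro mult_left_mono[OF nn_integral_mono]) simp_all
    qed simp
  qed
  also have "\<dots> = (\<integral>\<^sup>+x. ennreal (schwarz_rearrangement D g x) * ennreal (schwarz_rearrangement D f x) \<partial>lborel)"
    using nn_integral_mult_layer_cake[OF sigma_finite_lborel, of "schwarz_rearrangement D f" "schwarz_rearrangement D g"]
    by simp
  finally show ?thesis .
qed

lemma hardy_littlewood_rearrangement:
  fixes D :: "'a::euclidean_space set"
  assumes D: "D \<in> lmeasurable" and f: "integrable (lebesgue_on D) f" "AE x in lebesgue. x \<in> D \<longrightarrow> 0 \<le> f x"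
    and w [measurable]: "w \<in> borel_measurable (lebesgue_on D)" and B: "\<And>x. 0 \<le> w x" "\<And>x. w x \<le> B"
  shows "integrable (lebesgue_on D) (\<lambda>x. f x * w x)"
    and "(\<integral>x. f x * w x \<partial>lebesgue_on D)
      \<le> (\<integral>x. schwarz_rearrangement D f x * schwarz_rearrangement D w x \<partial>lebesgue_on (schwarz_ball D))"
proof -
  have [measurable]: "f \<in> borel_measurable (lebesgue_on D)" using f(1) by simp
  interpret F: rearrangement D f by unfold_locales (simp_all add: D)
  interpret W: rearrangement D w by unfold_locales (simp_all add: D)
  let ?f = "schwarz_rearrangement D f" and ?w = "schwarz_rearrangement D w"
  have B0: "0 \<le> B" using B[of undefined] by simp
  have D': "D \<in> sets lebesgue" using D by (rule fmeasurableD)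
  have S: "schwarz_ball D \<in> sets lebesgue" by (simp add: schwarz_ball_def)
  show int: "integrable (lebesgue_on D) (\<lambda>x. f x * w x)"
  proof (rule Bochner_Integration.integrable_bound[of _ "\<lambda>x. B * f x"])
    show "AE x in lebesgue_on D. norm (f x * w x) \<le> norm (B * f x)"
    proof (rule AE_I2)
      fix x
      have "\<bar>f x\<bar> * w x \<le> \<bar>f x\<bar> * B" using B by (intro mult_left_mono) auto
      then show "norm (f x * w x) \<le> norm (B * f x)" using B[of x] B0 by (simp add: abs_mult mult.commute)
    qed
  qed (use f(1) in auto)
  have fpos: "AE x in lebesgue_on D. 0 \<le> f x" using f(2) D' by (simp add: AE_restrict_space_iff)
  have w_le: "?w x \<le> B" for x
  proof (rule ccontr)
    assume "\<not> ?w x \<le> B"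
    then have "x \<in> ball 0 (level_radius D w B)"
      using W.superlevel_schwarz_rearrangement_bounded[OF B0 B0] B by auto
    moreover have "{x \<in> D. B < \<bar>w x\<bar>} = {}" using B by (auto simp: not_less)
    then have "level_radius D w B = 0" unfolding level_radius_def by (simp only: measure_empty) simp
    ultimately show False by simp
  qed
  let ?P = "\<lambda>x. ?f x * ?w x"
  have Pnn: "0 \<le> ?P x" for x by (intro mult_nonneg_nonneg F.schwarz_rearrangement_nonneg W.schwarz_rearrangement_nonneg)
  have ffin: "(\<integral>\<^sup>+x. ennreal (?f x) \<partial>lborel) < \<infinity>"
    unfolding F.nn_integral_schwarz_rearrangement using f(1) by (simp add: integrable_iff_bounded)
  have "(\<integral>\<^sup>+x. ennreal (?P x) \<partial>lborel) \<le> (\<integral>\<^sup>+x. ennreal B * ennreal (?f x) \<partial>lborel)"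
    using w_le F.schwarz_rearrangement_nonneg B0
  proof (intro nn_integral_mono)
    fix x
    have "?f x * ?w x \<le> ?f x * B" using w_le F.schwarz_rearrangement_nonneg by (intro mult_left_mono)
    then show "ennreal (?P x) \<le> ennreal B * ennreal (?f x)"
      using B0 by (simp add: ennreal_mult'[symmetric] ennreal_leI mult.commute)
  qed
  also have "\<dots> < \<infinity>" using ffin by (simp add: nn_integral_cmult ennreal_mult_less_top)
  finally have Pfin: "(\<integral>\<^sup>+x. ennreal (?P x) \<partial>lborel) < \<infinity>" .
  have Pint: "integrable lborel ?P"
    by (rule integrableI_bounded) (use Pfin Pnn in auto)
  then have Pint': "integrable lebesgue ?P" by (subst integrable_completion) auto
  have out: "AE x in lebesgue. indicator (schwarz_ball D) x *\<^sub>R ?P x = ?P x"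
  proof -
    have "AE x in lborel. x \<noteq> (0::'a)" by (rule AE_lborel_singleton)
    then have "AE x in lebesgue. x \<noteq> (0::'a)" by (rule AE_completion)
    then show ?thesis
      by eventually_elim (auto simp: W.schwarz_rearrangement_outside split: split_indicator)
  qed
  have Pm: "?P \<in> borel_measurable lebesgue" using Pint' by (rule borel_measurable_integrable)
  have "(\<integral>x. ?P x \<partial>lebesgue_on (schwarz_ball D)) = (\<integral>x. indicator (schwarz_ball D) x *\<^sub>R ?P x \<partial>lebesgue)"
    using S by (simp add: integral_restrict_space)
  also have "\<dots> = (\<integral>x. ?P x \<partial>lebesgue)"
    using out Pm S by (intro integral_cong_AE) auto
  also have "\<dots> = (\<integral>x. ?P x \<partial>lborel)" by (rule integral_completion) simp
  finally have R: "(\<integral>x. ?P x \<partial>lebesgue_on (schwarz_ball D)) = (\<integral>x. ?P x \<partial>lborel)" .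
  have "ennreal (\<integral>x. f x * w x \<partial>lebesgue_on D) = (\<integral>\<^sup>+x. ennreal (f x * w x) \<partial>lebesgue_on D)"
    using fpos B by (intro nn_integral_eq_integral[symmetric] int) auto
  also have "\<dots> = (\<integral>\<^sup>+x. ennreal (w x) * ennreal (f x) \<partial>lebesgue_on D)"
    using B by (intro nn_integral_cong) (simp add: ennreal_mult'' mult.commute)
  also have "\<dots> \<le> (\<integral>\<^sup>+x. ennreal (?w x) * ennreal (?f x) \<partial>lborel)"
    by (rule nn_integral_mult_schwarz_rearrangement_ge[OF D]) measurable
  also have "\<dots> = (\<integral>\<^sup>+x. ennreal (?P x) \<partial>lborel)"
    using W.schwarz_rearrangement_nonneg by (intro nn_integral_cong) (simp add: ennreal_mult'' mult.commute)
  also have "\<dots> = ennreal (\<integral>x. ?P x \<partial>lborel)"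
    using Pnn by (intro nn_integral_eq_integral Pint) auto
  finally show "(\<integral>x. f x * w x \<partial>lebesgue_on D) \<le> (\<integral>x. ?P x \<partial>lebesgue_on (schwarz_ball D))"
    unfolding R using Pnn by (subst (asm) ennreal_le_iff) (auto intro!: integral_nonneg_AE)
qed


section \<open>A bump function\<close>

text \<open>\<open>exp (- 1 / t) / t ^ m\<close>, extended by zero to \<open>t \<le> 0\<close>; the exponent \<open>m\<close> makes the family stable under derivatives.\<close>

definition flat_exp :: "nat \<Rightarrow> real \<Rightarrow> real" where
  "flat_exp m t = (if 0 < t then exp (- 1 / t) / t ^ m else 0)"

lemma flat_exp_nonneg: "0 \<le> flat_exp m t"
  by (simp add: flat_exp_def)

text \<open>
  The difference quotient of \<open>flat_exp m\<close> at \<open>0\<close> is \<open>flat_exp (Suc m)\<close>, so this bound yields the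
  derivative \<open>0\<close> there.
\<close>

lemma abs_flat_exp_le: "\<bar>flat_exp m t\<bar> \<le> real (Suc m) ^ Suc m * \<bar>t\<bar>"
proof (cases "0 < t")
  case True
  define a where "a = 1 / (real (Suc m) * t)"
  have a: "0 < a" using True by (simp add: a_def)
  have "exp (- a) \<le> 1 / a"
  proof -
    have "a \<le> exp a" using exp_ge_add_one_self[of a] by linarith
    then show ?thesis using a by (simp add: exp_minus field_simps)
  qed
  then have "exp (- a) ^ Suc m \<le> (1 / a) ^ Suc m"
    by (intro power_mono) auto
  moreover have "exp (- 1 / t) = exp (- a) ^ Suc m"
  proof -
    have "- 1 / t = of_nat (Suc m) * (- a)" using True by (simp add: a_def del: of_nat_Suc)
    then show ?thesis by (simp only: exp_of_nat_mult)
  qed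
  moreover have "(1 / a) ^ Suc m = real (Suc m) ^ Suc m * t ^ Suc m"
    unfolding a_def by (simp only: power_mult_distrib[symmetric]) simp
  ultimately have "exp (- 1 / t) / t ^ m \<le> real (Suc m) ^ Suc m * t ^ Suc m / t ^ m"
    using True by (intro divide_right_mono) auto
  also have "\<dots> = real (Suc m) ^ Suc m * t" using True by simp
  finally show ?thesis using True by (simp add: flat_exp_def)
next
  case False
  then have "flat_exp m t = 0" by (simp add: flat_exp_def)
  then show ?thesis by simp
qed

lemma flat_exp_has_derivative:
  "(flat_exp m has_real_derivative flat_exp (m + 2) t - real m * flat_exp (m + 1) t) (at t)"
proof -
  consider "t < 0" | "t = 0" | "0 < t" by linarith
  then show ?thesis
  proof cases
    case 1
    have "((\<lambda>_. 0) has_real_derivative 0) (at t)" by simp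
    then have "(flat_exp m has_real_derivative 0) (at t)"
      by (rule has_field_derivative_transform_within_open[of _ _ _ "{..<0}"]) (use 1 in \<open>auto simp: flat_exp_def\<close>)
    then show ?thesis using 1 by (simp add: flat_exp_def)
  next
    case 2
    have "(\<lambda>h. flat_exp (Suc m) h) \<midarrow>0\<rightarrow> 0"
    proof (rule Lim_null_comparison)
      show "eventually (\<lambda>h. norm (flat_exp (Suc m) h) \<le> real (Suc (Suc m)) ^ Suc (Suc m) * \<bar>h\<bar>) (at 0)"
        using abs_flat_exp_le[of "Suc m"] by (intro always_eventually) simp
      have "((\<lambda>h::real. real (Suc (Suc m)) ^ Suc (Suc m) * \<bar>h\<bar>) \<longlongrightarrow> real (Suc (Suc m)) ^ Suc (Suc m) * \<bar>0\<bar>) (at 0)"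
        by (intro tendsto_intros)
      then show "((\<lambda>h::real. real (Suc (Suc m)) ^ Suc (Suc m) * \<bar>h\<bar>) \<longlongrightarrow> 0) (at 0)" by simp
    qed
    moreover have "(flat_exp m (0 + h) - flat_exp m 0) / h = flat_exp (Suc m) h" for h
      by (simp add: flat_exp_def)
    ultimately have "(flat_exp m has_real_derivative 0) (at 0)"
      by (simp add: DERIV_def)
    then show ?thesis using 2 by (simp add: flat_exp_def)
  next
    case 3
    have "((\<lambda>t. exp (- 1 / t) / t ^ m) has_real_derivative
        (exp (- 1 / t) * (1 / t\<^sup>2) * t ^ m - exp (- 1 / t) * (real m * t ^ (m - 1))) / (t ^ m * t ^ m)) (at t)"
      using 3 by (auto intro!: derivative_eq_intros simp: power2_eq_square)
    also have "(exp (- 1 / t) * (1 / t\<^sup>2) * t ^ m - exp (- 1 / t) * (real m * t ^ (m - 1))) / (t ^ m * t ^ m)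
        = exp (- 1 / t) / t ^ (m + 2) - real m * (exp (- 1 / t) / t ^ (m + 1))"
      using 3 by (cases m) (simp_all add: field_simps power2_eq_square power_add)
    finally have "(flat_exp m has_real_derivative
        exp (- 1 / t) / t ^ (m + 2) - real m * (exp (- 1 / t) / t ^ (m + 1))) (at t)"
      by (rule has_field_derivative_transform_within_open[of _ _ _ "{0<..}"]) (use 3 in \<open>auto simp: flat_exp_def\<close>)
    then show ?thesis using 3 by (simp add: flat_exp_def)
  qed
qed

text \<open>
  An algebra of functions that contains all the bumps \<open>flat_exp m (1 - a |x|\<^sup>2)\<close> and is closed under
  directional derivatives, so that its members are infinitely often differentiable.
\<close>

inductive_set bump_algebra :: "('a::euclidean_space \<Rightarrow> real) set" where
  const: "(\<lambda>x. c) \<in> bump_algebra"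
| linear: "(\<lambda>x. x \<bullet> w) \<in> bump_algebra"
| bump: "(\<lambda>x. flat_exp m (1 - a * (x \<bullet> x))) \<in> bump_algebra"
| add: "f \<in> bump_algebra \<Longrightarrow> g \<in> bump_algebra \<Longrightarrow> (\<lambda>x. f x + g x) \<in> bump_algebra"
| mult: "f \<in> bump_algebra \<Longrightarrow> g \<in> bump_algebra \<Longrightarrow> (\<lambda>x. f x * g x) \<in> bump_algebra"

lemma bump_algebra_derivative:
  assumes "f \<in> bump_algebra"
  obtains f' where "\<And>x. (f has_derivative f' x) (at x)" "\<And>w. (\<lambda>x. f' x w) \<in> bump_algebra"
proof -
  have "\<exists>f'. (\<forall>x. (f has_derivative f' x) (at x)) \<and> (\<forall>w. (\<lambda>x. f' x w) \<in> bump_algebra)"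
    using assms
  proof induction
    case (const c)
    then show ?case by (intro exI[of _ "\<lambda>_ _. 0"]) (auto intro: bump_algebra.const)
  next
    case (linear w)
    have "((\<lambda>x. x \<bullet> w) has_derivative (\<lambda>h. h \<bullet> w)) (at x)" for x :: 'a
      by (auto intro!: derivative_eq_intros)
    then show ?case
      by (intro exI[of _ "\<lambda>_ h. h \<bullet> w"]) (auto intro: bump_algebra.const)
  next
    case (bump m a)
    let ?d = "\<lambda>x. flat_exp (m + 2) (1 - a * (x \<bullet> x)) + (- real m) * flat_exp (m + 1) (1 - a * (x \<bullet> x))"
    have "((\<lambda>x. flat_exp m (1 - a * (x \<bullet> x))) has_derivative (\<lambda>h. ((- 2 * a) * (x \<bullet> h)) * ?d x)) (at x)" for x :: 'a
    proof -
      have "((\<lambda>x. 1 - a * (x \<bullet> x)) has_derivative (\<lambda>h. (- 2 * a) * (x \<bullet> h))) (at x)"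
        by (auto intro!: derivative_eq_intros simp: inner_commute algebra_simps)
      from DERIV_compose_FDERIV[OF flat_exp_has_derivative this] show ?thesis by simp
    qed
    moreover have "(\<lambda>x. ((- 2 * a) * (x \<bullet> h)) * ?d x) \<in> bump_algebra" for h :: 'a
      by (intro bump_algebra.intros)
    ultimately show ?case by (intro exI[of _ "\<lambda>x h. ((- 2 * a) * (x \<bullet> h)) * ?d x"]) auto
  next
    case (add f g)
    then obtain f' g' where d: "\<And>x. (f has_derivative f' x) (at x)" "\<And>w. (\<lambda>x. f' x w) \<in> bump_algebra"
        "\<And>x. (g has_derivative g' x) (at x)" "\<And>w. (\<lambda>x. g' x w) \<in> bump_algebra" by blast
    then show ?case
      by (intro exI[of _ "\<lambda>x h. f' x h + g' x h"]) (auto intro: has_derivative_add bump_algebra.add)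
  next
    case (mult f g)
    then obtain f' g' where d: "\<And>x. (f has_derivative f' x) (at x)" "\<And>w. (\<lambda>x. f' x w) \<in> bump_algebra"
        "\<And>x. (g has_derivative g' x) (at x)" "\<And>w. (\<lambda>x. g' x w) \<in> bump_algebra" by blast
    then show ?case
      using mult.hyps
      by (intro exI[of _ "\<lambda>x h. f x * g' x h + f' x h * g x"])
        (auto intro!: has_derivative_mult bump_algebra.add bump_algebra.mult)
  qed
  then show ?thesis using that by blast
qed

lemma bump_algebra_continuous:
  assumes "f \<in> bump_algebra"
  shows "continuous_on S f"
proof -
  obtain f' where "\<And>x. (f has_derivative f' x) (at x)" using bump_algebra_derivative[OF assms] by metis
  then show ?thesis by (meson has_derivative_continuous continuous_at_imp_continuous_on)
qed

lemma bump_algebra_borel [measurable_dest]: "f \<in> bump_algebra \<Longrightarrow> f \<in> borel_measurable borel"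
  by (intro borel_measurable_continuous_onI bump_algebra_continuous)

lemma bump_algebra_bounded:
  assumes "f \<in> bump_algebra"
  obtains C where "0 \<le> C" "\<And>x. norm x \<le> T \<Longrightarrow> \<bar>f x\<bar> \<le> C"
proof -
  have "bounded (f ` cball 0 T)"
    by (intro compact_imp_bounded compact_continuous_image bump_algebra_continuous assms) simp
  then obtain C where "0 < C" "\<And>y. y \<in> f ` cball 0 T \<Longrightarrow> norm y \<le> C"
    unfolding bounded_pos by blast
  then show ?thesis using that[of C] by simp
qed

section \<open>Convolution with a bump\<close>

definition convolve :: "('a::euclidean_space \<Rightarrow> real) \<Rightarrow> ('a \<Rightarrow> real) \<Rightarrow> 'a \<Rightarrow> real" where
  "convolve \<theta> f x = (\<integral>y. \<theta> y * f (x - y) \<partial>lborel)"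

lemma convolve_integrable:
  fixes \<theta> :: "'a::euclidean_space \<Rightarrow> real"
  assumes \<theta>: "integrable lborel \<theta>" "\<And>y. S \<le> norm y \<Longrightarrow> \<theta> y = 0" and f: "f \<in> bump_algebra"
  shows "integrable lborel (\<lambda>y. \<theta> y * f (x - y))"
proof -
  obtain C where C: "0 \<le> C" "\<And>z. norm z \<le> norm x + S \<Longrightarrow> \<bar>f z\<bar> \<le> C"
    using bump_algebra_bounded[OF f] by metis
  have [measurable]: "\<theta> \<in> borel_measurable borel" "f \<in> borel_measurable borel"
    using \<theta>(1) f by auto
  show ?thesis
  proof (rule Bochner_Integration.integrable_bound[of _ "\<lambda>y. C * \<theta> y"])
    show "AE y in lborel. norm (\<theta> y * f (x - y)) \<le> norm (C * \<theta> y)"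
    proof (rule AE_I2)
      fix y
      show "norm (\<theta> y * f (x - y)) \<le> norm (C * \<theta> y)"
      proof (cases "S \<le> norm y")
        case False
        then have "\<bar>f (x - y)\<bar> \<le> C" using norm_triangle_ineq4[of x y] by (intro C) linarith
        then have "\<bar>\<theta> y\<bar> * \<bar>f (x - y)\<bar> \<le> \<bar>\<theta> y\<bar> * C" by (intro mult_left_mono) auto
        then show ?thesis using C(1) by (simp add: abs_mult mult.commute)
      qed (simp add: \<theta>(2))
    qed
  qed (use \<theta>(1) in auto)
qed

text \<open>
  Differentiation under the integral sign by dominated convergence. For \<open>y\<close> in the support of \<open>\<theta>\<close> and small
  increments all arguments of \<open>f\<close> lie in a fixed ball, on which \<open>f\<close> is Lipschitz.
\<close>

lemma convolve_has_derivative: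
  fixes \<theta> :: "'a::euclidean_space \<Rightarrow> real"
  assumes \<theta>: "integrable lborel \<theta>" "\<And>y. S \<le> norm y \<Longrightarrow> \<theta> y = 0" and f: "f \<in> bump_algebra"
    and f': "\<And>x. (f has_derivative f' x) (at x)" "\<And>w. (\<lambda>x. f' x w) \<in> bump_algebra"
  shows "(convolve \<theta> f has_derivative (\<lambda>w. convolve \<theta> (\<lambda>z. f' z w) x)) (at x)"
proof -
  define T where "T = norm x + 1 + S"
  have [measurable]: "\<theta> \<in> borel_measurable borel" "f \<in> borel_measurable borel"
      "\<And>w. (\<lambda>z. f' z w) \<in> borel_measurable borel"
    using \<theta>(1) f f' by auto
  have lin: "linear (f' z)" for z
    using f'(1)[of z] by (rule has_derivative_linear)
  have "\<exists>C. 0 \<le> C \<and> (\<forall>z. norm z \<le> T \<longrightarrow> \<bar>f' z b\<bar> \<le> C)" for b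
    by (rule bump_algebra_bounded[OF f'(2)[of b], of T]) blast
  then obtain c where c: "\<And>b. 0 \<le> c b" "\<And>b z. norm z \<le> T \<Longrightarrow> \<bar>f' z b\<bar> \<le> c b"
    by metis
  define C where "C = (\<Sum>b\<in>(Basis::'a set). c b)"
  have C0: "0 \<le> C" unfolding C_def by (intro sum_nonneg c)
  have Cf': "\<bar>f' z w\<bar> \<le> C * norm w" if "norm z \<le> T" for z w
  proof -
    have "f' z w = f' z (\<Sum>b\<in>Basis. (w \<bullet> b) *\<^sub>R b)" by (simp add: euclidean_representation)
    also have "\<dots> = (\<Sum>b\<in>Basis. (w \<bullet> b) * f' z b)"
      by (simp add: linear_sum[OF lin] linear_scale[OF lin])
    finally have "\<bar>f' z w\<bar> \<le> (\<Sum>b\<in>Basis. \<bar>(w \<bullet> b) * f' z b\<bar>)" by (simp add: sum_abs)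
    also have "\<dots> \<le> (\<Sum>b\<in>Basis. norm w * c b)"
      unfolding abs_mult using that by (intro sum_mono mult_mono c Basis_le_norm) auto
    finally show ?thesis by (simp add: C_def sum_distrib_left mult.commute)
  qed
  have lip: "\<bar>f z - f z'\<bar> \<le> C * norm (z - z')" if z: "norm z \<le> T" "norm z' \<le> T" for z z'
  proof -
    have "norm (f z - f z') \<le> C * norm (z - z')"
    proof (rule differentiable_bound[of "cball 0 T" f f'])
      show "(f has_derivative f' y) (at y within cball 0 T)" for y
        using f'(1) by (rule has_derivative_at_withinI)
      show "onorm (f' y) \<le> C" if "y \<in> cball 0 T" for y
        using that by (intro onorm_le) (use Cf' in auto)
    qed (use z in auto)
    then show ?thesis by simp
  qed
  have int: "integrable lborel (\<lambda>y. \<theta> y * f' (x - y) w)" for x w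
    using convolve_integrable[OF \<theta> f'(2)] .
  have intf: "integrable lborel (\<lambda>y. \<theta> y * f (x - y))" for x
    using convolve_integrable[OF \<theta> f] .
  let ?L = "\<lambda>w. convolve \<theta> (\<lambda>z. f' z w) x"
  have ineq: "norm (x - y + h) \<le> T \<and> norm (x - y) \<le> T" if "norm h \<le> 1" "norm y < S" for h y
    using that norm_triangle_ineq4[of x y] norm_triangle_ineq[of "x - y" h] by (auto simp: T_def)
  have bl: "bounded_linear ?L"
  proof (rule bounded_linear_intro)
    fix v w :: 'a and r :: real
    have "(\<lambda>y. \<theta> y * f' (x - y) (v + w)) = (\<lambda>y. \<theta> y * f' (x - y) v + \<theta> y * f' (x - y) w)"
      by (simp add: linear_add[OF lin] distrib_left)
    then show "?L (v + w) = ?L v + ?L w"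
      unfolding convolve_def using int by simp
    have "(\<lambda>y. \<theta> y * f' (x - y) (r *\<^sub>R w)) = (\<lambda>y. r * (\<theta> y * f' (x - y) w))"
      by (simp add: linear_scale[OF lin] mult_ac)
    then show "?L (r *\<^sub>R w) = r *\<^sub>R ?L w"
      unfolding convolve_def by simp
    have "norm (?L w) \<le> (\<integral>y. norm (\<theta> y * f' (x - y) w) \<partial>lborel)"
      unfolding convolve_def by (rule integral_norm_bound)
    also have "\<dots> \<le> (\<integral>y. \<bar>\<theta> y\<bar> * (C * norm w) \<partial>lborel)"
    proof (rule integral_mono)
      show "integrable lborel (\<lambda>y. norm (\<theta> y * f' (x - y) w))" using int by auto
      show "integrable lborel (\<lambda>y. \<bar>\<theta> y\<bar> * (C * norm w))" using \<theta>(1) by auto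
      show "norm (\<theta> y * f' (x - y) w) \<le> \<bar>\<theta> y\<bar> * (C * norm w)" for y
      proof (cases "S \<le> norm y")
        case False
        then have "\<bar>f' (x - y) w\<bar> \<le> C * norm w" using ineq[of 0 y] by (intro Cf') auto
        then show ?thesis by (simp add: abs_mult mult_left_mono)
      qed (simp add: \<theta>(2))
    qed
    also have "\<dots> = norm w * (C * (\<integral>y. \<bar>\<theta> y\<bar> \<partial>lborel))" by simp
    finally show "norm (?L w) \<le> norm w * (C * (\<integral>y. \<bar>\<theta> y\<bar> \<partial>lborel))" .
  qed
  have "(\<lambda>h. norm (convolve \<theta> f (x + h) - convolve \<theta> f x - ?L h) / norm h) \<midarrow>0\<rightarrow> 0"
    unfolding tendsto_at_iff_sequentially comp_def
  proof (intro allI impI)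
    fix X :: "nat \<Rightarrow> 'a" assume X0: "\<forall>i. X i \<in> UNIV - {0}" and X: "X \<longlonglongrightarrow> 0"
    let ?G = "\<lambda>n y. \<theta> y * ((f (x + X n - y) - f (x - y) - f' (x - y) (X n)) / norm (X n))"
    have "eventually (\<lambda>n. norm (X n) < 1) sequentially"
      using tendsto_norm[OF X] by (rule order_tendstoD) simp
    then obtain n0 where n0: "\<And>n. n \<ge> n0 \<Longrightarrow> norm (X n) < 1" by (auto simp: eventually_sequentially)
    have "(\<lambda>n. \<integral>y. ?G (n + n0) y \<partial>lborel) \<longlonglongrightarrow> (\<integral>y. 0 \<partial>(lborel :: 'a measure))"
    proof (rule integral_dominated_convergence[where w="\<lambda>y. \<bar>\<theta> y\<bar> * (2 * C)"])
      show "integrable lborel (\<lambda>y. \<bar>\<theta> y\<bar> * (2 * C))" using \<theta>(1) by auto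
      show "AE y in lborel. (\<lambda>n. ?G (n + n0) y) \<longlonglongrightarrow> 0"
      proof (rule AE_I2)
        fix y
        have "(\<lambda>h. norm (f (x - y + h) - f (x - y) - f' (x - y) h) / norm h) \<midarrow>0\<rightarrow> 0"
          using f'(1)[of "x - y"] by (simp add: has_derivative_at)
        then have "(\<lambda>n. norm (f (x - y + X n) - f (x - y) - f' (x - y) (X n)) / norm (X n)) \<longlonglongrightarrow> 0"
          using X0 X unfolding tendsto_at_iff_sequentially comp_def by blast
        then have "(\<lambda>n. norm ((f (x + X n - y) - f (x - y) - f' (x - y) (X n)) / norm (X n))) \<longlonglongrightarrow> 0"
          by (simp add: algebra_simps)
        then have "(\<lambda>n. (f (x + X n - y) - f (x - y) - f' (x - y) (X n)) / norm (X n)) \<longlonglongrightarrow> 0"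
          by (rule tendsto_norm_zero_cancel)
        then have "(\<lambda>n. ?G n y) \<longlonglongrightarrow> \<theta> y * 0" by (intro tendsto_intros)
        then have "(\<lambda>n. ?G n y) \<longlonglongrightarrow> 0" by (simp only: mult_zero_right)
        then show "(\<lambda>n. ?G (n + n0) y) \<longlonglongrightarrow> 0"
          by (rule LIMSEQ_ignore_initial_segment)
      qed
      fix n
      show "AE y in lborel. norm (?G (n + n0) y) \<le> \<bar>\<theta> y\<bar> * (2 * C)"
      proof (rule AE_I2)
        fix y
        let ?h = "X (n + n0)"
        have h: "norm ?h < 1" "0 < norm ?h" using n0[of "n + n0"] X0 by auto
        show "norm (?G (n + n0) y) \<le> \<bar>\<theta> y\<bar> * (2 * C)"
        proof (cases "S \<le> norm y")
          case False
          then have nn: "norm (x - y + ?h) \<le> T" "norm (x - y) \<le> T" using ineq[of ?h y] h by auto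
          have "\<bar>f (x + ?h - y) - f (x - y) - f' (x - y) ?h\<bar> \<le> C * norm ?h + C * norm ?h"
            using lip[OF nn] Cf'[OF nn(2), of ?h] by (simp add: algebra_simps)
          then have "\<bar>(f (x + ?h - y) - f (x - y) - f' (x - y) ?h) / norm ?h\<bar> \<le> 2 * C"
            using h by (simp add: pos_divide_le_eq)
          from mult_left_mono[OF this, of "\<bar>\<theta> y\<bar>"] show ?thesis by (simp add: abs_mult)
        qed (simp add: \<theta>(2))
      qed
    qed measurable
    then have "(\<lambda>n. \<integral>y. ?G (n + n0) y \<partial>lborel) \<longlonglongrightarrow> 0" by simp
    then have "(\<lambda>n. \<integral>y. ?G n y \<partial>lborel) \<longlonglongrightarrow> 0" by (rule LIMSEQ_offset)
    moreover have "(\<integral>y. ?G n y \<partial>lborel) = (convolve \<theta> f (x + X n) - convolve \<theta> f x - ?L (X n)) / norm (X n)" for n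
    proof -
      have "?G n = (\<lambda>y. (\<theta> y * f (x + X n - y) - \<theta> y * f (x - y) - \<theta> y * f' (x - y) (X n)) / norm (X n))"
        by (simp add: algebra_simps)
      then show ?thesis
        unfolding convolve_def using intf int by simp
    qed
    ultimately have "(\<lambda>n. (convolve \<theta> f (x + X n) - convolve \<theta> f x - ?L (X n)) / norm (X n)) \<longlonglongrightarrow> 0"
      by (simp only:)
    from tendsto_norm[OF this]
    show "(\<lambda>n. norm (convolve \<theta> f (x + X n) - convolve \<theta> f x - ?L (X n)) / norm (X n)) \<longlonglongrightarrow> 0"
      by simp
  qed
  with bl show ?thesis by (simp add: has_derivative_at)
qed

lemma C_k_convolve:
  fixes \<theta> :: "'a::euclidean_space \<Rightarrow> real"
  assumes \<theta>: "integrable lborel \<theta>" "\<And>y. S \<le> norm y \<Longrightarrow> \<theta> y = 0" and f: "f \<in> bump_algebra"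
  shows "C_k k (convolve \<theta> f)"
  using f
proof (induction k arbitrary: f)
  case 0
  obtain f' where f': "\<And>x. (f has_derivative f' x) (at x)" "\<And>w. (\<lambda>x. f' x w) \<in> bump_algebra"
    using bump_algebra_derivative[OF 0] by metis
  have "(convolve \<theta> f has_derivative (\<lambda>w. convolve \<theta> (\<lambda>z. f' z w) x)) (at x)" for x
    using convolve_has_derivative[OF \<theta> 0 f'] .
  then show ?case
    unfolding C_k.simps by (intro continuous_at_imp_continuous_on ballI has_derivative_continuous)
next
  case (Suc k)
  obtain f' where f': "\<And>x. (f has_derivative f' x) (at x)" "\<And>w. (\<lambda>x. f' x w) \<in> bump_algebra"
    using bump_algebra_derivative[OF Suc.prems] by metis
  have d: "(convolve \<theta> f has_derivative (\<lambda>w. convolve \<theta> (\<lambda>z. f' z w) x)) (at x)" for x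
    using convolve_has_derivative[OF \<theta> Suc.prems f'] .
  have "(\<lambda>x. frechet_derivative (convolve \<theta> f) (at x) w) = convolve \<theta> (\<lambda>z. f' z w)" for w
    by (simp add: frechet_derivative_at[OF d, symmetric])
  then show ?case
    using d Suc.IH[OF f'(2)] by (auto simp: differentiable_def)
qed


section \<open>Mollification\<close>

lemma nn_integral_translate:
  fixes f :: "'a::euclidean_space \<Rightarrow> ennreal"
  assumes [measurable]: "f \<in> borel_measurable borel"
  shows "(\<integral>\<^sup>+x. f (x - c) \<partial>lborel) = (\<integral>\<^sup>+x. f x \<partial>lborel)"
  using nn_integral_distr[of "(+) (- c)" lborel borel f] lborel_distr_plus[of "- c"] by simp

lemma nn_integral_reverse:
  fixes f :: "'a::euclidean_space \<Rightarrow> ennreal"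
  assumes [measurable]: "f \<in> borel_measurable borel"
  shows "(\<integral>\<^sup>+z. f (x - z) \<partial>lborel) = (\<integral>\<^sup>+y. f y \<partial>lborel)"
  using nn_integral_distr[of "\<lambda>z. x - z" lborel borel f]
    distr_isometric_involution[of "\<lambda>z. x - z"] by (simp add: norm_minus_commute)

lemma integral_reverse:
  fixes f :: "'a::euclidean_space \<Rightarrow> real"
  assumes [measurable]: "f \<in> borel_measurable borel"
  shows "(\<integral>z. f (x - z) \<partial>lborel) = (\<integral>y. f y \<partial>lborel)"
  using integral_distr[of "\<lambda>z. x - z" lborel borel f]
    distr_isometric_involution[of "\<lambda>z. x - z"] by (simp add: norm_minus_commute)

definition bump :: "real \<Rightarrow> 'a::euclidean_space \<Rightarrow> real" where
  "bump \<epsilon> z = flat_exp 0 (1 - 1 / \<epsilon>\<^sup>2 * (z \<bullet> z))"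

definition mollifier :: "real \<Rightarrow> 'a::euclidean_space \<Rightarrow> real" where
  "mollifier \<epsilon> z = (1 / (\<integral>y. bump \<epsilon> y \<partial>(lborel :: 'a measure))) * bump \<epsilon> z"

lemma bump_mem: "bump \<epsilon> \<in> bump_algebra"
  unfolding bump_def[abs_def] by (rule bump_algebra.bump)

lemma mollifier_mem: "mollifier \<epsilon> \<in> bump_algebra"
  unfolding mollifier_def[abs_def] by (intro bump_algebra.mult bump_algebra.const bump_mem)

lemma borel_measurable_mollifier [measurable]: "mollifier \<epsilon> \<in> borel_measurable borel"
  using mollifier_mem by (rule bump_algebra_borel)

lemma bump_bounds:
  assumes "0 < \<epsilon>"
  shows "0 \<le> bump \<epsilon> z" "bump \<epsilon> z \<le> 1" "\<epsilon> \<le> norm z \<Longrightarrow> bump \<epsilon> z = 0"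
    "norm z < \<epsilon> / 2 \<Longrightarrow> exp (- 2) \<le> bump \<epsilon> z"
proof -
  have eq: "1 / \<epsilon>\<^sup>2 * (z \<bullet> z) = (norm z / \<epsilon>)\<^sup>2"
    by (simp add: power2_norm_eq_inner power_divide)
  show "0 \<le> bump \<epsilon> z" by (simp add: bump_def flat_exp_nonneg)
  show "bump \<epsilon> z \<le> 1" by (simp add: bump_def flat_exp_def)
  show "bump \<epsilon> z = 0" if "\<epsilon> \<le> norm z"
  proof -
    have "1 \<le> norm z / \<epsilon>" using that assms by simp
    then have "1 \<le> (norm z / \<epsilon>)\<^sup>2" by (rule one_le_power)
    then show ?thesis unfolding bump_def eq by (simp add: flat_exp_def)
  qed
  show "exp (- 2) \<le> bump \<epsilon> z" if "norm z < \<epsilon> / 2"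
  proof -
    have "norm z / \<epsilon> \<le> 1 / 2" using that assms by (simp add: field_simps)
    then have "(norm z / \<epsilon>)\<^sup>2 \<le> (1 / 2)\<^sup>2" using assms by (intro power_mono) auto
    moreover have "(1 / 2 :: real)\<^sup>2 \<le> 1 / 2" by (simp add: power2_eq_square)
    ultimately have t: "1 / 2 \<le> 1 - (norm z / \<epsilon>)\<^sup>2" by linarith
    then have "- 2 \<le> - 1 / (1 - (norm z / \<epsilon>)\<^sup>2)" by (simp add: field_simps)
    then show ?thesis using t unfolding bump_def eq by (simp add: flat_exp_def)
  qed
qed

lemma integrable_bump:
  assumes "0 < \<epsilon>"
  shows "integrable lborel (bump \<epsilon> :: 'a::euclidean_space \<Rightarrow> real)"
proof (rule integrableI_bounded_set[of "ball 0 \<epsilon>" _ _ 1])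
  show "bump \<epsilon> \<in> borel_measurable (lborel :: 'a measure)"
    using bump_algebra_borel[OF bump_mem] by simp
  show "emeasure lborel (ball (0::'a) \<epsilon>) < \<infinity>" using assms by (simp add: emeasure_ball)
  show "AE x in lborel. x \<in> ball 0 \<epsilon> \<longrightarrow> norm (bump \<epsilon> (x::'a)) \<le> 1"
    using bump_bounds[OF assms, where 'a='a] by auto
  show "AE x in lborel. x \<notin> ball 0 \<epsilon> \<longrightarrow> bump \<epsilon> (x::'a) = 0"
    using bump_bounds(3)[OF assms, where 'a='a] by (auto simp: not_less)
qed simp

lemma integral_bump_ge:
  assumes "0 < \<epsilon>"
  shows "exp (- 2) * unit_ball_vol (real DIM('a)) / 2 ^ DIM('a) * \<epsilon> ^ DIM('a)
    \<le> (\<integral>y. bump \<epsilon> y \<partial>(lborel :: 'a::euclidean_space measure))"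
proof -
  have "(\<integral>y. exp (- 2) * indicator (ball 0 (\<epsilon> / 2)) y \<partial>(lborel :: 'a measure)) \<le> (\<integral>y. bump \<epsilon> y \<partial>(lborel :: 'a measure))"
  proof (rule integral_mono)
    show "integrable lborel (\<lambda>y::'a. exp (- 2) * indicator (ball 0 (\<epsilon> / 2)) y :: real)"
      using assms by (auto simp: emeasure_ball)
    show "integrable lborel (bump \<epsilon> :: 'a \<Rightarrow> real)" by (rule integrable_bump[OF assms])
    show "exp (- 2) * indicator (ball 0 (\<epsilon> / 2)) y \<le> bump \<epsilon> y" for y :: 'a
      using bump_bounds[OF assms, of y] by (auto split: split_indicator)
  qed
  moreover have "(\<integral>y. exp (- 2) * indicator (ball 0 (\<epsilon> / 2)) y \<partial>(lborel :: 'a measure))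
      = exp (- 2) * unit_ball_vol (real DIM('a)) / 2 ^ DIM('a) * \<epsilon> ^ DIM('a)"
    using assms by (simp add: content_ball power_divide)
  ultimately show ?thesis by simp
qed

text \<open>
  The supremum of the mollifier of width \<open>\<epsilon>\<close> is at most this constant over \<open>\<epsilon> ^ n\<close>: the bump is at least
  \<open>exp (- 2)\<close> on the ball of radius \<open>\<epsilon> / 2\<close>. The constant depends on the dimension \<open>n\<close>, hence on the type.
\<close>

definition mollifier_bound :: "'a::euclidean_space itself \<Rightarrow> real" where
  "mollifier_bound _ = 2 ^ DIM('a) / (exp (- 2) * unit_ball_vol (real DIM('a)))"

lemma mollifier_bound_nonneg: "0 \<le> mollifier_bound TYPE('a::euclidean_space)"
  by (simp add: mollifier_bound_def)

lemma mollifier: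
  fixes z :: "'a::euclidean_space"
  assumes \<epsilon>: "0 < \<epsilon>"
  shows "0 \<le> mollifier \<epsilon> z" "\<epsilon> \<le> norm z \<Longrightarrow> mollifier \<epsilon> z = 0"
    "mollifier \<epsilon> z \<le> mollifier_bound TYPE('a) / \<epsilon> ^ DIM('a)"
    "integrable lborel (mollifier \<epsilon> :: 'a \<Rightarrow> real)"
    "(\<integral>z. mollifier \<epsilon> z \<partial>(lborel :: 'a measure)) = 1"
    "(\<integral>\<^sup>+z. ennreal (mollifier \<epsilon> z) \<partial>(lborel :: 'a measure)) = 1"
proof -
  let ?I = "\<integral>y. bump \<epsilon> y \<partial>(lborel :: 'a measure)"
  let ?c = "exp (- 2) * unit_ball_vol (real DIM('a)) / 2 ^ DIM('a) * \<epsilon> ^ DIM('a)"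
  have c: "0 < ?c" using \<epsilon> by simp
  have I: "?c \<le> ?I" by (rule integral_bump_ge[OF \<epsilon>])
  then have I0: "0 < ?I" using c by linarith
  show nn: "0 \<le> mollifier \<epsilon> z" for z :: 'a
    using I0 bump_bounds(1)[OF \<epsilon>, of z] unfolding mollifier_def by (intro mult_nonneg_nonneg) auto
  show "\<epsilon> \<le> norm z \<Longrightarrow> mollifier \<epsilon> z = 0"
    using bump_bounds(3)[OF \<epsilon>, where 'a='a] by (simp add: mollifier_def)
  have "mollifier \<epsilon> z \<le> 1 / ?I"
    unfolding mollifier_def using bump_bounds(2)[OF \<epsilon>, of z] I0 by (simp add: divide_right_mono)
  also have "\<dots> \<le> 1 / ?c" using I c I0 \<epsilon> by (intro divide_left_mono mult_pos_pos) simp_all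
  also have "\<dots> = mollifier_bound TYPE('a) / \<epsilon> ^ DIM('a)"
    by (simp add: mollifier_bound_def)
  finally show "mollifier \<epsilon> z \<le> mollifier_bound TYPE('a) / \<epsilon> ^ DIM('a)" .
  show int: "integrable lborel (mollifier \<epsilon> :: 'a \<Rightarrow> real)"
    unfolding mollifier_def[abs_def] using integrable_bump[OF \<epsilon>, where 'a='a] by simp
  show one: "(\<integral>z. mollifier \<epsilon> z \<partial>(lborel :: 'a measure)) = 1"
    unfolding mollifier_def using I0 by simp
  show "(\<integral>\<^sup>+z. ennreal (mollifier \<epsilon> z) \<partial>(lborel :: 'a measure)) = 1"
    using nn_integral_eq_integral[OF int] nn one by simp
qed

text \<open>
  The mollifier is a probability density, and the Cauchy--Schwarz inequality applies to the product of its
  square root with \<open>sqrt (mollifier \<epsilon> z) * g z\<close>.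
\<close>

lemma mollifier_Jensen:
  fixes g :: "'a::euclidean_space \<Rightarrow> real"
  assumes \<epsilon>: "0 < \<epsilon>" and [measurable]: "g \<in> borel_measurable borel" and B: "\<And>z. \<bar>g z\<bar> \<le> B"
  shows "ennreal ((\<integral>z. mollifier \<epsilon> z * g z \<partial>lborel)\<^sup>2) \<le> (\<integral>\<^sup>+z. ennreal (mollifier \<epsilon> z * (g z)\<^sup>2) \<partial>lborel)"
proof -
  let ?F = "\<lambda>z::'a. sqrt (mollifier \<epsilon> z)" and ?G = "\<lambda>z::'a. sqrt (mollifier \<epsilon> z) * g z"
  have F: "sq_norm lborel ?F = 1"
    by (simp add: sq_norm_def mollifier[OF \<epsilon>])
  have G: "sq_norm lborel ?G = (\<integral>\<^sup>+z. ennreal (mollifier \<epsilon> z * (g z)\<^sup>2) \<partial>lborel)"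
    by (simp add: sq_norm_def mollifier[OF \<epsilon>] power_mult_distrib)
  have "sq_norm lborel ?G \<le> (\<integral>\<^sup>+z. ennreal (B\<^sup>2) * ennreal (mollifier \<epsilon> z) \<partial>(lborel::'a measure))"
    unfolding G
  proof (rule nn_integral_mono)
    fix z
    have "(g z)\<^sup>2 \<le> B\<^sup>2" using B[of z] by (metis abs_ge_zero power2_abs power_mono)
    then have "mollifier \<epsilon> z * (g z)\<^sup>2 \<le> B\<^sup>2 * mollifier \<epsilon> z"
      using mollifier(1)[OF \<epsilon>, of z] by (subst mult.commute) (rule mult_right_mono)
    then show "ennreal (mollifier \<epsilon> z * (g z)\<^sup>2) \<le> ennreal (B\<^sup>2) * ennreal (mollifier \<epsilon> z)"
      by (simp add: ennreal_mult'[symmetric] ennreal_leI)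
  qed
  also have "\<dots> = ennreal (B\<^sup>2)" by (simp add: nn_integral_cmult mollifier[OF \<epsilon>])
  finally have Gfin: "sq_norm lborel ?G < \<infinity>" by (simp add: order_le_less_trans)
  have "(\<integral>z. ?F z * ?G z \<partial>lborel)\<^sup>2 \<le> enn2real (sq_norm lborel ?F) * enn2real (sq_norm lborel ?G)"
    by (rule sq_norm_product(2)) (use F Gfin in auto)
  moreover have "?F z * ?G z = mollifier \<epsilon> z * g z" for z
    using mollifier(1)[OF \<epsilon>, of z] by (simp add: mult.assoc[symmetric])
  ultimately have "(\<integral>z. mollifier \<epsilon> z * g z \<partial>lborel)\<^sup>2 \<le> enn2real (sq_norm lborel ?G)"
    using F by simp
  then have "ennreal ((\<integral>z. mollifier \<epsilon> z * g z \<partial>lborel)\<^sup>2) \<le> ennreal (enn2real (sq_norm lborel ?G))"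
    by (rule ennreal_leI)
  also have "\<dots> = sq_norm lborel ?G" using Gfin by simp
  finally show ?thesis by (simp add: G)
qed

lemma convolve_mollifier:
  fixes \<theta> :: "'a::euclidean_space \<Rightarrow> real"
  assumes [measurable]: "\<theta> \<in> borel_measurable borel"
  shows "convolve \<theta> (mollifier \<epsilon>) x = (\<integral>z. mollifier \<epsilon> z * \<theta> (x - z) \<partial>lborel)"
  using integral_reverse[of "\<lambda>y. \<theta> y * mollifier \<epsilon> (x - y)" x]
  by (simp add: convolve_def mult.commute)

lemma integrable_mollifier_mult:
  fixes g :: "'a::euclidean_space \<Rightarrow> real"
  assumes \<epsilon>: "0 < \<epsilon>" and [measurable]: "g \<in> borel_measurable borel" and B: "\<And>z. \<bar>g z\<bar> \<le> B"
  shows "integrable lborel (\<lambda>z. mollifier \<epsilon> z * g z)"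
proof (rule Bochner_Integration.integrable_bound[of _ "\<lambda>z. B * mollifier \<epsilon> z"])
  show "integrable lborel (\<lambda>z::'a. B * mollifier \<epsilon> z)" using mollifier(4)[OF \<epsilon>, where 'a='a] by simp
  show "AE z in lborel. norm (mollifier \<epsilon> z * g z) \<le> norm (B * mollifier \<epsilon> z)"
  proof (rule AE_I2)
    fix z
    have "\<bar>g z\<bar> \<le> \<bar>B\<bar>" using B[of z] by linarith
    then have "\<bar>mollifier \<epsilon> z\<bar> * \<bar>g z\<bar> \<le> \<bar>mollifier \<epsilon> z\<bar> * \<bar>B\<bar>" by (rule mult_left_mono) simp
    then show "norm (mollifier \<epsilon> z * g z) \<le> norm (B * mollifier \<epsilon> z)" by (simp add: abs_mult mult.commute)
  qed
qed simp

text \<open>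
  The mollified function is an average of translates of \<open>\<theta>\<close>, all of which have the same energy, and the energy
  is convex.
\<close>

lemma gagliardo_energy_mollified_le:
  fixes \<theta> :: "'a::euclidean_space \<Rightarrow> real"
  assumes \<epsilon>: "0 < \<epsilon>" and [measurable]: "\<theta> \<in> borel_measurable borel" "convolve \<theta> (mollifier \<epsilon>) \<in> borel_measurable borel"
    and B: "\<And>z. \<bar>\<theta> z\<bar> \<le> B"
  shows "gagliardo_energy s UNIV (convolve \<theta> (mollifier \<epsilon>)) \<le> gagliardo_energy s UNIV \<theta>"
proof -
  let ?\<rho> = "mollifier \<epsilon> :: 'a \<Rightarrow> real" and ?K = "gagliardo_kernel s :: 'a \<Rightarrow> 'a \<Rightarrow> real"
  let ?T = "convolve \<theta> ?\<rho>"
  define G where "G x y = ennreal ((\<theta> x - \<theta> y)\<^sup>2 * ?K x y)" for x y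
  have [measurable]: "(\<lambda>z. G (f z) (g z)) \<in> borel_measurable M"
    if [measurable]: "f \<in> M \<rightarrow>\<^sub>M borel" "g \<in> M \<rightarrow>\<^sub>M borel" for f g and M :: "'c measure"
    unfolding G_def by measurable
  have pw: "ennreal ((?T x - ?T y)\<^sup>2 * ?K x y) \<le> (\<integral>\<^sup>+z. ennreal (?\<rho> z) * G (x - z) (y - z) \<partial>lborel)" for x y
  proof -
    have bd: "\<bar>\<theta> (x - z) - \<theta> (y - z)\<bar> \<le> 2 * B" for z using B[of "x - z"] B[of "y - z"] by linarith
    have "?T x - ?T y = (\<integral>z. ?\<rho> z * \<theta> (x - z) - ?\<rho> z * \<theta> (y - z) \<partial>lborel)"
      unfolding convolve_mollifier[OF assms(2)]
      by (intro Bochner_Integration.integral_diff[symmetric] integrable_mollifier_mult[OF \<epsilon> _ B]) measurable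
    also have "\<dots> = (\<integral>z. ?\<rho> z * (\<theta> (x - z) - \<theta> (y - z)) \<partial>lborel)"
      by (simp add: right_diff_distrib)
    finally have "ennreal ((?T x - ?T y)\<^sup>2) \<le> (\<integral>\<^sup>+z. ennreal (?\<rho> z * (\<theta> (x - z) - \<theta> (y - z))\<^sup>2) \<partial>lborel)"
      using mollifier_Jensen[OF \<epsilon>, of "\<lambda>z. \<theta> (x - z) - \<theta> (y - z)" "2 * B"] bd by simp
    then have "ennreal ((?T x - ?T y)\<^sup>2) * ennreal (?K x y)
        \<le> (\<integral>\<^sup>+z. ennreal (?\<rho> z * (\<theta> (x - z) - \<theta> (y - z))\<^sup>2) \<partial>lborel) * ennreal (?K x y)"
      by (rule mult_right_mono) simp
    also have "\<dots> = (\<integral>\<^sup>+z. ennreal (?\<rho> z * (\<theta> (x - z) - \<theta> (y - z))\<^sup>2) * ennreal (?K x y) \<partial>lborel)"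
      by (rule nn_integral_multc[symmetric]) measurable
    also have "\<dots> = (\<integral>\<^sup>+z. ennreal (?\<rho> z) * G (x - z) (y - z) \<partial>lborel)"
    proof (rule nn_integral_cong)
      fix z
      have "?K (x - z) (y - z) = ?K x y" by (simp add: gagliardo_kernel_def)
      then show "ennreal (?\<rho> z * (\<theta> (x - z) - \<theta> (y - z))\<^sup>2) * ennreal (?K x y) = ennreal (?\<rho> z) * G (x - z) (y - z)"
        using mollifier(1)[OF \<epsilon>, of z] by (simp add: G_def ennreal_mult'[symmetric] mult.assoc)
    qed
    finally show ?thesis by (simp add: ennreal_mult'[symmetric])
  qed
  have "gagliardo_energy s UNIV ?T \<le> (\<integral>\<^sup>+x. \<integral>\<^sup>+y. \<integral>\<^sup>+z. ennreal (?\<rho> z) * G (x - z) (y - z) \<partial>lborel \<partial>lborel \<partial>lborel)"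
    unfolding gagliardo_energy_borel[OF assms(3)] by (intro nn_integral_mono pw)
  also have "\<dots> = (\<integral>\<^sup>+x. \<integral>\<^sup>+z. \<integral>\<^sup>+y. ennreal (?\<rho> z) * G (x - z) (y - z) \<partial>lborel \<partial>lborel \<partial>lborel)"
    by (intro nn_integral_cong lborel_pair.Fubini'[symmetric]) measurable
  also have "\<dots> = (\<integral>\<^sup>+z. \<integral>\<^sup>+x. \<integral>\<^sup>+y. ennreal (?\<rho> z) * G (x - z) (y - z) \<partial>lborel \<partial>lborel \<partial>lborel)"
    by (intro lborel_pair.Fubini'[symmetric]) measurable
  also have "\<dots> = (\<integral>\<^sup>+z. ennreal (?\<rho> z) * gagliardo_energy s UNIV \<theta> \<partial>lborel)"
  proof (rule nn_integral_cong)
    fix z :: 'a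
    have "(\<integral>\<^sup>+x. \<integral>\<^sup>+y. ennreal (?\<rho> z) * G (x - z) (y - z) \<partial>lborel \<partial>lborel)
        = ennreal (?\<rho> z) * (\<integral>\<^sup>+x. \<integral>\<^sup>+y. G (x - z) (y - z) \<partial>lborel \<partial>lborel)"
      by (simp add: nn_integral_cmult)
    also have "(\<integral>\<^sup>+x. \<integral>\<^sup>+y. G (x - z) (y - z) \<partial>lborel \<partial>lborel) = (\<integral>\<^sup>+x. \<integral>\<^sup>+y. G (x - z) y \<partial>lborel \<partial>lborel)"
      by (intro nn_integral_cong nn_integral_translate) measurable
    also have "\<dots> = (\<integral>\<^sup>+x. \<integral>\<^sup>+y. G x y \<partial>lborel \<partial>lborel)"
      by (rule nn_integral_translate[of "\<lambda>x. \<integral>\<^sup>+y. G x y \<partial>lborel"]) measurable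
    also have "\<dots> = gagliardo_energy s UNIV \<theta>"
      unfolding G_def by (rule gagliardo_energy_borel[symmetric]) simp
    finally show "(\<integral>\<^sup>+x. \<integral>\<^sup>+y. ennreal (?\<rho> z) * G (x - z) (y - z) \<partial>lborel \<partial>lborel)
        = ennreal (?\<rho> z) * gagliardo_energy s UNIV \<theta>" .
  qed
  also have "\<dots> = gagliardo_energy s UNIV \<theta>"
    by (simp add: nn_integral_multc mollifier[OF \<epsilon>])
  finally show ?thesis .
qed

text \<open>
  The energy controls the mollification error, since for distinct points at distance less than \<open>\<epsilon>\<close> the
  kernel is at least \<open>\<epsilon> powr - (n + 2 * s)\<close>, where \<open>n\<close> is the dimension.
\<close>

lemma mollification_error:
  fixes \<theta> :: "'a::euclidean_space \<Rightarrow> real"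
  assumes \<epsilon>: "0 < \<epsilon>" and s: "0 < s"
    and [measurable]: "\<theta> \<in> borel_measurable borel" "convolve \<theta> (mollifier \<epsilon>) \<in> borel_measurable borel"
    and B: "\<And>z. \<bar>\<theta> z\<bar> \<le> B"
  shows "(\<integral>\<^sup>+x. ennreal ((convolve \<theta> (mollifier \<epsilon>) x - \<theta> x)\<^sup>2) \<partial>lborel)
    \<le> ennreal (mollifier_bound TYPE('a) * \<epsilon> powr (2 * s)) * gagliardo_energy s UNIV \<theta>"
proof -
  let ?\<rho> = "mollifier \<epsilon> :: 'a \<Rightarrow> real" and ?K = "gagliardo_kernel s :: 'a \<Rightarrow> 'a \<Rightarrow> real"
  let ?T = "convolve \<theta> ?\<rho>" and ?C = "mollifier_bound TYPE('a)"
  have pw: "?\<rho> (x - y) * (\<theta> y - \<theta> x)\<^sup>2 \<le> ?C * \<epsilon> powr (2 * s) * ((\<theta> x - \<theta> y)\<^sup>2 * ?K x y)" for x y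
  proof (cases "norm (x - y) < \<epsilon> \<and> x \<noteq> y")
    case True
    let ?p = "real DIM('a) + 2 * s"
    have "norm (x - y) powr ?p \<le> \<epsilon> powr ?p"
      using True s by (intro powr_mono2) auto
    then have K: "1 / \<epsilon> powr ?p \<le> ?K x y"
      unfolding gagliardo_kernel_def using True \<epsilon> by (intro divide_left_mono) auto
    have "?\<rho> (x - y) \<le> ?C / \<epsilon> ^ DIM('a)" by (rule mollifier(3)[OF \<epsilon>])
    also have "\<dots> = ?C * \<epsilon> powr (2 * s) * (1 / \<epsilon> powr ?p)"
      using \<epsilon> by (simp add: powr_add powr_realpow)
    also have "\<dots> \<le> ?C * \<epsilon> powr (2 * s) * ?K x y"
      by (intro mult_left_mono K mult_nonneg_nonneg mollifier_bound_nonneg) auto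
    finally have "?\<rho> (x - y) * (\<theta> x - \<theta> y)\<^sup>2 \<le> ?C * \<epsilon> powr (2 * s) * ?K x y * (\<theta> x - \<theta> y)\<^sup>2"
      by (rule mult_right_mono) simp
    then show ?thesis by (simp add: power2_commute mult_ac)
  next
    case False
    then have "?\<rho> (x - y) * (\<theta> y - \<theta> x)\<^sup>2 = 0"
      using mollifier(2)[OF \<epsilon>, of "x - y"] by (cases "x = y") auto
    then show ?thesis by (auto simp: mollifier_bound_nonneg)
  qed
  have "ennreal ((?T x - \<theta> x)\<^sup>2) \<le> (\<integral>\<^sup>+y. ennreal (?C * \<epsilon> powr (2 * s)) * ennreal ((\<theta> x - \<theta> y)\<^sup>2 * ?K x y) \<partial>lborel)" for x
  proof -
    have bd: "\<bar>\<theta> (x - z) - \<theta> x\<bar> \<le> 2 * B" for z using B[of "x - z"] B[of x] by linarith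
    have "?T x - \<theta> x = (\<integral>z. ?\<rho> z * \<theta> (x - z) \<partial>lborel) - (\<integral>z. ?\<rho> z * \<theta> x \<partial>lborel)"
      unfolding convolve_mollifier[OF assms(3)] using mollifier(5)[OF \<epsilon>, where 'a='a] by simp
    also have "\<dots> = (\<integral>z. ?\<rho> z * \<theta> (x - z) - ?\<rho> z * \<theta> x \<partial>lborel)"
      by (intro Bochner_Integration.integral_diff[symmetric] integrable_mollifier_mult[OF \<epsilon> _ B]) measurable
    also have "\<dots> = (\<integral>z. ?\<rho> z * (\<theta> (x - z) - \<theta> x) \<partial>lborel)"
      by (simp add: right_diff_distrib)
    finally have "ennreal ((?T x - \<theta> x)\<^sup>2) \<le> (\<integral>\<^sup>+z. ennreal (?\<rho> z * (\<theta> (x - z) - \<theta> x)\<^sup>2) \<partial>lborel)"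
      using mollifier_Jensen[OF \<epsilon>, of "\<lambda>z. \<theta> (x - z) - \<theta> x" "2 * B"] bd by simp
    also have "\<dots> = (\<integral>\<^sup>+y. ennreal (?\<rho> (x - y) * (\<theta> y - \<theta> x)\<^sup>2) \<partial>lborel)"
      using nn_integral_reverse[of "\<lambda>y. ennreal (?\<rho> (x - y) * (\<theta> y - \<theta> x)\<^sup>2)" x] by simp
    also have "\<dots> \<le> (\<integral>\<^sup>+y. ennreal (?C * \<epsilon> powr (2 * s)) * ennreal ((\<theta> x - \<theta> y)\<^sup>2 * ?K x y) \<partial>lborel)"
      by (intro nn_integral_mono) (simp add: ennreal_mult'[symmetric] mollifier_bound_nonneg ennreal_leI[OF pw])
    finally show ?thesis .
  qed
  then have "(\<integral>\<^sup>+x. ennreal ((?T x - \<theta> x)\<^sup>2) \<partial>lborel)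
      \<le> (\<integral>\<^sup>+x. \<integral>\<^sup>+y. ennreal (?C * \<epsilon> powr (2 * s)) * ennreal ((\<theta> x - \<theta> y)\<^sup>2 * ?K x y) \<partial>lborel \<partial>lborel)"
    by (intro nn_integral_mono)
  also have "\<dots> = ennreal (?C * \<epsilon> powr (2 * s)) * gagliardo_energy s UNIV \<theta>"
    by (simp add: gagliardo_energy_borel nn_integral_cmult)
  finally show ?thesis .
qed

text \<open>
  The mollifications converge in square mean at the rate given by \<open>mollification_error\<close>, hence almost
  everywhere along a subsequence. Their energy stays below that of \<open>\<theta>\<close>, so that
  \<open>gagliardo_energy_diff_tendsto_0\<close> turns this into convergence in energy.
\<close>

lemma smooth_approximation:
  fixes \<theta> :: "'a::euclidean_space \<Rightarrow> real"
  assumes s: "0 < s" and [measurable]: "\<theta> \<in> borel_measurable borel"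
    and \<theta>: "\<And>x. 0 \<le> \<theta> x" "\<And>x. \<theta> x \<le> B" "\<And>x. x \<notin> K \<Longrightarrow> \<theta> x = 0"
    and K: "compact K" "K \<subseteq> D" "open D" and fin: "gagliardo_energy s UNIV \<theta> < \<infinity>"
  obtains \<phi> K' where "compact K'" "K' \<subseteq> D" "\<And>n. \<phi> n \<in> Cc_infinity D" "\<And>n x. 0 \<le> \<phi> n x" "\<And>n x. \<phi> n x \<le> B"
    "\<And>n x. x \<notin> K' \<Longrightarrow> \<phi> n x = 0" "AE x in lborel. (\<lambda>n. \<phi> n x) \<longlonglongrightarrow> \<theta> x"
    "\<And>n. gagliardo_energy s UNIV (\<phi> n) \<le> gagliardo_energy s UNIV \<theta>"
    "\<And>n. \<phi> n \<in> borel_measurable borel"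
proof -
  obtain e where e: "0 < e" "(\<Union>x\<in>K. cball x e) \<subseteq> D"
    using compact_subset_open_imp_cball_epsilon_subset[OF K(1,3,2)] by blast
  define K' where "K' = {x + y | x y. x \<in> K \<and> y \<in> cball 0 e}"
  have K': "compact K'" unfolding K'_def by (intro compact_sums K(1)) simp
  have K'D: "K' \<subseteq> D"
  proof
    fix z assume "z \<in> K'"
    then obtain x y where "x \<in> K" "norm y \<le> e" "z = x + y" by (auto simp: K'_def)
    then have "z \<in> cball x e" by (simp add: dist_norm)
    then show "z \<in> D" using e(2) \<open>x \<in> K\<close> by blast
  qed
  have B: "\<bar>\<theta> x\<bar> \<le> B" for x using \<theta>(1,2)[of x] by simp
  obtain S where S: "0 < S" "\<And>x. x \<in> K \<Longrightarrow> norm x < S"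
    using compact_imp_bounded[OF K(1)] unfolding bounded_pos_less by blast
  have \<theta>0: "\<theta> y = 0" if "S \<le> norm y" for y using \<theta>(3) S(2) that by (meson not_le)
  have int: "integrable lborel \<theta>"
  proof (rule integrableI_bounded_set[of "ball 0 S" _ _ B])
    show "emeasure lborel (ball (0::'a) S) < \<infinity>"
      using S(1) by (simp add: emeasure_ball)
    show "AE x in lborel. x \<notin> ball 0 S \<longrightarrow> \<theta> x = 0" using \<theta>0 by (auto simp: not_less)
  qed (use B in auto)
  define \<epsilon> where "\<epsilon> n = e / real (Suc n)" for n
  have \<epsilon>: "0 < \<epsilon> n" "\<epsilon> n \<le> e" for n using e(1) by (auto simp: \<epsilon>_def field_simps)
  define \<psi> where "\<psi> n = convolve \<theta> (mollifier (\<epsilon> n))" for n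
  have Ck: "C_k k (\<psi> n)" for k n
    unfolding \<psi>_def by (rule C_k_convolve[OF int \<theta>0 mollifier_mem])
  have [measurable]: "\<psi> n \<in> borel_measurable borel" for n
    using Ck[of 0 n] by (intro borel_measurable_continuous_onI) simp
  have conv: "\<psi> n x = (\<integral>z. mollifier (\<epsilon> n) z * \<theta> (x - z) \<partial>lborel)" for n x
    unfolding \<psi>_def by (rule convolve_mollifier) simp
  have int2: "integrable lborel (\<lambda>z. mollifier (\<epsilon> n) z * \<theta> (x - z))" for n x
    by (rule integrable_mollifier_mult[OF \<epsilon>(1) _ B]) measurable
  have \<psi>0: "0 \<le> \<psi> n x" for n x
    unfolding conv using \<theta>(1) mollifier(1)[OF \<epsilon>(1)] by (intro integral_nonneg_AE AE_I2 mult_nonneg_nonneg)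
  have \<psi>B: "\<psi> n x \<le> B" for n x
  proof -
    have "\<psi> n x \<le> (\<integral>z. mollifier (\<epsilon> n) z * B \<partial>(lborel :: 'a measure))"
      unfolding conv
      using mollifier(4)[OF \<epsilon>(1), of n] int2 \<theta>(2) mollifier(1)[OF \<epsilon>(1)]
      by (intro integral_mono mult_left_mono) auto
    then show ?thesis using mollifier(5)[OF \<epsilon>(1), of n, where 'a='a] by simp
  qed
  have \<psi>K: "\<psi> n x = 0" if x: "x \<notin> K'" for n x
  proof -
    have e: "(\<lambda>z. mollifier (\<epsilon> n) z * \<theta> (x - z)) = (\<lambda>_. 0)"
    proof
      fix z
      show "mollifier (\<epsilon> n) z * \<theta> (x - z) = 0"
      proof (cases "norm z < \<epsilon> n")
      case True
      then have "x - z \<notin> K" using x \<epsilon>(2)[of n] by (auto simp: K'_def)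
      then show ?thesis by (simp add: \<theta>(3))
    next
      case False
      then show ?thesis using mollifier(2)[OF \<epsilon>(1), of n z] by simp
      qed
    qed
    show ?thesis unfolding conv e by simp
  qed
  have \<psi>E: "gagliardo_energy s UNIV (\<psi> n) \<le> gagliardo_energy s UNIV \<theta>" for n
    unfolding \<psi>_def by (rule gagliardo_energy_mollified_le[OF \<epsilon>(1) _ _ B]) (simp_all add: \<psi>_def[symmetric])
  have \<psi>C: "\<psi> n \<in> Cc_infinity D" for n
  proof -
    have "closure {x. \<psi> n x \<noteq> 0} \<subseteq> K'"
      using \<psi>K by (intro closure_minimal compact_imp_closed K') auto
    moreover from this have "compact (closure {x. \<psi> n x \<noteq> 0})"
      using K' by (meson bounded_subset closed_closure compact_eq_bounded_closed)
    ultimately show ?thesis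
      using Ck K'D by (auto simp: Cc_infinity_def)
  qed
  define c where "c = enn2real (gagliardo_energy s UNIV \<theta>)"
  have c: "gagliardo_energy s UNIV \<theta> = ennreal c" "0 \<le> c" using fin by (auto simp: c_def)
  let ?b = "\<lambda>n. mollifier_bound TYPE('a) * \<epsilon> n powr (2 * s) * c"
  have err: "(\<integral>\<^sup>+x. ennreal ((\<psi> n x - \<theta> x)\<^sup>2) \<partial>lborel) \<le> ennreal (?b n)" for n
    using mollification_error[OF \<epsilon>(1)[of n] s, of \<theta> B] B c
    by (simp add: \<psi>_def[symmetric] ennreal_mult'[symmetric] mollifier_bound_nonneg)
  have ierr: "integrable lborel (\<lambda>x. (\<psi> n x - \<theta> x)\<^sup>2)" for n
    by (rule integrableI_bounded) (use err[of n] in \<open>auto simp: order_le_less_trans\<close>)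
  have "(\<lambda>n. \<integral>x. norm ((\<psi> n x - \<theta> x)\<^sup>2) \<partial>lborel) \<longlonglongrightarrow> 0"
  proof (rule tendsto_sandwich[OF _ _ tendsto_const])
    show "eventually (\<lambda>n. 0 \<le> (\<integral>x. norm ((\<psi> n x - \<theta> x)\<^sup>2) \<partial>lborel)) sequentially" by simp
    have "(\<integral>x. norm ((\<psi> n x - \<theta> x)\<^sup>2) \<partial>lborel) \<le> ?b n" for n
      using err[of n] nn_integral_eq_integral[OF ierr[of n]] c(2)
      by (simp add: mollifier_bound_nonneg)
    then show "eventually (\<lambda>n. (\<integral>x. norm ((\<psi> n x - \<theta> x)\<^sup>2) \<partial>lborel) \<le> ?b n) sequentially" by simp
    have "(\<lambda>n. e * (1 / real (Suc n))) \<longlonglongrightarrow> e * 0"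
      by (intro tendsto_mult_left LIMSEQ_Suc[OF lim_1_over_n])
    then have "\<epsilon> \<longlonglongrightarrow> 0" by (simp add: \<epsilon>_def[abs_def])
    then have "(\<lambda>n. \<epsilon> n powr (2 * s)) \<longlonglongrightarrow> 0"
      using s \<epsilon>(1) by (intro tendsto_zero_powrI[OF _ tendsto_const]) (auto simp: less_imp_le)
    then have "?b \<longlonglongrightarrow> mollifier_bound TYPE('a) * 0 * c" by (intro tendsto_intros)
    then show "?b \<longlonglongrightarrow> 0" by simp
  qed
  then obtain r where r: "strict_mono r" "AE x in lborel. (\<lambda>n. (\<psi> (r n) x - \<theta> x)\<^sup>2) \<longlonglongrightarrow> 0"
    using tendsto_L1_AE_subseq[of lborel "\<lambda>n x. (\<psi> n x - \<theta> x)\<^sup>2"] ierr by auto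
  have "AE x in lborel. (\<lambda>n. \<psi> (r n) x) \<longlonglongrightarrow> \<theta> x"
    using r(2)
  proof eventually_elim
    case (elim x)
    then have "(\<lambda>n. \<psi> (r n) x - \<theta> x) \<longlonglongrightarrow> 0" by simp
    then show ?case by (rule LIM_zero_cancel)
  qed
  then show ?thesis
    by (intro that[of K' "\<lambda>n. \<psi> (r n)"] K' K'D \<psi>C \<psi>0 \<psi>B \<psi>K \<psi>E) auto
qed


section \<open>Lipschitz domains from the outside\<close>

text \<open>
  Below a point of the boundary the Lipschitz condition keeps a downward cone with slope \<open>L\<close> outside the
  supergraph, and the cone contains a ball of radius \<open>t / (1 + L)\<close> at depth \<open>t\<close>.
\<close>

lemma frontier_supergraph_exterior_ball:
  fixes e p :: "'a::euclidean_space"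
  assumes e: "norm e = 1" and r: "r > 0" and g: "L-lipschitz_on {y. y \<bullet> e = 0} g"
    and D: "D \<inter> ball p0 r = {x \<in> ball p0 r. g (x - (x \<bullet> e) *\<^sub>R e) < x \<bullet> e}"
    and p: "p \<in> ball p0 (r / 2)" "p \<notin> D" and t: "0 < t" "t < r / 4"
  shows "ball (p - t *\<^sub>R e) (t / (1 + L)) \<inter> D = {}"
proof -
  have L: "0 \<le> L" using g by (rule lipschitz_on_nonneg)
  define k where "k = t / (1 + L)"
  have "k * (1 + L) = t" using L by (simp add: k_def)
  then have k3: "t = k + L * k" by (simp add: distrib_left mult.commute)
  have k1: "0 < k" using t L by (simp add: k_def)
  then have k: "0 < k" "k \<le> t" "t = k + L * k" using k3 L by auto
  have False if z: "z \<in> ball (p - t *\<^sub>R e) k" "z \<in> D" for z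
  proof -
    define \<zeta> where "\<zeta> = z - (p - t *\<^sub>R e)"
    have \<zeta>: "norm \<zeta> < k" using z(1) by (simp add: \<zeta>_def dist_norm norm_minus_commute)
    have zp: "z = p - t *\<^sub>R e + \<zeta>" by (simp add: \<zeta>_def)
    let ?P = "\<lambda>x. x - (x \<bullet> e) *\<^sub>R e"
    have ee: "e \<bullet> e = 1" using e by (simp add: dot_square_norm)
    have P0: "?P x \<in> {y. y \<bullet> e = 0}" for x by (simp add: inner_diff_left ee)
    have "norm (z - p) \<le> t + norm \<zeta>"
      unfolding zp using norm_triangle_ineq[of "- t *\<^sub>R e" \<zeta>] e t by simp
    then have "norm (z - p) < r / 2" using \<zeta> k t by linarith
    then have zr: "z \<in> ball p0 r"
      using p(1) norm_triangle_ineq[of "z - p" "p - p0"] by (simp add: dist_norm norm_minus_commute)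
    then have gz: "g (?P z) < z \<bullet> e" using D z(2) by blast
    have "p \<in> ball p0 r" using p(1) r by auto
    then have gp: "p \<bullet> e \<le> g (?P p)" using D p(2) by (metis (mono_tags, lifting) IntD1 mem_Collect_eq not_le)
    have Pz: "?P z - ?P p = ?P \<zeta>"
      unfolding zp by (simp add: inner_add_left inner_diff_left ee algebra_simps)
    have "(norm (?P \<zeta>))\<^sup>2 = (norm \<zeta>)\<^sup>2 - (\<zeta> \<bullet> e)\<^sup>2"
      unfolding power2_norm_eq_inner by (simp add: algebra_simps inner_commute ee power2_eq_square)
    then have "(norm (?P \<zeta>))\<^sup>2 \<le> (norm \<zeta>)\<^sup>2" by simp
    then have "norm (?P \<zeta>) \<le> norm \<zeta>" by (rule power2_le_imp_le) simp
    then have "norm (?P z - ?P p) \<le> k" using \<zeta> Pz by simp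
    have "\<bar>g (?P z) - g (?P p)\<bar> \<le> L * norm (?P z - ?P p)"
      using lipschitz_onD[OF g P0 P0, of z p] by (simp add: dist_norm)
    also have "\<dots> \<le> L * k" using \<open>norm (?P z - ?P p) \<le> k\<close> L by (rule mult_left_mono)
    finally have "g (?P p) - L * k \<le> g (?P z)" by linarith
    moreover have "z \<bullet> e = p \<bullet> e - t + \<zeta> \<bullet> e"
      unfolding zp by (simp add: inner_add_left inner_diff_left ee)
    moreover have "\<zeta> \<bullet> e < k"
      using Cauchy_Schwarz_ineq2[of \<zeta> e] e \<zeta> by simp
    ultimately show False using gz gp k(3) by linarith
  qed
  then show ?thesis by (auto simp: k_def)
qed

lemma lipschitz_boundary_exterior_ball:
  fixes D :: "'a::euclidean_space set"
  assumes D: "open D" "bounded D" "lipschitz_boundary D"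
  obtains r0 k where "0 < r0" "0 < k" "k \<le> 1"
    "\<And>p t. p \<in> frontier D \<Longrightarrow> 0 < t \<Longrightarrow> t < r0 \<Longrightarrow> \<exists>y. norm (y - p) = t \<and> ball y (k * t) \<inter> D = {}"
proof -
  have fr: "p \<notin> D" if "p \<in> frontier D" for p
    using that D(1) by (simp add: frontier_def interior_open)
  have "\<forall>p\<in>frontier D. \<exists>r L e. norm e = 1 \<and> r > 0 \<and> L \<ge> (0::real) \<and>
      (\<forall>p'\<in>ball p (r / 2) - D. \<forall>t. 0 < t \<and> t < r / 4 \<longrightarrow> ball (p' - t *\<^sub>R e) (t / (1 + L)) \<inter> D = {})"
  proof
    fix p assume "p \<in> frontier D"
    then obtain e g L r where *: "norm e = 1" "r > 0" "L-lipschitz_on {y. y \<bullet> e = 0} g"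
        "D \<inter> ball p r = {x \<in> ball p r. g (x - (x \<bullet> e) *\<^sub>R e) < x \<bullet> e}"
      using D(3) unfolding lipschitz_boundary_def by blast
    then show "\<exists>r L e. norm e = 1 \<and> r > 0 \<and> L \<ge> (0::real) \<and>
      (\<forall>p'\<in>ball p (r / 2) - D. \<forall>t. 0 < t \<and> t < r / 4 \<longrightarrow> ball (p' - t *\<^sub>R e) (t / (1 + L)) \<inter> D = {})"
      using frontier_supergraph_exterior_ball[OF *] lipschitz_on_nonneg[OF *(3)]
      by (intro exI[of _ r] exI[of _ L] exI[of _ e]) auto
  qed
  then obtain r L e where rLe: "\<And>p. p \<in> frontier D \<Longrightarrow> norm (e p) = 1 \<and> r p > 0 \<and> L p \<ge> (0::real) \<and>
      (\<forall>p'\<in>ball p (r p / 2) - D. \<forall>t. 0 < t \<and> t < r p / 4 \<longrightarrow> ball (p' - t *\<^sub>R e p) (t / (1 + L p)) \<inter> D = {})"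
    by metis
  have "compact (frontier D)" using D(2) by (rule compact_frontier_bounded)
  moreover have "frontier D \<subseteq> (\<Union>p\<in>frontier D. ball p (r p / 2))" using rLe by auto
  ultimately obtain F where F: "F \<subseteq> frontier D" "finite F" "frontier D \<subseteq> (\<Union>p\<in>F. ball p (r p / 2))"
    using compactE_image[of "frontier D" "frontier D" "\<lambda>p. ball p (r p / 2)"] by auto
  define r0 where "r0 = Min (insert 1 ((\<lambda>p. r p / 4) ` F))"
  define k where "k = Min (insert 1 ((\<lambda>p. 1 / (1 + L p)) ` F))"
  have r0: "0 < r0" "\<And>p. p \<in> F \<Longrightarrow> r0 \<le> r p / 4"
  proof -
    have "0 < r p / 4" if "p \<in> F" for p using rLe[of p] F(1) that by auto
    then show "0 < r0" using F(2) by (auto simp: r0_def Min_gr_iff)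
    show "r0 \<le> r p / 4" if "p \<in> F" for p unfolding r0_def by (rule Min_le) (use F(2) that in auto)
  qed
  have "0 < 1 / (1 + L p)" if "p \<in> F" for p using rLe[of p] F(1) that by (auto intro!: divide_pos_pos add_pos_nonneg)
  then have k: "0 < k" "k \<le> 1" "\<And>p. p \<in> F \<Longrightarrow> k \<le> 1 / (1 + L p)"
    using F(2) unfolding k_def by (auto simp: Min_gr_iff intro!: Min_le simp del: Min_insert)
  show ?thesis
  proof (rule that[OF r0(1) k(1,2)])
    fix p t :: 'a and s :: real assume p: "p \<in> frontier D" and s: "0 < s" "s < r0"
    then obtain p0 where p0: "p0 \<in> F" "p \<in> ball p0 (r p0 / 2)" using F(3) by auto
    note R = rLe[OF subsetD[OF F(1) p0(1)]]
    have "k * s \<le> 1 / (1 + L p0) * s" using k(3)[OF p0(1)] s by (intro mult_right_mono) auto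
    then have "ball (p - s *\<^sub>R e p0) (k * s) \<subseteq> ball (p - s *\<^sub>R e p0) (s / (1 + L p0))"
      by (intro subset_ball) simp
    moreover have "ball (p - s *\<^sub>R e p0) (s / (1 + L p0)) \<inter> D = {}"
      using R p0(2) fr[OF p] s r0(2)[OF p0(1)] by auto
    ultimately show "\<exists>y. norm (y - p) = s \<and> ball y (k * s) \<inter> D = {}"
      using R s by (intro exI[of _ "p - s *\<^sub>R e p0"]) auto
  qed
qed

lemma nearest_frontier_point:
  fixes D :: "'a::euclidean_space set"
  assumes "open D" "bounded D" "x \<in> D"
  obtains p where "p \<in> frontier D" "infdist x (- D) = norm (x - p)" "0 < norm (x - p)"
proof -
  have "- D \<noteq> {}" using assms(2) not_bounded_UNIV by (metis Compl_empty_eq double_compl)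
  moreover have cl: "closed (- D)" using assms(1) by (simp add: closed_Compl)
  ultimately obtain p where p: "p \<in> - D" "infdist x (- D) = dist x p"
    using infdist_attains_inf[of "- D" x] by metis
  have "ball x (dist x p) \<subseteq> D"
  proof
    fix z assume z: "z \<in> ball x (dist x p)"
    show "z \<in> D"
    proof (rule ccontr)
      assume "z \<notin> D"
      then have "infdist x (- D) \<le> dist x z" by (intro infdist_le) simp
      then show False using z p(2) by simp
    qed
  qed
  moreover have pos: "0 < dist x p" using p(1) assms(3) by (metis ComplD zero_less_dist_iff)
  ultimately have "cball x (dist x p) \<subseteq> closure D" by (metis closure_ball closure_mono)
  then have "p \<in> closure D" by auto
  then have "p \<in> frontier D" using p(1) assms(1) by (simp add: frontier_def interior_open)
  then show ?thesis using that p pos by (simp add: dist_norm)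
qed

section \<open>A fractional Hardy inequality\<close>

text \<open>
  Next to the boundary point nearest to \<open>x\<close> there is a ball in the complement whose radius and whose distance
  from \<open>x\<close> are comparable to the distance of \<open>x\<close> from the boundary; the integral over this ball suffices.
\<close>

lemma exterior_kernel_integral_ge:
  fixes D :: "'a::euclidean_space set"
  assumes D: "open D" "bounded D" "lipschitz_boundary D" and s: "0 < s"
  obtains c where "0 < c" "\<And>x. x \<in> D \<Longrightarrow>
    ennreal (c * infdist x (- D) powr (- 2 * s)) \<le> (\<integral>\<^sup>+z. indicator (- D) z * ennreal (gagliardo_kernel s x z) \<partial>lborel)"
proof -
  obtain r0 k where k: "0 < r0" "0 < k" "k \<le> 1"
    "\<And>p t. p \<in> frontier D \<Longrightarrow> 0 < t \<Longrightarrow> t < r0 \<Longrightarrow> \<exists>y. norm (y - p) = t \<and> ball y (k * t) \<inter> D = {}"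
    using lipschitz_boundary_exterior_ball[OF D] by metis
  obtain z0 where z0: "z0 \<notin> D" using D(2) not_bounded_UNIV by (metis UNIV_I UNIV_eq_I)
  obtain R where R: "0 < R" "\<And>x. x \<in> D \<Longrightarrow> norm x \<le> R" using D(2) unfolding bounded_pos by blast
  define m where "m = R + norm z0"
  have m: "0 < m" using R by (simp add: m_def add_pos_nonneg)
  have dm: "infdist x (- D) \<le> m" if "x \<in> D" for x
  proof -
    have "infdist x (- D) \<le> dist x z0" using z0 by (intro infdist_le) simp
    also have "\<dots> \<le> m" using R(2)[OF that] norm_triangle_ineq4[of x z0] by (simp add: m_def dist_norm)
    finally show ?thesis .
  qed
  define a where "a = r0 / (2 * m)"
  have a: "0 < a" using k m by (simp add: a_def)
  define b where "b = 1 + a + k * a"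
  have b: "0 < b" using a k by (simp add: b_def add_pos_pos)
  let ?p = "real DIM('a) + 2 * s"
  define c where "c = unit_ball_vol (real DIM('a)) * (k * a) ^ DIM('a) / b powr ?p"
  have c: "0 < c" using a k b by (simp add: c_def)
  show ?thesis
  proof (rule that[OF c])
    fix x assume x: "x \<in> D"
    obtain p where p: "p \<in> frontier D" "infdist x (- D) = norm (x - p)" "0 < norm (x - p)"
      using nearest_frontier_point[OF D(1,2) x] .
    define d where "d = infdist x (- D)"
    have d: "0 < d" "d = norm (x - p)" using p by (auto simp: d_def)
    define t where "t = a * d"
    have "t \<le> a * m" using dm[OF x] a by (simp add: t_def d_def)
    also have "\<dots> < r0" using k m by (simp add: a_def)
    finally have t: "0 < t" "t < r0" using a d by (auto simp: t_def)
    obtain y where y: "norm (y - p) = t" "ball y (k * t) \<inter> D = {}" using k(4)[OF p(1) t] by blast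
    have "ennreal (c * d powr (- 2 * s)) = ennreal (1 / (b * d) powr ?p) * emeasure lborel (ball y (k * t))"
    proof -
      have "c * d powr (- 2 * s) = 1 / (b * d) powr ?p * (unit_ball_vol (real DIM('a)) * (k * t) ^ DIM('a))"
        using d b by (simp add: c_def t_def powr_mult powr_add powr_minus powr_realpow power_mult_distrib field_simps)
      then show ?thesis using k t by (simp add: emeasure_ball ennreal_mult'[symmetric])
    qed
    also have "\<dots> = (\<integral>\<^sup>+z. ennreal (1 / (b * d) powr ?p) * indicator (ball y (k * t)) z \<partial>lborel)"
      by (rule nn_integral_cmult_indicator[symmetric]) simp
    also have "\<dots> \<le> (\<integral>\<^sup>+z. indicator (- D) z * ennreal (gagliardo_kernel s x z) \<partial>lborel)"
    proof (rule nn_integral_mono)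
      fix z
      show "ennreal (1 / (b * d) powr ?p) * indicator (ball y (k * t)) z
          \<le> indicator (- D) z * ennreal (gagliardo_kernel s x z)"
      proof (cases "z \<in> ball y (k * t)")
        case True
        then have zD: "z \<notin> D" using y(2) by blast
        have "norm (x - z) \<le> norm (x - p) + norm (y - p) + norm (y - z)"
          using norm_triangle_ineq[of "x - p" "p - z"] norm_triangle_ineq[of "p - y" "y - z"]
          by (simp add: norm_minus_commute)
        also have "\<dots> \<le> d + t + k * t" using True d y(1) by (simp add: dist_norm)
        also have "\<dots> = b * d" by (simp add: b_def t_def algebra_simps)
        finally have le: "norm (x - z) \<le> b * d" .
        have "0 < norm (x - z)" using zD x by auto
        moreover have "norm (x - z) powr ?p \<le> (b * d) powr ?p" using le s by (intro powr_mono2) auto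
        ultimately have "1 / (b * d) powr ?p \<le> gagliardo_kernel s x z"
          unfolding gagliardo_kernel_def using b d by (intro divide_left_mono) auto
        then show ?thesis using True zD by (simp add: ennreal_leI)
      qed simp
    qed
    finally show "ennreal (c * infdist x (- D) powr (- 2 * s))
        \<le> (\<integral>\<^sup>+z. indicator (- D) z * ennreal (gagliardo_kernel s x z) \<partial>lborel)"
      by (simp add: d_def)
  qed
qed

text \<open>
  The energy is taken over the whole space, so it contains the interaction of the domain with its
  complement. That is why the inequality holds for all \<open>s\<close>, including \<open>s = 1/2\<close>.
\<close>

lemma fractional_Hardy:
  fixes D :: "'a::euclidean_space set"
  assumes D: "open D" "bounded D" "lipschitz_boundary D" and s: "0 < s"
  obtains C where "0 \<le> C" "\<forall>\<eta>\<in>borel_measurable borel. (\<forall>x. x \<notin> D \<longrightarrow> \<eta> x = 0) \<longrightarrow>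
    (\<integral>\<^sup>+x. ennreal ((\<eta> x)\<^sup>2 * infdist x (- D) powr (- 2 * s)) \<partial>lborel) \<le> ennreal C * gagliardo_energy s UNIV \<eta>"
proof -
  obtain c where c: "0 < c" "\<And>x. x \<in> D \<Longrightarrow>
    ennreal (c * infdist x (- D) powr (- 2 * s)) \<le> (\<integral>\<^sup>+z. indicator (- D) z * ennreal (gagliardo_kernel s x z) \<partial>lborel)"
    using exterior_kernel_integral_ge[OF D s] by metis
  have Dm [measurable]: "D \<in> sets borel" using D(1) by simp
  show ?thesis
  proof (rule that[of "1 / c"], goal_cases)
    case 1
    show ?case using c by simp
  next
    case 2
    show ?case
    proof (intro ballI impI)
      fix \<eta> :: "'a \<Rightarrow> real" assume [measurable]: "\<eta> \<in> borel_measurable borel" and "\<forall>x. x \<notin> D \<longrightarrow> \<eta> x = 0"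
      then have \<eta>0: "\<And>x. x \<notin> D \<Longrightarrow> \<eta> x = 0" by blast
      have pw: "ennreal ((\<eta> x)\<^sup>2 * infdist x (- D) powr (- 2 * s))
        \<le> ennreal (1 / c) * (\<integral>\<^sup>+y. ennreal ((\<eta> x - \<eta> y)\<^sup>2 * gagliardo_kernel s x y) \<partial>lborel)" for x
      proof (cases "x \<in> D")
        case True
        have "ennreal ((\<eta> x)\<^sup>2 * infdist x (- D) powr (- 2 * s))
            = ennreal (1 / c) * (ennreal ((\<eta> x)\<^sup>2) * ennreal (c * infdist x (- D) powr (- 2 * s)))"
          using c(1) by (simp add: ennreal_mult'[symmetric])
        also have "\<dots> \<le> ennreal (1 / c) * (ennreal ((\<eta> x)\<^sup>2) * (\<integral>\<^sup>+z. indicator (- D) z * ennreal (gagliardo_kernel s x z) \<partial>lborel))"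
          by (intro mult_left_mono c(2)[OF True]) auto
        also have "ennreal ((\<eta> x)\<^sup>2) * (\<integral>\<^sup>+z. indicator (- D) z * ennreal (gagliardo_kernel s x z) \<partial>lborel)
            = (\<integral>\<^sup>+z. ennreal ((\<eta> x)\<^sup>2) * (indicator (- D) z * ennreal (gagliardo_kernel s x z)) \<partial>lborel)"
          by (rule nn_integral_cmult[symmetric]) measurable
        also have "\<dots> \<le> (\<integral>\<^sup>+y. ennreal ((\<eta> x - \<eta> y)\<^sup>2 * gagliardo_kernel s x y) \<partial>lborel)"
          by (intro nn_integral_mono) (auto split: split_indicator simp: \<eta>0 ennreal_mult'[symmetric])
        finally show ?thesis by (simp add: mult_left_mono)
      qed (simp add: \<eta>0)
      have "(\<integral>\<^sup>+x. ennreal ((\<eta> x)\<^sup>2 * infdist x (- D) powr (- 2 * s)) \<partial>lborel)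
          \<le> (\<integral>\<^sup>+x. ennreal (1 / c) * (\<integral>\<^sup>+y. ennreal ((\<eta> x - \<eta> y)\<^sup>2 * gagliardo_kernel s x y) \<partial>lborel) \<partial>lborel)"
        by (intro nn_integral_mono pw)
      also have "\<dots> = ennreal (1 / c) * gagliardo_energy s UNIV \<eta>"
        by (simp add: gagliardo_energy_borel nn_integral_cmult)
      finally show "(\<integral>\<^sup>+x. ennreal ((\<eta> x)\<^sup>2 * infdist x (- D) powr (- 2 * s)) \<partial>lborel)
          \<le> ennreal (1 / c) * gagliardo_energy s UNIV \<eta>" .
    qed
  qed
qed

section \<open>Cutting off near the boundary\<close>

lemma dyadic_bracket:
  fixes a :: real
  assumes "1 \<le> a"
  obtains k :: nat where "2 ^ k \<le> a" "a < 2 ^ Suc k"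
proof -
  define k where "k = nat \<lfloor>log 2 a\<rfloor>"
  have l: "0 \<le> log 2 a" using assms by simp
  have k: "real k \<le> log 2 a" "log 2 a < real k + 1" using l unfolding k_def by linarith+
  have "2 powr real k \<le> 2 powr log 2 a" using k(1) by simp
  moreover have "2 powr log 2 a < 2 powr real (Suc k)" using k(2) by simp
  moreover have "2 powr log 2 a = a" using assms by simp
  ultimately show ?thesis using that[of k] by (simp only: powr_realpow zero_less_numeral)
qed

lemma nn_integral_ball_series:
  fixes A r :: "nat \<Rightarrow> real" and x :: "'a::euclidean_space"
  assumes A: "\<And>k. 0 \<le> A k" "\<And>k. 0 \<le> r k"
    and S: "summable (\<lambda>k. A k * (unit_ball_vol (real DIM('a)) * r k ^ DIM('a)))"
    and F: "\<And>y. F y \<le> 0 \<or> (\<exists>k. norm (x - y) \<le> r k \<and> F y \<le> A k)"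
  shows "(\<integral>\<^sup>+y. ennreal (F y) \<partial>lborel) \<le> ennreal (\<Sum>k. A k * (unit_ball_vol (real DIM('a)) * r k ^ DIM('a)))"
proof -
  have "ennreal (F y) \<le> (\<Sum>k. ennreal (A k) * indicator (cball x (r k)) y)" for y
  proof (cases "F y \<le> 0")
    case False
    then obtain k where k: "norm (x - y) \<le> r k" "F y \<le> A k" using F[of y] by blast
    define g where "g i = ennreal (A i) * indicator (cball x (r i)) y" for i
    have "ennreal (F y) \<le> g k"
      using k by (simp add: g_def dist_norm ennreal_leI)
    also have "\<dots> = (\<Sum>i\<in>{k}. g i)" by simp
    also have "\<dots> \<le> (\<Sum>i. g i)"
      by (rule sum_le_suminf) auto
    finally show ?thesis by (simp add: g_def)
  qed (simp add: ennreal_neg)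
  then have "(\<integral>\<^sup>+y. ennreal (F y) \<partial>lborel) \<le> (\<integral>\<^sup>+y. (\<Sum>k. ennreal (A k) * indicator (cball x (r k)) y) \<partial>lborel)"
    by (intro nn_integral_mono)
  also have "\<dots> = (\<Sum>k. \<integral>\<^sup>+y. ennreal (A k) * indicator (cball x (r k)) y \<partial>lborel)"
    by (intro nn_integral_suminf borel_measurable_times_ennreal borel_measurable_const borel_measurable_indicator) simp
  also have "\<dots> = (\<Sum>k. ennreal (A k * (unit_ball_vol (real DIM('a)) * r k ^ DIM('a))))"
    using A by (simp add: nn_integral_cmult_indicator emeasure_cball ennreal_mult'[symmetric])
  also have "\<dots> = ennreal (\<Sum>k. A k * (unit_ball_vol (real DIM('a)) * r k ^ DIM('a)))"
    using A S by (intro suminf_ennreal2) auto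
  finally show ?thesis .
qed

text \<open>
  The integral over dyadic annuli of radius \<open>2 ^ k * d\<close> is \<open>d powr (- 2 * s)\<close> times the terms of two
  geometric series. The ratio outside the ball of radius \<open>d\<close> is \<open>2 powr (- 2 * s)\<close>, inside it is
  \<open>2 powr (2 * s - 2)\<close>; both are less than \<open>1\<close> for \<open>0 < s < 1\<close>.
\<close>

lemma truncated_kernel_integral_le:
  assumes s: "0 < s" "s < 1"
  obtains C where "0 \<le> C" "\<forall>(x::'a::euclidean_space) d. 0 < d \<longrightarrow>
    (\<integral>\<^sup>+y. ennreal (min 1 ((norm (x - y) / d)\<^sup>2) * gagliardo_kernel s x y) \<partial>lborel) \<le> ennreal (C * d powr (- 2 * s))"
proof -
  let ?N = "DIM('a)" and ?p = "real DIM('a) + 2 * s" and ?v = "unit_ball_vol (real DIM('a))"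
  define q1 where "q1 = 2 powr (- 2 * s)"
  define q2 where "q2 = 2 powr (2 * s - 2)"
  have q: "0 < q1" "q1 < 1" "0 < q2" "q2 < 1"
    using s powr_less_mono[of "- 2 * s" 0 2] powr_less_mono[of "2 * s - 2" 0 2] by (auto simp: q1_def q2_def)
  have q1k: "q1 ^ k = 2 powr (- 2 * s * real k)" and q2k: "q2 ^ k = 2 powr ((2 * s - 2) * real k)" for k
    by (simp_all add: q1_def q2_def powr_realpow[symmetric] powr_powr)
  define C1 where "C1 = ?v * 2 ^ ?N * (\<Sum>k. q1 ^ k)"
  define C2 where "C2 = ?v * 2 powr ?p * (\<Sum>k. q2 ^ k)"
  have sm: "summable (\<lambda>k. q1 ^ k)" "summable (\<lambda>k. q2 ^ k)" using q by (auto intro!: summable_geometric)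
  have "0 \<le> (\<Sum>k. q1 ^ k)" "0 \<le> (\<Sum>k. q2 ^ k)"
    using q by (auto intro: suminf_nonneg[OF sm(1)] suminf_nonneg[OF sm(2)])
  then have C: "0 \<le> C1" "0 \<le> C2" unfolding C1_def C2_def by (intro mult_nonneg_nonneg; simp)+
  show ?thesis
  proof (rule that[of "C1 + C2"], goal_cases)
    case 1
    show ?case using C by simp
  next
    case 2
    show ?case
    proof (intro allI impI)
      fix x :: 'a and d :: real assume d: "0 < d"
      let ?K = "gagliardo_kernel s x"
      define A1 where "A1 k = 1 / (2 ^ k * d) powr ?p" for k :: nat
      define r1 where "r1 k = 2 ^ Suc k * d" for k :: nat
      define A2 where "A2 k = (1 / 4) ^ k / (d / 2 ^ Suc k) powr ?p" for k :: nat
      define r2 where "r2 k = d / 2 ^ k" for k :: nat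
      have e1: "A1 k * (?v * r1 k ^ ?N) = ?v * 2 ^ ?N * d powr (- 2 * s) * q1 ^ k" for k
      proof -
        have "(2 ^ k * d) powr ?p = (2 ^ k * d) ^ ?N * (2 ^ k * d) powr (2 * s)"
          using d by (simp add: powr_add powr_realpow)
        moreover have "(2 ^ k * d) powr (2 * s) = 2 powr (2 * s * real k) * d powr (2 * s)"
          using d by (simp add: powr_mult powr_realpow[symmetric] powr_powr mult_ac)
        moreover have "r1 k ^ ?N = 2 ^ ?N * (2 ^ k * d) ^ ?N"
          by (simp add: r1_def power_mult_distrib mult_ac)
        moreover have "q1 ^ k = 1 / 2 powr (2 * s * real k)"
          unfolding q1k by (simp add: powr_minus_divide[symmetric])
        moreover have "d powr (- 2 * s) = 1 / d powr (2 * s)"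
          by (simp add: powr_minus_divide[symmetric])
        moreover have "1 / (P * (w * y)) * (v * (M * P)) = v * M * (1 / y) * (1 / w)"
          if "P \<noteq> 0" for P w y v M :: real
          using that by (simp add: field_simps)
        moreover have "(2 ^ k * d) ^ ?N \<noteq> 0" using d by simp
        ultimately show ?thesis
          by (simp only: A1_def)
      qed
      have e2: "A2 k * (?v * r2 k ^ ?N) = ?v * 2 powr ?p * d powr (- 2 * s) * q2 ^ k" for k
      proof -
        have "d / 2 ^ Suc k = (d / 2 ^ k) / 2" by simp
        moreover have "((d / 2 ^ k) / 2) powr ?p = (d / 2 ^ k) powr ?p / 2 powr ?p"
          by (rule powr_divide)
        ultimately have "(d / 2 ^ Suc k) powr ?p = (d / 2 ^ k) powr ?p / 2 powr ?p"
          by (simp only:)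
        also have "(d / 2 ^ k) powr ?p = (d / 2 ^ k) ^ ?N * (d / 2 ^ k) powr (2 * s)"
          using d by (simp add: powr_add powr_realpow)
        also have "(d / 2 ^ k) powr (2 * s) = d powr (2 * s) / 2 powr (2 * s * real k)"
          using d by (simp add: powr_divide powr_realpow[symmetric] powr_powr mult_ac)
        finally have P: "(d / 2 ^ Suc k) powr ?p
            = (d / 2 ^ k) ^ ?N * (d powr (2 * s) / 2 powr (2 * s * real k)) / 2 powr ?p" .
        have "q2 ^ k = 2 powr (2 * s * real k) * (1 / 4) ^ k"
        proof -
          have "(2 * s - 2) * real k = 2 * s * real k - real (2 * k)" by (simp add: algebra_simps)
          then have "q2 ^ k = 2 powr (2 * s * real k) / 2 ^ (2 * k)"
            unfolding q2k by (simp only: powr_diff powr_realpow zero_less_numeral)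
          also have "(2::real) ^ (2 * k) = 4 ^ k" by (simp add: power_mult)
          finally show ?thesis by (simp add: power_divide)
        qed
        moreover have "d powr (- 2 * s) = 1 / d powr (2 * s)"
          by (simp add: powr_minus_divide[symmetric])
        moreover have "b / (P * (y / w) / Z) * (v * P) = v * Z * (1 / y) * (w * b)"
          if "P \<noteq> 0" for P w y v Z b :: real
          using that by simp
        moreover have "(d / 2 ^ k) ^ ?N \<noteq> 0" using d by simp
        ultimately show ?thesis
          by (simp only: A2_def r2_def P)
      qed
      have S1: "summable (\<lambda>k. A1 k * (?v * r1 k ^ ?N))" "(\<Sum>k. A1 k * (?v * r1 k ^ ?N)) = C1 * d powr (- 2 * s)"
        unfolding e1 C1_def using sm by (auto simp: suminf_mult intro!: summable_mult)
      have S2: "summable (\<lambda>k. A2 k * (?v * r2 k ^ ?N))" "(\<Sum>k. A2 k * (?v * r2 k ^ ?N)) = C2 * d powr (- 2 * s)"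
        unfolding e2 C2_def using sm by (auto simp: suminf_mult intro!: summable_mult)
      have pk: "?K y \<le> 1 / b powr ?p" if "0 < b" "b \<le> norm (x - y)" for b y
      proof -
        have "b powr ?p \<le> norm (x - y) powr ?p" using that s by (intro powr_mono2) auto
        moreover have "0 < norm (x - y)" using that by linarith
        ultimately show ?thesis unfolding gagliardo_kernel_def using that by (intro divide_left_mono mult_pos_pos) auto
      qed
      let ?F = "\<lambda>y. min 1 ((norm (x - y) / d)\<^sup>2) * ?K y"
      have far: "(\<integral>\<^sup>+y. ennreal (if d \<le> norm (x - y) then ?F y else 0) \<partial>lborel) \<le> ennreal (C1 * d powr (- 2 * s))"
        unfolding S1(2)[symmetric]
      proof (rule nn_integral_ball_series)
        fix y
        show "(if d \<le> norm (x - y) then ?F y else 0) \<le> 0 \<or>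
          (\<exists>k. norm (x - y) \<le> r1 k \<and> (if d \<le> norm (x - y) then ?F y else 0) \<le> A1 k)"
        proof (cases "d \<le> norm (x - y)")
          case True
          then obtain k where k: "2 ^ k \<le> norm (x - y) / d" "norm (x - y) / d < 2 ^ Suc k"
            using dyadic_bracket[of "norm (x - y) / d"] d by auto
          have "?F y \<le> 1 * ?K y" by (intro mult_right_mono) auto
          also have "\<dots> \<le> A1 k" using pk[of "2 ^ k * d" y] k(1) d by (simp add: A1_def pos_le_divide_eq)
          finally show ?thesis
            using k(2) d True by (intro disjI2 exI[of _ k]) (simp add: r1_def pos_divide_less_eq less_imp_le)
        qed simp
      qed (use S1(1) d in \<open>auto simp: A1_def r1_def\<close>)
      have near: "(\<integral>\<^sup>+y. ennreal (if d \<le> norm (x - y) then 0 else ?F y) \<partial>lborel) \<le> ennreal (C2 * d powr (- 2 * s))"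
        unfolding S2(2)[symmetric]
      proof (rule nn_integral_ball_series)
        fix y
        show "(if d \<le> norm (x - y) then 0 else ?F y) \<le> 0 \<or>
          (\<exists>k. norm (x - y) \<le> r2 k \<and> (if d \<le> norm (x - y) then 0 else ?F y) \<le> A2 k)"
        proof (cases "norm (x - y) < d \<and> x \<noteq> y")
          case True
          then have n: "0 < norm (x - y)" "norm (x - y) < d" by auto
          then obtain k where k: "2 ^ k \<le> d / norm (x - y)" "d / norm (x - y) < 2 ^ Suc k"
            using dyadic_bracket[of "d / norm (x - y)"] by auto
          have r: "norm (x - y) \<le> r2 k" using k(1) n by (simp add: r2_def field_simps)
          then have "norm (x - y) / d \<le> 1 / 2 ^ k" using d by (simp add: r2_def field_simps)
          then have "(norm (x - y) / d)\<^sup>2 \<le> (1 / 2 ^ k)\<^sup>2" using d by (intro power_mono) auto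
          also have "(1 / 2 ^ k)\<^sup>2 = (1 / 4 :: real) ^ k"
            by (simp add: power_divide power_mult[symmetric] mult.commute[of k 2]) (simp add: power_mult)
          finally have "min 1 ((norm (x - y) / d)\<^sup>2) \<le> (1 / 4) ^ k" by simp
          moreover have "?K y \<le> 1 / (d / 2 ^ Suc k) powr ?p"
          proof (rule pk)
            show "d / 2 ^ Suc k \<le> norm (x - y)" using k(2) n by (simp add: field_simps)
          qed (use d in simp)
          ultimately have "?F y \<le> (1 / 4) ^ k * (1 / (d / 2 ^ Suc k) powr ?p)"
            by (intro mult_mono) auto
          then show ?thesis using r n by (intro disjI2 exI[of _ k]) (simp add: A2_def)
        next
          case False
          then show ?thesis by (auto simp: gagliardo_kernel_def)
        qed
      qed (use S2(1) d in \<open>auto simp: A2_def r2_def\<close>)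
      have "(\<integral>\<^sup>+y. ennreal (?F y) \<partial>lborel)
          = (\<integral>\<^sup>+y. ennreal (if d \<le> norm (x - y) then ?F y else 0) + ennreal (if d \<le> norm (x - y) then 0 else ?F y) \<partial>lborel)"
        by (intro nn_integral_cong) auto
      also have "\<dots> = (\<integral>\<^sup>+y. ennreal (if d \<le> norm (x - y) then ?F y else 0) \<partial>lborel)
          + (\<integral>\<^sup>+y. ennreal (if d \<le> norm (x - y) then 0 else ?F y) \<partial>lborel)"
        by (rule nn_integral_add) measurable
      also have "\<dots> \<le> ennreal (C1 * d powr (- 2 * s)) + ennreal (C2 * d powr (- 2 * s))"
        by (rule add_mono[OF far near])
      also have "\<dots> = ennreal ((C1 + C2) * d powr (- 2 * s))"
        using C by (simp add: distrib_right)
      finally show "(\<integral>\<^sup>+y. ennreal (min 1 ((norm (x - y) / d)\<^sup>2) * ?K y) \<partial>lborel)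
          \<le> ennreal ((C1 + C2) * d powr (- 2 * s))" .
    qed
  qed
qed


definition cutoff :: "nat \<Rightarrow> 'a::euclidean_space set \<Rightarrow> 'a \<Rightarrow> real" where
  "cutoff n D x = min 1 (max 0 (real n * infdist x (- D) - 1))"

lemma cutoff_range: "0 \<le> cutoff n D x" "cutoff n D x \<le> 1"
  by (simp_all add: cutoff_def)

lemma borel_measurable_cutoff [measurable]: "cutoff n D \<in> borel_measurable borel"
  unfolding cutoff_def[abs_def] by (intro borel_measurable_continuous_onI continuous_intros)

text \<open>The profile of the cutoff varies by a bounded amount on every dyadic interval, so the estimate does not depend on \<open>n\<close>.\<close>

lemma cutoff_diff_le:
  fixes D :: "'a::euclidean_space set"
  assumes d: "0 < infdist x (- D)"
  shows "\<bar>cutoff n D x - cutoff n D y\<bar> \<le> 4 * min 1 (norm (x - y) / infdist x (- D))"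
proof -
  define A where "A = real n * infdist x (- D)"
  define B where "B = real n * infdist y (- D)"
  define t where "t = norm (x - y) / infdist x (- D)"
  have t: "0 \<le> t" using d by (simp add: t_def)
  have "\<bar>infdist x (- D) - infdist y (- D)\<bar> \<le> norm (x - y)"
    using infdist_triangle_abs[of x "- D" y] by (simp add: dist_norm)
  then have "real n * \<bar>infdist x (- D) - infdist y (- D)\<bar> \<le> real n * norm (x - y)"
    by (rule mult_left_mono) simp
  also have "real n * norm (x - y) = A * t" using d by (simp add: A_def t_def)
  also have "real n * \<bar>infdist x (- D) - infdist y (- D)\<bar> = \<bar>A - B\<bar>"
    by (simp only: A_def B_def right_diff_distrib[symmetric] abs_mult abs_of_nat)
  finally have AB: "\<bar>A - B\<bar> \<le> A * t" .
  have nn: "0 \<le> A" "0 \<le> B" by (simp_all add: A_def B_def infdist_nonneg)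
  let ?th = "\<lambda>r::real. min 1 (max 0 (r - 1))"
  have "\<bar>?th A - ?th B\<bar> \<le> 4 * t"
  proof (cases "A \<le> 4")
    case True
    have "\<bar>?th A - ?th B\<bar> \<le> \<bar>A - B\<bar>" by linarith
    also have "\<dots> \<le> 4 * t" using AB True t by (meson mult_right_mono order_trans)
    finally show ?thesis .
  next
    case A4: False
    show ?thesis
    proof (cases "2 \<le> B")
      case True
      then show ?thesis using A4 t by simp
    next
      case False
      have "A / 2 \<le> A * t" using AB A4 False by linarith
      then have "1 / 2 \<le> t" using A4 by (simp add: field_simps)
      moreover have "\<bar>?th A - ?th B\<bar> \<le> 1" by linarith
      ultimately show ?thesis by linarith
    qed
  qed
  moreover have "\<bar>?th A - ?th B\<bar> \<le> 1" by linarith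
  moreover have "X \<le> 4 * min 1 t" if "X \<le> 4 * t" "X \<le> 1" for X
    using that by (simp add: min_def)
  ultimately have "\<bar>?th A - ?th B\<bar> \<le> 4 * min 1 t" by blast
  then show ?thesis by (simp only: cutoff_def A_def B_def t_def)
qed

lemma cutoff_tendsto:
  assumes "0 < infdist x (- D)"
  shows "(\<lambda>n. cutoff n D x) \<longlonglongrightarrow> 1"
proof -
  obtain n0 :: nat where n0: "2 / infdist x (- D) \<le> real n0" using real_arch_simple by blast
  have "cutoff n D x = 1" if "n \<ge> n0" for n
  proof -
    have "2 / infdist x (- D) \<le> real n" using n0 that by linarith
    then have "2 \<le> real n * infdist x (- D)" using assms by (simp add: pos_divide_le_eq)
    then show ?thesis by (simp add: cutoff_def)
  qed
  then show ?thesis by (intro tendsto_eventually) (auto simp: eventually_sequentially)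
qed

lemma infdist_compl_pos:
  fixes D :: "'a::euclidean_space set"
  assumes "open D" "bounded D" "x \<in> D"
  shows "0 < infdist x (- D)"
  using nearest_frontier_point[OF assms] by metis

lemma nn_integral_gagliardo_measure_borel:
  fixes g :: "'a::euclidean_space \<times> 'a \<Rightarrow> real"
  assumes [measurable]: "g \<in> borel_measurable (borel \<Otimes>\<^sub>M borel)" and "\<And>z. 0 \<le> g z"
  shows "(\<integral>\<^sup>+z. ennreal (g z) \<partial>gagliardo_measure s)
    = (\<integral>\<^sup>+x. \<integral>\<^sup>+y. ennreal (g (x, y) * gagliardo_kernel s x y) \<partial>lborel \<partial>lborel)"
proof -
  have "(\<lambda>z. (fst z, snd z)) \<in> lebesgue \<Otimes>\<^sub>M lebesgue \<rightarrow>\<^sub>M (borel \<Otimes>\<^sub>M borel :: ('a \<times> 'a) measure)"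
    by measurable
  then have [measurable]: "g \<in> borel_measurable (lebesgue \<Otimes>\<^sub>M lebesgue)"
    using measurable_compose[OF _ assms(1)] by simp
  have "(\<integral>\<^sup>+z. ennreal (g z) \<partial>gagliardo_measure s)
      = (\<integral>\<^sup>+z. ennreal (g z * gagliardo_kernel s (fst z) (snd z)) \<partial>(lebesgue \<Otimes>\<^sub>M lebesgue))"
    unfolding gagliardo_measure_def using assms(2)
    by (subst nn_integral_density) (auto simp: ennreal_mult'[symmetric] mult.commute)
  also have "\<dots> = (\<integral>\<^sup>+x. \<integral>\<^sup>+y. ennreal (g (x, y) * gagliardo_kernel s x y) \<partial>lborel \<partial>lborel)"
    by (subst nn_integral_lebesgue_pair_borel) auto
  finally show ?thesis .
qed

text \<open>
  Writing the increment of \<open>\<eta> (1 - \<psi>)\<close> as \<open>(\<eta> x - \<eta> y) (1 - \<psi> y) - \<eta> x (\<psi> x - \<psi> y)\<close>, the estimate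
  of \<open>cutoff_diff_le\<close> and Hardy's inequality provide a majorant independent of \<open>n\<close>.
\<close>

lemma cutoff_approximation:
  fixes D :: "'a::euclidean_space set"
  assumes D: "open D" "bounded D" "lipschitz_boundary D" and s: "0 < s" "s < 1"
    and [measurable]: "\<eta> \<in> borel_measurable borel" and \<eta>0: "\<And>x. x \<notin> D \<Longrightarrow> \<eta> x = 0"
    and fin: "gagliardo_energy s UNIV \<eta> < \<infinity>"
  shows "gagliardo_energy s UNIV (\<lambda>x. \<eta> x * cutoff n D x - \<eta> x) < \<infinity>"
    and "(\<lambda>n. gagliardo_energy s UNIV (\<lambda>x. \<eta> x * cutoff n D x - \<eta> x)) \<longlonglongrightarrow> 0"
proof -
  obtain C where C: "0 \<le> C" "\<forall>(x::'a) d. 0 < d \<longrightarrow>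
    (\<integral>\<^sup>+y. ennreal (min 1 ((norm (x - y) / d)\<^sup>2) * gagliardo_kernel s x y) \<partial>lborel) \<le> ennreal (C * d powr (- 2 * s))"
    by (rule truncated_kernel_integral_le[OF s, where 'a='a]) (rule that)
  obtain H where H: "0 \<le> H" "\<forall>\<eta>\<in>borel_measurable borel. (\<forall>x. x \<notin> D \<longrightarrow> \<eta> x = 0) \<longrightarrow>
    (\<integral>\<^sup>+x. ennreal ((\<eta> x)\<^sup>2 * infdist x (- D) powr (- 2 * s)) \<partial>lborel) \<le> ennreal H * gagliardo_energy s UNIV \<eta>"
    by (rule fractional_Hardy[OF D s(1)]) (rule that)
  have dpos: "0 < infdist x (- D)" if "x \<in> D" for x using infdist_compl_pos[OF D(1,2) that] .
  define h where "h n x = \<eta> x * cutoff n D x - \<eta> x" for n x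
  have hb [measurable]: "h n \<in> borel_measurable borel" for n unfolding h_def by measurable
  have hl [measurable]: "h n \<in> borel_measurable lebesgue" "\<eta> \<in> borel_measurable lebesgue" for n
    by (auto intro!: measurable_completion)
  define m where "m z = (\<eta> (fst z))\<^sup>2 * min 1 ((norm (fst z - snd z) / infdist (fst z) (- D))\<^sup>2)" for z
  define W where "W z = 2 * (increment \<eta> z)\<^sup>2 + 32 * m z" for z
  have mm [measurable]: "m \<in> borel_measurable (borel \<Otimes>\<^sub>M borel)"
  proof -
    have [measurable]: "(\<lambda>x. infdist x (- D)) \<in> borel_measurable borel"
      by (intro borel_measurable_continuous_onI continuous_intros)
    show ?thesis unfolding m_def[abs_def] by measurable
  qed
  have m0: "0 \<le> m z" for z by (simp add: m_def)
  have [measurable]: "m \<in> borel_measurable (gagliardo_measure s)"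
  proof -
    have "(\<lambda>z. (fst z, snd z)) \<in> lebesgue \<Otimes>\<^sub>M lebesgue \<rightarrow>\<^sub>M (borel \<Otimes>\<^sub>M borel :: ('a \<times> 'a) measure)"
      by measurable
    then have "m \<in> borel_measurable (lebesgue \<Otimes>\<^sub>M lebesgue)"
      using measurable_compose[OF _ mm] by simp
    then show ?thesis by (simp cong: measurable_cong_sets add: sets_gagliardo_measure)
  qed
  have bound: "(increment (h n) z)\<^sup>2 \<le> W z" for n z
  proof -
    obtain x y where z: "z = (x, y)" by (cases z)
    let ?\<psi> = "cutoff n D"
    let ?b = "\<eta> x * (?\<psi> x - ?\<psi> y)"
    have "increment (h n) z = ?b - (\<eta> x - \<eta> y) * (1 - ?\<psi> y)"
      by (simp add: z increment_def h_def algebra_simps)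
    moreover have "(a - b)\<^sup>2 \<le> 2 * a\<^sup>2 + 2 * b\<^sup>2" for a b :: real
      using zero_le_power2[of "a + b"] by (simp add: power2_eq_square algebra_simps)
    ultimately have "(increment (h n) z)\<^sup>2 \<le> 2 * ?b\<^sup>2 + 2 * ((\<eta> x - \<eta> y) * (1 - ?\<psi> y))\<^sup>2"
      by simp
    moreover have "((\<eta> x - \<eta> y) * (1 - ?\<psi> y))\<^sup>2 \<le> (\<eta> x - \<eta> y)\<^sup>2"
    proof -
      have "(1 - ?\<psi> y)\<^sup>2 \<le> 1" using cutoff_range[of n D y] by (intro power_le_one) auto
      from mult_left_mono[OF this, of "(\<eta> x - \<eta> y)\<^sup>2"] show ?thesis by (simp add: power_mult_distrib)
    qed
    moreover have "?b\<^sup>2 \<le> 16 * m z"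
    proof (cases "x \<in> D")
      case True
      let ?t = "norm (x - y) / infdist x (- D)"
      have t: "0 \<le> ?t" by (simp add: infdist_nonneg)
      have "\<bar>?\<psi> x - ?\<psi> y\<bar>\<^sup>2 \<le> (4 * min 1 ?t)\<^sup>2"
        using cutoff_diff_le[OF dpos[OF True]] by (intro power_mono) auto
      also have "(4 * min 1 ?t)\<^sup>2 = 16 * (min 1 ?t)\<^sup>2"
        by (simp add: power_mult_distrib)
      also have "(min 1 ?t)\<^sup>2 \<le> min 1 (?t\<^sup>2)"
        using t by (auto simp: min_def power_le_one one_le_power)
      finally have "(?\<psi> x - ?\<psi> y)\<^sup>2 \<le> 16 * min 1 (?t\<^sup>2)" by simp
      from mult_left_mono[OF this, of "(\<eta> x)\<^sup>2"] show ?thesis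
        by (simp add: power_mult_distrib m_def z)
    qed (simp add: \<eta>0 m0)
    ultimately show ?thesis by (simp add: W_def z increment_def)
  qed
  have mfin: "(\<integral>\<^sup>+z. ennreal (m z) \<partial>gagliardo_measure s) < \<infinity>"
  proof -
    have "(\<integral>\<^sup>+z. ennreal (m z) \<partial>gagliardo_measure s)
        = (\<integral>\<^sup>+x. \<integral>\<^sup>+y. ennreal (m (x, y) * gagliardo_kernel s x y) \<partial>lborel \<partial>lborel)"
      by (rule nn_integral_gagliardo_measure_borel[OF mm m0])
    also have "\<dots> \<le> (\<integral>\<^sup>+x. ennreal C * ennreal ((\<eta> x)\<^sup>2 * infdist x (- D) powr (- 2 * s)) \<partial>lborel)"
    proof (rule nn_integral_mono)
      fix x
      show "(\<integral>\<^sup>+y. ennreal (m (x, y) * gagliardo_kernel s x y) \<partial>lborel)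
        \<le> ennreal C * ennreal ((\<eta> x)\<^sup>2 * infdist x (- D) powr (- 2 * s))"
      proof (cases "x \<in> D")
        case True
        let ?d = "infdist x (- D)"
        have "(\<integral>\<^sup>+y. ennreal (m (x, y) * gagliardo_kernel s x y) \<partial>lborel)
            = (\<integral>\<^sup>+y. ennreal ((\<eta> x)\<^sup>2) * ennreal (min 1 ((norm (x - y) / ?d)\<^sup>2) * gagliardo_kernel s x y) \<partial>lborel)"
          by (intro nn_integral_cong) (simp add: m_def ennreal_mult'[symmetric] mult.assoc)
        also have "\<dots> = ennreal ((\<eta> x)\<^sup>2) * (\<integral>\<^sup>+y. ennreal (min 1 ((norm (x - y) / ?d)\<^sup>2) * gagliardo_kernel s x y) \<partial>lborel)"
          by (rule nn_integral_cmult) measurable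
        also have "\<dots> \<le> ennreal ((\<eta> x)\<^sup>2) * ennreal (C * ?d powr (- 2 * s))"
          using C(2) dpos[OF True] by (intro mult_left_mono) auto
        also have "\<dots> = ennreal C * ennreal ((\<eta> x)\<^sup>2 * ?d powr (- 2 * s))"
          using C(1) by (simp add: ennreal_mult'[symmetric] mult_ac)
        finally show ?thesis .
      qed (simp add: m_def \<eta>0)
    qed
    also have "\<dots> = ennreal C * (\<integral>\<^sup>+x. ennreal ((\<eta> x)\<^sup>2 * infdist x (- D) powr (- 2 * s)) \<partial>lborel)"
    proof (rule nn_integral_cmult)
      have [measurable]: "(\<lambda>x. infdist x (- D)) \<in> borel_measurable borel"
        by (intro borel_measurable_continuous_onI continuous_intros)
      show "(\<lambda>x. ennreal ((\<eta> x)\<^sup>2 * infdist x (- D) powr (- 2 * s))) \<in> borel_measurable lborel" by measurable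
    qed
    also have "\<dots> \<le> ennreal C * (ennreal H * gagliardo_energy s UNIV \<eta>)"
      using H(2) \<eta>0 by (intro mult_left_mono) auto
    also have "\<dots> < \<infinity>" using fin by (simp add: ennreal_mult_less_top)
    finally show ?thesis .
  qed
  have W: "ennreal (W z) = 2 * ennreal ((increment \<eta> z)\<^sup>2) + 32 * ennreal (m z)" for z
    using m0[of z] by (simp add: W_def ennreal_mult')
  have Wfin: "(\<integral>\<^sup>+z. ennreal (W z) \<partial>gagliardo_measure s) < \<infinity>"
  proof -
    have "(\<integral>\<^sup>+z. ennreal (W z) \<partial>gagliardo_measure s)
        = 2 * gagliardo_energy s UNIV \<eta> + 32 * (\<integral>\<^sup>+z. ennreal (m z) \<partial>gagliardo_measure s)"
      by (simp add: W nn_integral_add nn_integral_cmult gagliardo_energy_eq_sq_norm sq_norm_def)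
    also have "\<dots> < \<infinity>" using fin mfin by (simp add: ennreal_mult_less_top)
    finally show ?thesis .
  qed
  have E: "gagliardo_energy s UNIV (h n) = (\<integral>\<^sup>+z. ennreal ((increment (h n) z)\<^sup>2) \<partial>gagliardo_measure s)" for n
    by (simp add: gagliardo_energy_eq_sq_norm sq_norm_def)
  have "gagliardo_energy s UNIV (h n) \<le> (\<integral>\<^sup>+z. ennreal (W z) \<partial>gagliardo_measure s)" for n
    unfolding E by (intro nn_integral_mono ennreal_leI bound)
  then have "gagliardo_energy s UNIV (h n) < \<infinity>" for n
    using Wfin by (rule order_le_less_trans)
  then show "gagliardo_energy s UNIV (\<lambda>x. \<eta> x * cutoff n D x - \<eta> x) < \<infinity>"
    by (simp add: h_def[abs_def])
  have hlim: "(\<lambda>n. h n x) \<longlonglongrightarrow> 0" for x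
  proof (cases "x \<in> D")
    case True
    have "(\<lambda>n. \<eta> x * cutoff n D x - \<eta> x) \<longlonglongrightarrow> \<eta> x * 1 - \<eta> x"
      by (intro tendsto_intros cutoff_tendsto dpos True)
    then show ?thesis by (simp add: h_def)
  qed (simp add: h_def \<eta>0)
  have "(\<lambda>n. \<integral>\<^sup>+z. ennreal ((increment (h n) z)\<^sup>2) \<partial>gagliardo_measure s)
      \<longlonglongrightarrow> (\<integral>\<^sup>+z. 0 \<partial>(gagliardo_measure s :: ('a \<times> 'a) measure))"
  proof (rule nn_integral_dominated_convergence[where w="\<lambda>z. ennreal (W z)"])
    show "AE z in gagliardo_measure s. ennreal ((increment (h n) z)\<^sup>2) \<le> ennreal (W z)" for n
      by (intro AE_I2 ennreal_leI bound)
    show "AE z in gagliardo_measure s. (\<lambda>n. ennreal ((increment (h n) z)\<^sup>2)) \<longlonglongrightarrow> 0"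
    proof (rule AE_I2)
      fix z :: "'a \<times> 'a"
      have "(\<lambda>n. (increment (h n) z)\<^sup>2) \<longlonglongrightarrow> (0 - 0)\<^sup>2"
        unfolding increment_def by (intro tendsto_intros hlim)
      then have "(\<lambda>n. ennreal ((increment (h n) z)\<^sup>2)) \<longlonglongrightarrow> ennreal ((0 - 0)\<^sup>2)"
        by (rule tendsto_ennrealI)
      then show "(\<lambda>n. ennreal ((increment (h n) z)\<^sup>2)) \<longlonglongrightarrow> 0" by simp
    qed
    show "(\<integral>\<^sup>+z. ennreal (W z) \<partial>gagliardo_measure s) < \<infinity>" by (rule Wfin)
  qed (auto simp: W)
  then have "(\<lambda>n. gagliardo_energy s UNIV (h n)) \<longlonglongrightarrow> 0" by (simp add: E)
  then show "(\<lambda>n. gagliardo_energy s UNIV (\<lambda>x. \<eta> x * cutoff n D x - \<eta> x)) \<longlonglongrightarrow> 0"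
    by (simp add: h_def[abs_def])
qed

section \<open>Enlarging the class of test functions\<close>

lemma gagliardo_energy_add_le:
  assumes [measurable]: "f \<in> borel_measurable lebesgue" "g \<in> borel_measurable lebesgue"
  shows "gagliardo_energy s UNIV (\<lambda>x. f x + g x) \<le> 2 * gagliardo_energy s UNIV f + 2 * gagliardo_energy s UNIV g"
proof -
  have "increment (\<lambda>x. f x + g x) z = increment f z + increment g z" for z
    by (simp add: increment_def)
  then show ?thesis
    using sq_norm_add_le[of "increment f" "gagliardo_measure s" "increment g" "increment (\<lambda>x. f x + g x)"]
    by (simp add: gagliardo_energy_eq_sq_norm)
qed

text \<open>
  Along the mollifications of \<open>\<theta>\<close> the left-hand side converges by convergence in energy, and the right-hand
  side by dominated convergence: they are uniformly bounded and supported in one compact subset of \<open>D\<close>,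
  on which \<open>g\<close> is integrable.
\<close>

lemma weak_equation_compact_support:
  fixes D :: "'a::euclidean_space set"
  assumes D: "open D" and s: "0 < s"
    and [measurable]: "u \<in> borel_measurable lebesgue" and ufin: "gagliardo_energy s UNIV u < \<infinity>"
    and g [measurable]: "g \<in> borel_measurable (lebesgue_on D)" and gloc: "g \<in> L1_loc D"
    and weak: "\<And>\<phi>. \<phi> \<in> Cc_infinity D \<Longrightarrow> (\<And>x. 0 \<le> \<phi> x) \<Longrightarrow> frac_form s u \<phi> = (\<integral>x. g x * \<phi> x \<partial>lebesgue_on D)"
    and [measurable]: "\<theta> \<in> borel_measurable borel"
    and \<theta>: "\<And>x. 0 \<le> \<theta> x" "\<And>x. \<theta> x \<le> B" "\<And>x. x \<notin> K \<Longrightarrow> \<theta> x = 0"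
    and K: "compact K" "K \<subseteq> D" and fin: "gagliardo_energy s UNIV \<theta> < \<infinity>"
  shows "frac_form s u \<theta> = (\<integral>x. g x * \<theta> x \<partial>lebesgue_on D)"
    and "integrable (lebesgue_on D) (\<lambda>x. g x * \<theta> x)"
proof -
  obtain \<phi> K' where K': "compact K'" "K' \<subseteq> D" and \<phi>: "\<And>n. \<phi> n \<in> Cc_infinity D" "\<And>n x. 0 \<le> \<phi> n x" "\<And>n x. \<phi> n x \<le> B"
    "\<And>n x. x \<notin> K' \<Longrightarrow> \<phi> n x = 0" "AE x in lborel. (\<lambda>n. \<phi> n x) \<longlonglongrightarrow> \<theta> x"
    "\<And>n. gagliardo_energy s UNIV (\<phi> n) \<le> gagliardo_energy s UNIV \<theta>"
    and \<phi>m [measurable]: "\<And>n. \<phi> n \<in> borel_measurable borel"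
    by (rule smooth_approximation[OF s assms(8) \<theta> K D fin]) (assumption | (rule that; (assumption | simp only:)))+
  have [measurable]: "\<phi> n \<in> borel_measurable lebesgue" "\<theta> \<in> borel_measurable lebesgue" for n
    by (auto intro!: measurable_completion)
  have D' [measurable]: "D \<in> sets lebesgue" using D by auto
  have rm: "k \<in> borel_measurable (lebesgue_on D)" if "k \<in> borel_measurable borel" for k :: "'a \<Rightarrow> real"
    by (intro measurable_restrict_space1 measurable_completion) (use that in simp)
  note [measurable] = rm[OF \<phi>m] rm[OF assms(8)]
  have AEl: "AE x in lebesgue. (\<lambda>n. \<phi> n x) \<longlonglongrightarrow> \<theta> x" using \<phi>(5) by (rule AE_completion)
  then have AED: "AE x in lebesgue_on D. (\<lambda>n. \<phi> n x) \<longlonglongrightarrow> \<theta> x"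
    by (subst AE_restrict_space_iff) (auto simp: D' elim: eventually_mono)
  have "(\<lambda>n. gagliardo_energy s UNIV (\<lambda>x. \<phi> n x - \<theta> x)) \<longlonglongrightarrow> 0"
    by (rule gagliardo_energy_diff_tendsto_0) (use AEl \<phi>(6) fin in auto)
  then have lim1: "(\<lambda>n. frac_form s u (\<phi> n)) \<longlonglongrightarrow> frac_form s u \<theta>"
    by (intro frac_form_tendsto) (use fin ufin in auto)
  have B: "0 \<le> B" using \<theta>(1,2) order_trans by blast
  have K'm [measurable]: "K' \<in> sets lebesgue" using K'(1) by (simp add: compact_imp_closed)
  have gK: "integrable (lebesgue_on D) (\<lambda>x. indicator K' x * \<bar>g x\<bar>)"
  proof -
    have "g \<in> Lp 1 K'" using gloc K' by (auto simp: L1_loc_def)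
    then have "integrable (lebesgue_on K') (\<lambda>x. \<bar>g x\<bar>)" by (simp add: Lp_def)
    then have "integrable lebesgue (\<lambda>x. indicator K' x *\<^sub>R \<bar>g x\<bar>)"
      using K'm by (subst (asm) integrable_restrict_space) auto
    moreover have "(\<lambda>x. indicator K' x *\<^sub>R \<bar>g x\<bar>) = (\<lambda>x. indicator D x *\<^sub>R (indicator K' x * \<bar>g x\<bar>))"
      using K'(2) by (auto simp: fun_eq_iff split: split_indicator)
    ultimately show ?thesis using D' by (subst integrable_restrict_space) auto
  qed
  have dom: "integrable (lebesgue_on D) (\<lambda>x. B * (indicator K' x * \<bar>g x\<bar>))"
    using gK by simp
  have bd: "AE x in lebesgue_on D. norm (g x * \<phi> n x) \<le> B * (indicator K' x * \<bar>g x\<bar>)" for n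
  proof (rule AE_I2)
    fix x
    show "norm (g x * \<phi> n x) \<le> B * (indicator K' x * \<bar>g x\<bar>)"
    proof (cases "x \<in> K'")
      case True
      then show ?thesis using mult_right_mono[OF \<phi>(3)[of n x], of "\<bar>g x\<bar>"] \<phi>(2)[of n x]
        by (simp add: abs_mult mult.commute)
    qed (simp add: \<phi>(4))
  qed
  have lim: "AE x in lebesgue_on D. (\<lambda>n. g x * \<phi> n x) \<longlonglongrightarrow> g x * \<theta> x"
    using AED by eventually_elim (intro tendsto_intros)
  have m1: "(\<lambda>x. g x * \<theta> x) \<in> borel_measurable (lebesgue_on D)"
    and m2: "(\<lambda>x. g x * \<phi> n x) \<in> borel_measurable (lebesgue_on D)" for n
    by measurable
  show "integrable (lebesgue_on D) (\<lambda>x. g x * \<theta> x)"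
    by (rule integrable_dominated_convergence[OF m1 m2 dom lim bd])
  have "(\<lambda>n. \<integral>x. g x * \<phi> n x \<partial>lebesgue_on D) \<longlonglongrightarrow> (\<integral>x. g x * \<theta> x \<partial>lebesgue_on D)"
    by (rule integral_dominated_convergence[OF m1 m2 dom lim bd])
  then have "(\<lambda>n. frac_form s u (\<phi> n)) \<longlonglongrightarrow> (\<integral>x. g x * \<theta> x \<partial>lebesgue_on D)"
    using weak[OF \<phi>(1,2)] by simp
  then show "frac_form s u \<theta> = (\<integral>x. g x * \<theta> x \<partial>lebesgue_on D)"
    using lim1 LIMSEQ_unique by blast
qed

text \<open>
  The cutoffs of \<open>\<eta>\<close> stay below \<open>\<eta>\<close> and \<open>g\<close> is nonnegative, so the right-hand sides of their equations stay
  below the integral of \<open>g \<eta>\<close>, while the left-hand sides converge in energy.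
\<close>

lemma weak_inequality_bounded_test:
  fixes D :: "'a::euclidean_space set"
  assumes D: "open D" "bounded D" "lipschitz_boundary D" and s: "0 < s" "s < 1"
    and [measurable]: "u \<in> borel_measurable lebesgue" and ufin: "gagliardo_energy s UNIV u < \<infinity>"
    and g: "g \<in> borel_measurable (lebesgue_on D)" "g \<in> L1_loc D" "AE x in lebesgue. x \<in> D \<longrightarrow> 0 \<le> g x"
    and weak: "\<And>\<phi>. \<phi> \<in> Cc_infinity D \<Longrightarrow> (\<And>x. 0 \<le> \<phi> x) \<Longrightarrow> frac_form s u \<phi> = (\<integral>x. g x * \<phi> x \<partial>lebesgue_on D)"
    and \<eta>m [measurable]: "\<eta> \<in> borel_measurable borel"
    and \<eta>: "\<And>x. 0 \<le> \<eta> x" "\<And>x. \<eta> x \<le> B" "\<And>x. x \<notin> D \<Longrightarrow> \<eta> x = 0"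
    and fin: "gagliardo_energy s UNIV \<eta> < \<infinity>"
    and int: "integrable (lebesgue_on D) (\<lambda>x. g x * \<eta> x)"
  shows "frac_form s u \<eta> \<le> (\<integral>x. g x * \<eta> x \<partial>lebesgue_on D)"
proof -
  define \<theta> where "\<theta> n x = \<eta> x * cutoff n D x" for n x
  have \<theta>m [measurable]: "\<theta> n \<in> borel_measurable borel" for n unfolding \<theta>_def by measurable
  have [measurable]: "\<theta> n \<in> borel_measurable lebesgue" "\<eta> \<in> borel_measurable lebesgue" for n
    by (auto intro!: measurable_completion)
  have D': "D \<in> sets lebesgue" using D by auto
  have \<theta>: "0 \<le> \<theta> n x" "\<theta> n x \<le> \<eta> x" for n x
    using \<eta>(1)[of x] cutoff_range[of n D x] by (auto simp: \<theta>_def mult_left_le)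
  have diff: "gagliardo_energy s UNIV (\<lambda>x. \<theta> n x - \<eta> x) < \<infinity>" for n
    unfolding \<theta>_def by (rule cutoff_approximation(1)[OF D s \<eta>m \<eta>(3) fin])
  have "(\<lambda>n. gagliardo_energy s UNIV (\<lambda>x. \<theta> n x - \<eta> x)) \<longlonglongrightarrow> 0"
    unfolding \<theta>_def by (rule cutoff_approximation(2)[OF D s \<eta>m \<eta>(3) fin])
  then have lim: "(\<lambda>n. frac_form s u (\<theta> n)) \<longlonglongrightarrow> frac_form s u \<eta>"
    by (intro frac_form_tendsto) (use fin ufin in auto)
  have "frac_form s u (\<theta> n) \<le> (\<integral>x. g x * \<eta> x \<partial>lebesgue_on D)" if n: "1 \<le> n" for n
  proof -
    define K where "K = {x. 1 / real n \<le> infdist x (- D)}"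
    have KD: "K \<subseteq> D"
    proof
      fix x assume x: "x \<in> K"
      have "0 < 1 / real n" using n by simp
      moreover have "1 / real n \<le> infdist x (- D)" using x by (simp add: K_def)
      ultimately have "0 < infdist x (- D)" by (rule order_less_le_trans)
      then show "x \<in> D" using infdist_zero[of x "- D"] by (cases "x \<in> D") auto
    qed
    have "closed K" unfolding K_def by (intro closed_Collect_le continuous_intros)
    moreover have "bounded K" using KD D(2) by (rule bounded_subset[rotated])
    ultimately have K: "compact K" by (simp add: compact_eq_bounded_closed)
    have \<theta>0: "\<theta> n x = 0" if "x \<notin> K" for x
    proof -
      have "real n * infdist x (- D) \<le> 1" using that n by (simp add: K_def field_simps not_le)
      then show ?thesis by (simp add: \<theta>_def cutoff_def)
    qed
    have "gagliardo_energy s UNIV (\<lambda>x. (\<theta> n x - \<eta> x) + \<eta> x)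
        \<le> 2 * gagliardo_energy s UNIV (\<lambda>x. \<theta> n x - \<eta> x) + 2 * gagliardo_energy s UNIV \<eta>"
      by (rule gagliardo_energy_add_le) measurable
    also have "\<dots> < \<infinity>" using diff fin by (simp add: ennreal_mult_less_top)
    finally have \<theta>fin: "gagliardo_energy s UNIV (\<theta> n) < \<infinity>" by simp
    have \<theta>B: "\<theta> n x \<le> B" for x using \<theta>(2)[of n x] \<eta>(2)[of x] by linarith
    note W = weak_equation_compact_support[OF D(1) s(1) assms(6) ufin g(1,2) weak \<theta>m \<theta>(1) \<theta>B \<theta>0 K KD \<theta>fin]
    have "AE x in lebesgue_on D. g x * \<theta> n x \<le> g x * \<eta> x"
    proof -
      have "AE x in lebesgue_on D. 0 \<le> g x" using g(3) D' by (simp add: AE_restrict_space_iff)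
      then show ?thesis by eventually_elim (simp add: mult_left_mono \<theta>(2))
    qed
    then have "(\<integral>x. g x * \<theta> n x \<partial>lebesgue_on D) \<le> (\<integral>x. g x * \<eta> x \<partial>lebesgue_on D)"
      using W(2) int by (intro integral_mono_AE) auto
    then show ?thesis using W(1) by simp
  qed
  then show ?thesis
    using lim by (intro LIMSEQ_le_const2[OF lim]) auto
qed


section \<open>Powers of a truncation\<close>

lemma powr_diff_le:
  fixes a b p :: real
  assumes "0 \<le> b" "b \<le> a" "1 \<le> p"
  shows "a powr p - b powr p \<le> p * a powr (p - 1) * (a - b)"
proof (cases "b = 0 \<or> a = b")
  case True
  moreover have "a powr p \<le> p * a powr (p - 1) * a"
  proof (cases "a = 0")
    case False
    then have a: "0 < a" using assms by simp
    then have "a powr p = a powr (p - 1) * a" by (simp add: powr_diff)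
    also have "\<dots> \<le> p * (a powr (p - 1) * a)"
      using assms(3) a mult_right_mono[of 1 p "a powr (p - 1) * a"] by simp
    finally show ?thesis by (simp add: mult.assoc)
  qed simp
  ultimately show ?thesis by auto
next
  case False
  then have ab: "0 < b" "b < a" using assms by auto
  have "\<exists>z. b < z \<and> z < a \<and> a powr p - b powr p = (a - b) * (p * z powr (p - 1))"
  proof (rule MVT2[OF ab(2)])
    fix x assume "b \<le> x" "x \<le> a"
    then show "((\<lambda>x. x powr p) has_real_derivative p * x powr (p - 1)) (at x)"
      using ab by (intro has_real_derivative_powr) linarith
  qed
  then obtain z where z: "b < z" "z < a" "a powr p - b powr p = (a - b) * (p * z powr (p - 1))"
    by blast
  have "z powr (p - 1) \<le> a powr (p - 1)" using z ab assms(3) by (intro powr_mono2) auto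
  then have "(a - b) * (p * z powr (p - 1)) \<le> (a - b) * (p * a powr (p - 1))"
    using ab assms(3) by (intro mult_left_mono) auto
  then show ?thesis unfolding z(3) by (simp add: mult_ac)
qed

lemma truncated_powr_lipschitz:
  fixes a b p k :: real
  assumes ab: "0 \<le> a" "0 \<le> b" and p: "1 \<le> p" and k: "0 \<le> k"
  shows "\<bar>min a k powr p - min b k powr p\<bar> \<le> p * k powr (p - 1) * \<bar>a - b\<bar>"
proof -
  have *: "\<bar>min a k powr p - min b k powr p\<bar> \<le> p * k powr (p - 1) * \<bar>a - b\<bar>"
    if "b \<le> a" "0 \<le> b" for a b :: real
  proof -
    have m: "0 \<le> min b k" "min b k \<le> min a k" using that k by auto
    have "min b k powr p \<le> min a k powr p" using m p by (intro powr_mono2) auto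
    then have "\<bar>min a k powr p - min b k powr p\<bar> = min a k powr p - min b k powr p" by simp
    also have "\<dots> \<le> p * min a k powr (p - 1) * (min a k - min b k)" by (rule powr_diff_le[OF m p])
    also have "\<dots> \<le> p * k powr (p - 1) * \<bar>a - b\<bar>"
      using m p that k by (intro mult_mono powr_mono2 mult_nonneg_nonneg) auto
    finally show ?thesis .
  qed
  show ?thesis
    using *[of b a] *[of a b] ab by (cases "b \<le> a") (simp_all add: abs_minus_commute)
qed

text \<open>
  The convexity inequality behind the comparison: \<open>\<Phi>(a) - \<Phi>(b) \<le> \<Phi>'(a) (a - b)\<close> for
  \<open>\<Phi>(t) = t powr (\<gamma> + 1)\<close>, multiplied by \<open>\<Phi>(a) - \<Phi>(b)\<close>; monotonicity takes care of the truncation.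
\<close>

lemma truncated_powr_convexity:
  fixes a b \<gamma> k :: real
  assumes ab: "0 \<le> a" "0 \<le> b" and \<gamma>: "0 < \<gamma>" and k: "0 \<le> k"
  shows "(min a k powr (\<gamma> + 1) - min b k powr (\<gamma> + 1))\<^sup>2
    \<le> (\<gamma> + 1) * ((a - b) * (min a k powr (2 * \<gamma> + 1) - min b k powr (2 * \<gamma> + 1)))"
proof -
  have *: "(min a k powr (\<gamma> + 1) - min b k powr (\<gamma> + 1))\<^sup>2
    \<le> (\<gamma> + 1) * ((a - b) * (min a k powr (2 * \<gamma> + 1) - min b k powr (2 * \<gamma> + 1)))"
    if "b \<le> a" "0 \<le> b" for a b :: real
  proof -
    define A where "A = min a k"
    define B where "B = min b k"
    have AB: "0 \<le> B" "B \<le> A" "A - B \<le> a - b" using that k by (auto simp: A_def B_def)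
    have mono: "B powr r \<le> A powr r" if "0 \<le> r" for r using AB that by (intro powr_mono2) auto
    let ?d = "A powr (\<gamma> + 1) - B powr (\<gamma> + 1)"
    have d0: "0 \<le> ?d" using mono[of "\<gamma> + 1"] \<gamma> by simp
    have "?d \<le> (\<gamma> + 1) * A powr \<gamma> * (A - B)"
      using powr_diff_le[OF AB(1,2), of "\<gamma> + 1"] \<gamma> by simp
    then have "?d * ?d \<le> ((\<gamma> + 1) * A powr \<gamma> * (A - B)) * ?d"
      using d0 by (rule mult_right_mono)
    also have "\<dots> = (\<gamma> + 1) * ((A - B) * (A powr \<gamma> * ?d))" by (simp add: mult_ac)
    also have "A powr \<gamma> * ?d = A powr (2 * \<gamma> + 1) - A powr \<gamma> * B powr (\<gamma> + 1)"
      by (simp add: right_diff_distrib powr_add[symmetric])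
    also have "(\<gamma> + 1) * ((A - B) * (A powr (2 * \<gamma> + 1) - A powr \<gamma> * B powr (\<gamma> + 1)))
        \<le> (\<gamma> + 1) * ((A - B) * (A powr (2 * \<gamma> + 1) - B powr (2 * \<gamma> + 1)))"
    proof -
      have "B powr \<gamma> * B powr (\<gamma> + 1) \<le> A powr \<gamma> * B powr (\<gamma> + 1)"
        using mono[of \<gamma>] \<gamma> by (intro mult_right_mono) auto
      then have "B powr (2 * \<gamma> + 1) \<le> A powr \<gamma> * B powr (\<gamma> + 1)"
        by (simp add: powr_add[symmetric])
      then show ?thesis using AB \<gamma> by (intro mult_left_mono) auto
    qed
    also have "\<dots> \<le> (\<gamma> + 1) * ((a - b) * (A powr (2 * \<gamma> + 1) - B powr (2 * \<gamma> + 1)))"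
      using AB \<gamma> mono[of "2 * \<gamma> + 1"] by (intro mult_left_mono mult_right_mono) auto
    finally show ?thesis by (simp add: A_def B_def power2_eq_square)
  qed
  show ?thesis
  proof (cases "b \<le> a")
    case True
    then show ?thesis using * ab by simp
  next
    case False
    then show ?thesis
      using *[of a b] ab by (simp add: power2_commute algebra_simps)
  qed
qed

section \<open>The comparison theorem\<close>

text \<open>
  On a bounded set the weight in Hardy's inequality is bounded from below.
\<close>

lemma fractional_Poincare:
  fixes D :: "'a::euclidean_space set"
  assumes D: "open D" "bounded D" "lipschitz_boundary D" and s: "0 < s"
    and [measurable]: "w \<in> borel_measurable borel" and w0: "\<And>x. x \<notin> D \<Longrightarrow> w x = 0"
    and fin: "gagliardo_energy s UNIV w < \<infinity>"
  shows "(\<integral>\<^sup>+x. ennreal ((w x)\<^sup>2) \<partial>lborel) < \<infinity>"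
proof -
  obtain C where C: "0 \<le> C" "\<forall>\<eta>\<in>borel_measurable borel. (\<forall>x. x \<notin> D \<longrightarrow> \<eta> x = 0) \<longrightarrow>
    (\<integral>\<^sup>+x. ennreal ((\<eta> x)\<^sup>2 * infdist x (- D) powr (- 2 * s)) \<partial>lborel) \<le> ennreal C * gagliardo_energy s UNIV \<eta>"
    by (rule fractional_Hardy[OF D s]) (rule that)
  obtain z0 where z0: "z0 \<notin> D" using D(2) not_bounded_UNIV by (metis UNIV_I UNIV_eq_I)
  obtain R where R: "0 < R" "\<And>x. x \<in> D \<Longrightarrow> norm x \<le> R" using D(2) unfolding bounded_pos by blast
  define m where "m = R + norm z0"
  have m: "0 < m" using R by (simp add: m_def add_pos_nonneg)
  have pw: "(w x)\<^sup>2 \<le> m powr (2 * s) * ((w x)\<^sup>2 * infdist x (- D) powr (- 2 * s))" for x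
  proof (cases "x \<in> D")
    case True
    have "infdist x (- D) \<le> dist x z0" using z0 by (intro infdist_le) simp
    also have "\<dots> \<le> m" using R(2)[OF True] norm_triangle_ineq4[of x z0] by (simp add: m_def dist_norm)
    finally have dm: "infdist x (- D) \<le> m" .
    have d: "0 < infdist x (- D)" by (rule infdist_compl_pos[OF D(1,2) True])
    have "m powr (- 2 * s) \<le> infdist x (- D) powr (- 2 * s)" using dm d s by (intro powr_mono2') auto
    then have "m powr (2 * s) * m powr (- 2 * s) \<le> m powr (2 * s) * infdist x (- D) powr (- 2 * s)"
      by (rule mult_left_mono) simp
    then have "1 \<le> m powr (2 * s) * infdist x (- D) powr (- 2 * s)"
      using m by (simp add: powr_add[symmetric])
    from mult_left_mono[OF this, of "(w x)\<^sup>2"] show ?thesis by (simp add: mult_ac)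
  qed (simp add: w0)
  have [measurable]: "(\<lambda>x. infdist x (- D)) \<in> borel_measurable borel"
    by (intro borel_measurable_continuous_onI continuous_intros)
  have "(\<integral>\<^sup>+x. ennreal ((w x)\<^sup>2) \<partial>lborel)
      \<le> (\<integral>\<^sup>+x. ennreal (m powr (2 * s)) * ennreal ((w x)\<^sup>2 * infdist x (- D) powr (- 2 * s)) \<partial>lborel)"
  proof (rule nn_integral_mono)
    fix x
    show "ennreal ((w x)\<^sup>2) \<le> ennreal (m powr (2 * s)) * ennreal ((w x)\<^sup>2 * infdist x (- D) powr (- 2 * s))"
      using ennreal_leI[OF pw[of x]] by (subst ennreal_mult'[symmetric]) simp_all
  qed
  also have "\<dots> = ennreal (m powr (2 * s)) * (\<integral>\<^sup>+x. ennreal ((w x)\<^sup>2 * infdist x (- D) powr (- 2 * s)) \<partial>lborel)"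
    by (rule nn_integral_cmult) measurable
  also have "\<dots> \<le> ennreal (m powr (2 * s)) * (ennreal C * gagliardo_energy s UNIV w)"
    using C(2) w0 by (intro mult_left_mono) auto
  also have "\<dots> < \<infinity>" using fin by (simp add: ennreal_mult_less_top)
  finally show ?thesis .
qed

lemma Lp_imp_integrable:
  assumes "f \<in> Lp p D" "1 \<le> p" "D \<in> lmeasurable"
  shows "integrable (lebesgue_on D) f"
proof -
  interpret finite_measure "lebesgue_on D" using assms(3) by (rule finite_measure_lebesgue_on)
  have f: "f \<in> borel_measurable (lebesgue_on D)" "integrable (lebesgue_on D) (\<lambda>x. \<bar>f x\<bar> powr p)"
    using assms(1) by (auto simp: Lp_def)
  show ?thesis
  proof (rule Bochner_Integration.integrable_bound[OF _ f(1)])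
    show "integrable (lebesgue_on D) (\<lambda>x. 1 + \<bar>f x\<bar> powr p)" using f(2) by simp
    have "\<bar>f x\<bar> \<le> 1 + \<bar>f x\<bar> powr p" for x
    proof (cases "1 \<le> \<bar>f x\<bar>")
      case True
      then have "\<bar>f x\<bar> powr 1 \<le> \<bar>f x\<bar> powr p" using assms(2) by (intro powr_mono) auto
      then show ?thesis using True by simp
    next
      case False
      moreover have "0 \<le> \<bar>f x\<bar> powr p" by simp
      ultimately show ?thesis by linarith
    qed
    then show "AE x in lebesgue_on D. norm (f x) \<le> norm (1 + \<bar>f x\<bar> powr p)" by (intro AE_I2) simp
  qed
qed

lemma frac_form_cong_AE:
  assumes [measurable]: "u \<in> borel_measurable lebesgue" "u' \<in> borel_measurable lebesgue" "\<phi> \<in> borel_measurable lebesgue"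
    and eq: "AE x in lebesgue. u x = u' x"
  shows "frac_form s u \<phi> = frac_form s u' \<phi>"
proof -
  have "(\<integral>z. increment u z * increment \<phi> z \<partial>gagliardo_measure s) = (\<integral>z. increment u' z * increment \<phi> z \<partial>gagliardo_measure s)"
  proof (rule integral_cong_AE)
    show "AE z in gagliardo_measure s. increment u z * increment \<phi> z = increment u' z * increment \<phi> z"
      using AE_gagliardo_measure[OF eq] by eventually_elim (simp add: increment_def)
  qed measurable
  then show ?thesis by (simp add: frac_form_eq_integral)
qed

text \<open>
  The bound for a truncation \<open>min u k\<close>. Testing the singular equation with \<open>min u k powr (2 \<gamma> + 1)\<close>
  replaces the singular right-hand side by \<open>f\<close>; testing the linear equation with the rearrangement of
  \<open>min u k powr (\<gamma> + 1)\<close> closes the estimate.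
\<close>

lemma truncated_energy_comparison:
  fixes D :: "'a::euclidean_space set"
  assumes s: "0 < s" "s < 1" and \<gamma>: "0 < \<gamma>"
    and D: "open D" "bounded D" "lipschitz_boundary D"
    and f: "integrable (lebesgue_on D) f" "AE x in lebesgue. x \<in> D \<longrightarrow> 0 \<le> f x"
    and u: "u \<in> borel_measurable lebesgue" "gagliardo_energy s UNIV u < \<infinity>"
    and sol: "singular_weak_solution s \<gamma> D f u"
    and v: "v \<in> X0s s (schwarz_ball D)"
    and lin: "linear_weak_solution s (schwarz_ball D) (\<lambda>x. (\<gamma> + 1) * schwarz_rearrangement D f x) v"
    and b [measurable]: "b \<in> borel_measurable borel" and b0: "\<And>x. 0 \<le> b x" "\<And>x. x \<notin> D \<Longrightarrow> b x = 0"
    and ub: "AE x in lebesgue. u x = b x" and k: "0 \<le> k"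
  shows "gagliardo_energy s UNIV (\<lambda>x. min (b x) k powr (\<gamma> + 1)) \<le> gagliardo_energy s UNIV v"
proof -
  let ?C = "C_frac DIM('a) s"
  have C: "0 < ?C" by (rule C_frac_pos[OF s])
  have bl: "h \<in> borel_measurable lebesgue" if "h \<in> borel_measurable borel" for h :: "'a \<Rightarrow> real"
    by (rule measurable_completion) (use that in simp)
  note [measurable] = u(1) bl[OF b]
  have D' [measurable]: "D \<in> sets lebesgue" using D by auto
  have Dm: "D \<in> lmeasurable" using D by (auto intro: bounded_set_imp_lmeasurable)
  have vm [measurable]: "v \<in> borel_measurable lebesgue" and vfin: "gagliardo_energy s UNIV v < \<infinity>"
    using v by (auto simp: X0s_def Hs_def Lp_def lebesgue_on_UNIV_eq)
  define w where "w x = min (b x) k powr (\<gamma> + 1)" for x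
  define \<eta> where "\<eta> x = min (b x) k powr (2 * \<gamma> + 1)" for x
  have wm [measurable]: "w \<in> borel_measurable borel" and \<eta>m [measurable]: "\<eta> \<in> borel_measurable borel"
    unfolding w_def \<eta>_def by measurable
  note [measurable] = bl[OF wm] bl[OF \<eta>m]
  have w: "0 \<le> w x" "w x \<le> k powr (\<gamma> + 1)" "x \<notin> D \<Longrightarrow> w x = 0" for x
    using b0 k \<gamma> by (auto simp: w_def intro!: powr_mono2)
  have \<eta>: "0 \<le> \<eta> x" "\<eta> x \<le> k powr (2 * \<gamma> + 1)" "x \<notin> D \<Longrightarrow> \<eta> x = 0" for x
    using b0 k \<gamma> by (auto simp: \<eta>_def intro!: powr_mono2)
  have bfin: "gagliardo_energy s UNIV b < \<infinity>"
    using gagliardo_energy_cong_AE[OF _ _ ub, of s] u(2) by simp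
  have comp_fin: "gagliardo_energy s UNIV (\<lambda>x. min (b x) k powr p) < \<infinity>" if p: "1 \<le> p" for p
  proof -
    have "gagliardo_energy s UNIV (\<lambda>x. min (b x) k powr p) \<le> ennreal ((p * k powr (p - 1))\<^sup>2) * gagliardo_energy s UNIV b"
      by (rule gagliardo_energy_mono_AE[where P="\<lambda>_. True"])
        (use truncated_powr_lipschitz[OF b0(1) b0(1) p k] in auto)
    also have "\<dots> < \<infinity>" using bfin by (simp add: ennreal_mult_less_top)
    finally show ?thesis .
  qed
  have wfin: "gagliardo_energy s UNIV w < \<infinity>" and \<eta>fin: "gagliardo_energy s UNIV \<eta> < \<infinity>"
    using comp_fin[of "\<gamma> + 1"] comp_fin[of "2 * \<gamma> + 1"] \<gamma> by (simp_all add: w_def[abs_def] \<eta>_def[abs_def])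
  define Ew where "Ew = enn2real (gagliardo_energy s UNIV w)"
  define Ev where "Ev = enn2real (gagliardo_energy s UNIV v)"
  \<comment> \<open>integrate \<open>truncated_powr_convexity\<close> against the kernel\<close>
  have step1: "?C / 2 * Ew \<le> (\<gamma> + 1) * frac_form s u \<eta>"
  proof -
    let ?P = "\<lambda>z. increment b z * increment \<eta> z"
    have int: "integrable (gagliardo_measure s) ?P"
      by (rule sq_norm_product(1)) (use bfin \<eta>fin in \<open>auto simp: gagliardo_energy_eq_sq_norm\<close>)
    have pw: "(increment w z)\<^sup>2 \<le> (\<gamma> + 1) * ?P z" for z
      unfolding increment_def w_def \<eta>_def by (rule truncated_powr_convexity[OF b0(1) b0(1) \<gamma> k])
    have "gagliardo_energy s UNIV w \<le> (\<integral>\<^sup>+z. ennreal ((\<gamma> + 1) * ?P z) \<partial>gagliardo_measure s)"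
      unfolding gagliardo_energy_eq_sq_norm[OF bl[OF wm]] sq_norm_def
      by (intro nn_integral_mono ennreal_leI pw)
    also have "\<dots> = ennreal (\<integral>z. (\<gamma> + 1) * ?P z \<partial>gagliardo_measure s)"
      by (rule nn_integral_eq_integral) (use int in \<open>auto intro!: AE_I2 order_trans[OF zero_le_power2 pw]\<close>)
    also have "(\<integral>z. (\<gamma> + 1) * ?P z \<partial>gagliardo_measure s) = (\<gamma> + 1) * (\<integral>z. ?P z \<partial>gagliardo_measure s)"
      by simp
    finally have le: "gagliardo_energy s UNIV w \<le> ennreal ((\<gamma> + 1) * (\<integral>z. ?P z \<partial>gagliardo_measure s))" .
    have "0 \<le> (\<integral>z. (\<gamma> + 1) * ?P z \<partial>gagliardo_measure s)"
      by (intro integral_nonneg_AE AE_I2 order_trans[OF zero_le_power2 pw])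
    then have "Ew \<le> (\<gamma> + 1) * (\<integral>z. ?P z \<partial>gagliardo_measure s)"
      unfolding Ew_def using enn2real_mono[OF le] by simp
    then have "?C / 2 * Ew \<le> ?C / 2 * ((\<gamma> + 1) * (\<integral>z. ?P z \<partial>gagliardo_measure s))"
      using C by (intro mult_left_mono) auto
    also have "\<dots> = (\<gamma> + 1) * frac_form s b \<eta>"
      by (simp add: frac_form_eq_integral)
    also have "frac_form s b \<eta> = frac_form s u \<eta>"
      using ub by (intro frac_form_cong_AE) (auto elim: eventually_mono)
    finally show ?thesis .
  qed
  define g where "g x = f x / u x powr \<gamma>" for x
  have fm: "f \<in> borel_measurable (lebesgue_on D)" using f(1) by simp
  have rm: "h \<in> borel_measurable (lebesgue_on D)" if "h \<in> borel_measurable lebesgue" for h :: "'a \<Rightarrow> real"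
    using that by (rule measurable_restrict_space1)
  note [measurable] = fm rm[OF u(1)] rm[OF bl[OF wm]] rm[OF bl[OF \<eta>m]]
  have gm [measurable]: "g \<in> borel_measurable (lebesgue_on D)" unfolding g_def by measurable
  have gpos: "AE x in lebesgue. x \<in> D \<longrightarrow> 0 \<le> g x" using f(2) by eventually_elim (simp add: g_def)
  have upos: "AE x in lebesgue. x \<in> D \<longrightarrow> 0 < u x" using sol by (simp add: singular_weak_solution_def)
  have onD: "AE x in lebesgue_on D. P x" if "AE x in lebesgue. x \<in> D \<longrightarrow> P x" for P
    using that D' by (simp add: AE_restrict_space_iff)
  have fw: "integrable (lebesgue_on D) (\<lambda>x. f x * w x)"
    by (rule hardy_littlewood_rearrangement(1)[OF Dm f _ w(1,2)]) measurable
  \<comment> \<open>the truncation absorbs the singularity: \<open>min u k powr \<gamma> \<le> u powr \<gamma>\<close>\<close>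
  have pw2: "AE x in lebesgue_on D. 0 \<le> g x * \<eta> x \<and> g x * \<eta> x \<le> f x * w x"
  proof (rule onD)
    show "AE x in lebesgue. x \<in> D \<longrightarrow> 0 \<le> g x * \<eta> x \<and> g x * \<eta> x \<le> f x * w x"
      using f(2) gpos upos ub
    proof eventually_elim
      case (elim x)
      show ?case
      proof
        assume x: "x \<in> D"
        then have ux: "0 < u x" "0 \<le> f x" "b x = u x" using elim by auto
        have "\<eta> x = min (u x) k powr \<gamma> * w x"
          unfolding \<eta>_def w_def ux(3) by (simp add: powr_add[symmetric])
        also have "\<dots> \<le> u x powr \<gamma> * w x"
          using ux k \<gamma> w(1) by (intro mult_right_mono powr_mono2) auto
        finally have "\<eta> x / u x powr \<gamma> \<le> w x" using ux by (simp add: pos_divide_le_eq mult.commute)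
        then have "f x * (\<eta> x / u x powr \<gamma>) \<le> f x * w x" using ux by (intro mult_left_mono) auto
        then show "0 \<le> g x * \<eta> x \<and> g x * \<eta> x \<le> f x * w x"
          using ux \<eta>(1)[of x] by (simp add: g_def)
      qed
    qed
  qed
  have g\<eta>: "integrable (lebesgue_on D) (\<lambda>x. g x * \<eta> x)"
    by (rule Bochner_Integration.integrable_bound[OF fw]) (use pw2 in \<open>auto elim: eventually_mono\<close>)
  have "frac_form s u \<eta> \<le> (\<integral>x. g x * \<eta> x \<partial>lebesgue_on D)"
  proof (rule weak_inequality_bounded_test[OF D s u gm _ gpos _ \<eta>m \<eta> \<eta>fin g\<eta>])
    show "g \<in> L1_loc D" using sol by (simp add: singular_weak_solution_def g_def[abs_def])
    show "frac_form s u \<phi> = (\<integral>x. g x * \<phi> x \<partial>lebesgue_on D)" if "\<phi> \<in> Cc_infinity D" "\<And>x. 0 \<le> \<phi> x" for \<phi>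
      using sol that by (simp add: singular_weak_solution_def g_def)
  qed
  also have "\<dots> \<le> (\<integral>x. f x * w x \<partial>lebesgue_on D)"
    by (rule integral_mono_AE[OF g\<eta> fw]) (use pw2 in \<open>auto elim: eventually_mono\<close>)
  finally have step2: "frac_form s u \<eta> \<le> (\<integral>x. f x * w x \<partial>lebesgue_on D)" .
  interpret W: rearrangement D w
    by unfold_locales (use Dm in \<open>simp_all add: rm\<close>)
  define ws where "ws = schwarz_rearrangement D w"
  have wsm [measurable]: "ws \<in> borel_measurable borel" unfolding ws_def by measurable
  note [measurable] = bl[OF wsm]
  have superlevel: "{x. t < ws x} = ball 0 (level_radius D w t)" if "0 \<le> t" for t
    unfolding ws_def by (rule W.superlevel_schwarz_rearrangement_bounded[OF that, of "k powr (\<gamma> + 1)"]) (use w in auto)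
  have same: "emeasure lborel {x. t < ws x} = emeasure lborel {x. t < w x}" if t: "0 \<le> t" for t
  proof -
    have "{x \<in> D. t < \<bar>w x\<bar>} = {x. t < w x}"
      using w t by (auto simp: abs_of_nonneg) (metis not_less)
    then show ?thesis
      unfolding ws_def W.emeasure_superlevel_schwarz_rearrangement[OF t] by simp
  qed
  have ws0: "0 \<le> ws x" for x unfolding ws_def by (rule W.schwarz_rearrangement_nonneg)
  obtain R where R: "0 < R" "\<And>x. x \<in> D \<Longrightarrow> norm x < R" using D(2) unfolding bounded_pos_less by blast
  have ws_le: "gagliardo_energy s UNIV ws \<le> gagliardo_energy s UNIV w"
  proof (rule fractional_polya_szego[OF s(1) wm wsm w(1,2) _ R(1) ws0])
    show "w x = 0" if "R \<le> norm x" for x using w(3) R(2) that by (meson not_le)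
    show "\<exists>\<rho>\<ge>0. {x. t < ws x} = ball 0 \<rho>" if "0 \<le> t" for t
      using superlevel[OF that] level_radius_nonneg by blast
  qed (rule same)
  then have wsfin: "gagliardo_energy s UNIV ws < \<infinity>" using wfin by (rule order_le_less_trans)
  \<comment> \<open>so the rearrangement is an admissible test function for the linear equation\<close>
  have wsX: "ws \<in> X0s s (schwarz_ball D)"
  proof -
    have AE0: "AE x in lebesgue. x \<noteq> (0::'a)"
      by (rule AE_completion) (rule AE_lborel_singleton)
    have out: "AE x in lebesgue. x \<notin> schwarz_ball D \<longrightarrow> ws x = 0"
      using AE0 by eventually_elim (simp add: ws_def W.schwarz_rearrangement_outside)
    have bd: "ws x \<le> k powr (\<gamma> + 1)" for x
    proof (rule ccontr)
      assume "\<not> ws x \<le> k powr (\<gamma> + 1)"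
      then have "x \<in> {x. k powr (\<gamma> + 1) < ws x}" by simp
      then have "{x. k powr (\<gamma> + 1) < ws x} \<noteq> {}" by blast
      then have "0 < level_radius D w (k powr (\<gamma> + 1))" using superlevel[of "k powr (\<gamma> + 1)"] by simp
      moreover have "{x \<in> D. k powr (\<gamma> + 1) < \<bar>w x\<bar>} = {}" using w by (auto simp: not_less)
      then have "level_radius D w (k powr (\<gamma> + 1)) = 0" unfolding level_radius_def by (simp only: measure_empty) simp
      ultimately show False by simp
    qed
    have "integrable lborel (\<lambda>x. \<bar>ws x\<bar> powr 2)"
    proof (rule integrableI_bounded_set[of "ball 0 (level_radius D w 0)" _ _ "(k powr (\<gamma> + 1)) powr 2"])
      show "emeasure lborel (ball (0::'a) (level_radius D w 0)) < \<infinity>"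
        using level_radius_nonneg[of D w 0] by (simp add: emeasure_ball)
      show "AE x in lborel. x \<in> ball 0 (level_radius D w 0) \<longrightarrow> norm (\<bar>ws x\<bar> powr 2) \<le> (k powr (\<gamma> + 1)) powr 2"
        using bd ws0 by (intro AE_I2) (auto intro!: powr_mono2)
      have "ws x = 0" if "x \<notin> ball 0 (level_radius D w 0)" for x
        using that ws0[of x] unfolding superlevel[OF order_refl, symmetric] by simp
      then show "AE x in lborel. x \<notin> ball 0 (level_radius D w 0) \<longrightarrow> \<bar>ws x\<bar> powr 2 = 0" by auto
    qed auto
    then have "integrable lebesgue (\<lambda>x. \<bar>ws x\<bar> powr 2)"
      by (subst integrable_completion) auto
    then show ?thesis
      using wsfin out by (simp add: X0s_def Hs_def Lp_def lebesgue_on_UNIV_eq bl[OF wsm])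
  qed
  have "(\<gamma> + 1) * (\<integral>x. f x * w x \<partial>lebesgue_on D)
      \<le> (\<gamma> + 1) * (\<integral>x. schwarz_rearrangement D f x * ws x \<partial>lebesgue_on (schwarz_ball D))"
    unfolding ws_def using \<gamma>
    by (intro mult_left_mono hardy_littlewood_rearrangement(2)[OF Dm f _ w(1,2)]) (simp_all add: rm)
  also have "\<dots> = (\<integral>x. (\<gamma> + 1) * schwarz_rearrangement D f x * ws x \<partial>lebesgue_on (schwarz_ball D))"
    by (simp add: mult.assoc)
  also have "\<dots> = frac_form s v ws"
    using lin wsX by (simp add: linear_weak_solution_def)
  also have "\<dots> \<le> ?C / 4 * (Ev + enn2real (gagliardo_energy s UNIV ws))"
    unfolding Ev_def by (rule frac_form_le_energies) (use vfin wsfin s in auto)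
  also have "\<dots> \<le> ?C / 4 * (Ev + Ew)"
    unfolding Ew_def using C ws_le wfin by (intro mult_left_mono add_left_mono enn2real_mono) auto
  finally have step3: "(\<gamma> + 1) * (\<integral>x. f x * w x \<partial>lebesgue_on D) \<le> ?C / 4 * (Ev + Ew)" .
  have "?C / 2 * Ew \<le> (\<gamma> + 1) * (\<integral>x. f x * w x \<partial>lebesgue_on D)"
    using step1 mult_left_mono[OF step2, of "\<gamma> + 1"] \<gamma> by linarith
  with step3 have "?C / 4 * (2 * Ew) \<le> ?C / 4 * (Ev + Ew)" by linarith
  then have "2 * Ew \<le> Ev + Ew" using C by (simp add: mult_le_cancel_left_pos)
  then have "Ew \<le> Ev" by simp
  then have "ennreal Ew \<le> ennreal Ev" by (rule ennreal_leI)
  moreover have "ennreal Ew = gagliardo_energy s UNIV w" "ennreal Ev = gagliardo_energy s UNIV v"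
    using wfin vfin by (simp_all add: Ew_def Ev_def)
  ultimately have "gagliardo_energy s UNIV w \<le> gagliardo_energy s UNIV v" by (simp only:)
  then show ?thesis by (simp only: w_def[abs_def])
qed

theorem proposition5p1:
  fixes s \<gamma> :: real
    and \<Omega> :: "(real ^ 'n) set"
    and f u v :: "real ^ 'n \<Rightarrow> real"
  assumes "0 < s" and "s < 1"
    and "CARD('n) \<ge> 2"
    and "\<gamma> > 0"
    and "open \<Omega>" and "bounded \<Omega>" and "lipschitz_boundary \<Omega>"
    and "f \<in> Lp (2 * real CARD('n) / (real CARD('n) + 2 * s)) \<Omega>"
    and "AE x in lebesgue. x \<in> \<Omega> \<longrightarrow> f x \<ge> 0"
    and "u \<in> X0s s \<Omega>" and "singular_weak_solution s \<gamma> \<Omega> f u"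
    and "v \<in> X0s s (schwarz_ball \<Omega>)"
    and "linear_weak_solution s (schwarz_ball \<Omega>)
           (\<lambda>x. (\<gamma> + 1) * schwarz_rearrangement \<Omega> f x) v"
  shows "(\<lambda>x. u x powr (\<gamma> + 1)) \<in> X0s s \<Omega> \<and>
         X0s_norm s (\<lambda>x. u x powr (\<gamma> + 1)) \<le> X0s_norm s v"
proof -
  note s = assms(1,2) and \<gamma> = assms(4) and \<Omega> = assms(5-7)
  have bl: "h \<in> borel_measurable lebesgue" if "h \<in> borel_measurable borel" for h :: "real ^ 'n \<Rightarrow> real"
    by (rule measurable_completion) (use that in simp)
  have um [measurable]: "u \<in> borel_measurable lebesgue" and ufin: "gagliardo_energy s UNIV u < \<infinity>"
    and u0: "AE x in lebesgue. x \<notin> \<Omega> \<longrightarrow> u x = 0"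
    using assms(10) by (auto simp: X0s_def Hs_def Lp_def lebesgue_on_UNIV_eq)
  have vfin: "gagliardo_energy s UNIV v < \<infinity>"
    using assms(12) by (auto simp: X0s_def Hs_def)
  have upos: "AE x in lebesgue. x \<in> \<Omega> \<longrightarrow> 0 < u x"
    using assms(11) by (simp add: singular_weak_solution_def)
  obtain b0 where b0 [measurable]: "b0 \<in> borel_measurable borel" and ub0: "AE x in lborel. u x = b0 x"
    using completion_ex_borel_measurable_real[OF um] by auto
  define b where "b x = indicator \<Omega> x * max 0 (b0 x)" for x
  have [measurable]: "\<Omega> \<in> sets borel" using \<Omega>(1) by simp
  have bm [measurable]: "b \<in> borel_measurable borel" unfolding b_def by measurable
  have b: "0 \<le> b x" "x \<notin> \<Omega> \<Longrightarrow> b x = 0" for x by (auto simp: b_def)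
  have ub: "AE x in lebesgue. u x = b x"
    using AE_completion[OF ub0] u0 upos by eventually_elim (auto simp: b_def split: split_indicator)
  have fint: "integrable (lebesgue_on \<Omega>) f"
  proof (rule Lp_imp_integrable[OF assms(8)])
    have "real CARD('n) + 2 * s \<le> 2 * real CARD('n)" using assms(2,3) by linarith
    then show "1 \<le> 2 * real CARD('n) / (real CARD('n) + 2 * s)"
      using s by (subst pos_le_divide_eq) auto
    show "\<Omega> \<in> lmeasurable" using \<Omega> by (auto intro: bounded_set_imp_lmeasurable)
  qed
  define w where "w x = b x powr (\<gamma> + 1)" for x
  have wm [measurable]: "w \<in> borel_measurable borel" unfolding w_def by measurable
  have w0: "w x = 0" if "x \<notin> \<Omega>" for x using b(2)[OF that] by (simp add: w_def)
  have wE: "gagliardo_energy s UNIV w \<le> gagliardo_energy s UNIV v"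
  proof (rule gagliardo_energy_Fatou)
    show "gagliardo_energy s UNIV (\<lambda>x. min (b x) (real n) powr (\<gamma> + 1)) \<le> gagliardo_energy s UNIV v" for n
      by (rule truncated_energy_comparison[OF s \<gamma> \<Omega> fint assms(9) um ufin assms(11-13) bm b ub]) auto
    show "(\<lambda>x. min (b x) (real n) powr (\<gamma> + 1)) \<in> borel_measurable lebesgue" for n
      by (rule bl) measurable
    show "w \<in> borel_measurable lebesgue" by (rule bl) measurable
    show "AE x in lebesgue. (\<lambda>n. min (b x) (real n) powr (\<gamma> + 1)) \<longlonglongrightarrow> w x"
    proof (rule AE_I2)
      fix x
      obtain n0 :: nat where n0: "b x \<le> real n0" using real_arch_simple by blast
      have "min (b x) (real n) powr (\<gamma> + 1) = w x" if "n \<ge> n0" for n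
      proof -
        have "b x \<le> real n" using n0 that by linarith
        then show ?thesis by (simp add: w_def)
      qed
      then show "(\<lambda>n. min (b x) (real n) powr (\<gamma> + 1)) \<longlonglongrightarrow> w x"
        by (intro tendsto_eventually) (auto simp: eventually_sequentially)
    qed
  qed
  then have wfin: "gagliardo_energy s UNIV w < \<infinity>" using vfin by (rule order_le_less_trans)
  define U where "U x = u x powr (\<gamma> + 1)" for x
  have Um [measurable]: "U \<in> borel_measurable lebesgue" unfolding U_def by measurable
  have Uw: "AE x in lebesgue. U x = w x" using ub by eventually_elim (simp add: U_def w_def)
  have UE: "gagliardo_energy s UNIV U = gagliardo_energy s UNIV w"
    by (rule gagliardo_energy_cong_AE[OF Um bl[OF wm] Uw])
  have "integrable lebesgue (\<lambda>x. \<bar>U x\<bar> powr 2)"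
  proof -
    have "integrable lborel (\<lambda>x. (w x)\<^sup>2)"
      by (rule integrableI_bounded) (use fractional_Poincare[OF \<Omega> s(1) wm w0 wfin] in auto)
    then have "integrable lebesgue (\<lambda>x. (w x)\<^sup>2)" by (subst integrable_completion) auto
    moreover have "integrable lebesgue (\<lambda>x. \<bar>U x\<bar> powr 2) \<longleftrightarrow> integrable lebesgue (\<lambda>x. (w x)\<^sup>2)"
    proof (rule integrable_cong_AE)
      show "(\<lambda>x. (w x)\<^sup>2) \<in> borel_measurable lebesgue" by (rule bl) measurable
      show "AE x in lebesgue. \<bar>U x\<bar> powr 2 = (w x)\<^sup>2" using Uw by eventually_elim simp
    qed measurable
    ultimately show ?thesis by simp
  qed
  moreover have "AE x in lebesgue. x \<notin> \<Omega> \<longrightarrow> U x = 0"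
    using Uw by eventually_elim (simp add: w0)
  ultimately have "U \<in> X0s s \<Omega>"
    using wfin UE by (simp add: X0s_def Hs_def Lp_def lebesgue_on_UNIV_eq)
  moreover have "X0s_norm s U \<le> X0s_norm s v"
    unfolding X0s_norm_def gagliardo_seminorm_def UE
    using wE vfin by (intro real_sqrt_le_mono enn2real_mono) auto
  ultimately show ?thesis by (simp add: U_def[abs_def])
qed

end
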